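(* Let $d,m\in\mathbb{N}$, $L,T\in(0,\infty)$, let $\langle\cdot,\cdot\rangle$ and $\|\cdot\|$ be the standard Euclidean scalar product and norm on $\mathbb{R}^d$, let $|\!|\!|\cdot|\!|\!|$ be the Frobenius norm on $\mathbb{R}^{d\times m}$, let $\mathcal{O}\subseteq\mathbb{R}^d$ be a non-empty open set, for every $r\in(0,\infty)$ let $O_r=\{x\in\mathcal{O}\colon\|x\|\le r\text{ and }\{y\in\mathbb{R}^d\colon\|y-x\|<1/r\}\subseteq\mathcal{O}\}$, let $\mu\in C([0,T]\times\mathcal{O},\mathbb{R}^d)$, $\sigma\in C([0,T]\times\mathcal{O},\mathbb{R}^{d\times m})$, $f\in C([0,T]\times\mathcal{O}\times\mathbb{R},\mathbb{R})$, $g\in C(\mathcal{O},\mathbb{R})$, $V\in C^{1,2}([0,T]\times\mathcal{O},(0,\infty))$. Assume for all $r\in(0,\infty)$ that $$\sup\left(\left\{\frac{\|\mu(t,x)-\mu(t,y)\|+|\!|\!|\sigma(t,x)-\sigma(t,y)|\!|\!|}{\|x-y\|}\colon t\in[0,T],\ x,y\in O_r,\ x\ne y\right\}\cup\{0\}\right)<\infty,$$ assume for all $t\in[0,T]$, $x\in\mathcal{O}$, $v,w\in\mathbb{R}$ that $(f(t,x,v)-f(t,x,w))(v-w)\le L|v-w|^2$, $\limsup_{r\to\infty}\left[\sup_{s\in[0,T]}\sup_{y\in\mathcal{O}\setminus O_r}\frac{|f(s,y,0)|}{V(s,y)}\right]=0$, and $$\left(\tfrac{\partial}{\partial t}V\right)(t,x)+\tfrac12\operatorname{Trace}\left(\sigma(t,x)[\sigma(t,x)]^*(\operatorname{Hess}_xV)(t,x)\right)+\langle\mu(t,x),(\nabla_xV)(t,x)\rangle\le0,$$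 and let $u_1,u_2\in\left\{\mathbf{u}\in C([0,T]\times\mathcal{O},\mathbb{R})\colon\limsup_{r\to\infty}\left[\sup_{t\in[0,T]}\sup_{x\in\mathcal{O}\setminus O_r}\frac{|\mathbf{u}(t,x)|}{V(t,x)}\right]=0\right\}$ satisfy for all $i\in\{1,2\}$ that $u_i$ is a viscosity solution of $$\left(\tfrac{\partial}{\partial t}u_i\right)(t,x)+\tfrac12\operatorname{Trace}\left(\sigma(t,x)[\sigma(t,x)]^*(\operatorname{Hess}_xu_i)(t,x)\right)+\langle\mu(t,x),(\nabla_xu_i)(t,x)\rangle+f(t,x,u_i(t,x))=0$$ with $u_i(T,x)=g(x)$ for $(t,x)\in(0,T)\times\mathcal{O}$. Then for all $t\in[0,T]$, $x\in\mathcal{O}$ we have $u_1(t,x)=u_2(t,x)$.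
   Context: $C^{1,2}$ denotes functions that are once continuously differentiable in the time variable and twice continuously differentiable in the space variable. Viscosity solutions. Let $\mathbb{S}_d=\{A\in\mathbb{R}^{d\times d}\colon A^*=A\}$. A function $G\colon(0,T)\times\mathcal{O}\times\mathbb{R}\times\mathbb{R}^d\times\mathbb{S}_d\to\mathbb{R}$ is degenerate elliptic if $G(t,x,r,p,A)\le G(t,x,r,p,B)$ whenever $\langle Ay,y\rangle\le\langle By,y\rangle$ for all $y\in\mathbb{R}^d$. A function $u$ defined on a set containing $(0,T)\times\mathcal{O}$ is a viscosity subsolution (resp. supersolution) of $(\frac{\partial}{\partial t}u)(t,x)+G(t,x,u(t,x),(\nabla_xu)(t,x),(\operatorname{Hess}_xu)(t,x))=0$ for $(t,x)\in(0,T)\times\mathcal{O}$ if $u$ is real-valued and upper (resp. lower) semi-continuous on its domain and for all $t\in(0,T)$, $x\in\mathcal{O}$, $\phi\in C^{1,2}((0,T)\times\mathcal{O},\mathbb{R})$ with $\phi(t,x)=u(t,x)$ and $\phi\ge u$ (resp. $\phi\le u$) on $(0,T)\times\mathcal{O}$ it holds that $(\frac{\partial}{\partial t}\phi)(t,x)+G(t,x,\phi(t,x),(\nabla_x\phi)(t,x),(\operatorname{Hess}_x\phi)(t,x))\ge0$ (resp. $\le0$). A viscosity solution is a function which is both a viscosity subsolution and a viscosity supersolution. Here $G(t,x,r,p,A)=\frac12\operatorname{Trace}(\sigma(t,x)[\sigma(t,x)]^*A)+\langle\mu(t,x),p\rangle+f(t,x,r)$. *)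

theory Defs
  imports "HOL-Analysis.Analysis"
begin

text \<open>
  Functions of time and space are curried, with space \<^typ>\<open>real^'d\<close>. A \<open>d \<times> m\<close> matrix has type
  \<^typ>\<open>real^'m^'d\<close>; the library norm on this type is the Frobenius norm.
\<close>

text \<open>The derivative within \<open>I\<close> is one-sided at endpoints of \<open>I\<close> that belong to \<open>I\<close>.\<close>

definition time_deriv :: "real set \<Rightarrow> (real \<Rightarrow> real^'d \<Rightarrow> real) \<Rightarrow> real \<Rightarrow> real^'d \<Rightarrow> real" where
  "time_deriv I u t x = vector_derivative (\<lambda>s. u s x) (at t within I)"

definition space_grad :: "(real \<Rightarrow> real^'d \<Rightarrow> real) \<Rightarrow> real \<Rightarrow> real^'d \<Rightarrow> real^'d" where
  "space_grad u t x = (\<chi> i. frechet_derivative (u t) (at x) (axis i 1))"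

definition space_hess :: "(real \<Rightarrow> real^'d \<Rightarrow> real) \<Rightarrow> real \<Rightarrow> real^'d \<Rightarrow> real^'d^'d" where
  "space_hess u t x = jacobian (space_grad u t) (at x)"

definition C12_on :: "real set \<Rightarrow> (real^'d) set \<Rightarrow> (real \<Rightarrow> real^'d \<Rightarrow> real) \<Rightarrow> bool" where
  "C12_on I D u \<longleftrightarrow>
     (\<forall>t\<in>I. \<forall>x\<in>D.
        (\<lambda>s. u s x) differentiable (at t within I) \<and>
        u t differentiable (at x) \<and>
        space_grad u t differentiable (at x)) \<and>
     continuous_on (I \<times> D) (\<lambda>(t, x). u t x) \<and>
     continuous_on (I \<times> D) (\<lambda>(t, x). time_deriv I u t x) \<and>
     continuous_on (I \<times> D) (\<lambda>(t, x). space_grad u t x) \<and>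
     continuous_on (I \<times> D) (\<lambda>(t, x). space_hess u t x)"

lemma space_grad_eq_GDERIV:
  assumes "GDERIV (u t) x :> p"
  shows "space_grad u t x = p"
proof -
  have "(u t has_derivative (\<lambda>h. h \<bullet> p)) (at x)"
    using assms by (simp add: gderiv_def)
  then have "frechet_derivative (u t) (at x) = (\<lambda>h. h \<bullet> p)"
    by (rule frechet_derivative_at[symmetric])
  then show ?thesis
    by (simp add: space_grad_def vec_eq_iff inner_axis')
qed

definition usc_on :: "'a::topological_space set \<Rightarrow> ('a \<Rightarrow> real) \<Rightarrow> bool" where
  "usc_on S u \<longleftrightarrow> (\<forall>z\<in>S. \<forall>a. u z < a \<longrightarrow> (\<forall>\<^sub>F w in at z within S. u w < a))"

definition lsc_on :: "'a::topological_space set \<Rightarrow> ('a \<Rightarrow> real) \<Rightarrow> bool" where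
  "lsc_on S u \<longleftrightarrow> (\<forall>z\<in>S. \<forall>a. a < u z \<longrightarrow> (\<forall>\<^sub>F w in at z within S. a < u w))"

type_synonym 'd pde_fun = "real \<Rightarrow> real^'d \<Rightarrow> real \<Rightarrow> real^'d \<Rightarrow> real^'d^'d \<Rightarrow> real"

text \<open>The matrix argument of \<open>G\<close> is only relevant on symmetric matrices.\<close>

definition degenerate_elliptic :: "real \<Rightarrow> (real^'d) set \<Rightarrow> 'd pde_fun \<Rightarrow> bool" where
  "degenerate_elliptic T D G \<longleftrightarrow>
     (\<forall>t\<in>{0<..<T}. \<forall>x\<in>D. \<forall>r p A B.
        transpose A = A \<longrightarrow> transpose B = B \<longrightarrow> (\<forall>y. (A *v y) \<bullet> y \<le> (B *v y) \<bullet> y) \<longrightarrow>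
        G t x r p A \<le> G t x r p B)"

text \<open>
  The set \<open>W\<close> is the domain of \<open>u\<close>. The signs are those of the backward equation
  \<open>\<partial>\<^sub>t u + G(t, x, u, \<nabla>u, Hess u) = 0\<close> with \<open>+G\<close>: a subsolution satisfies \<open>\<ge> 0\<close>.
\<close>

definition viscosity_subsolution ::
  "real \<Rightarrow> (real^'d) set \<Rightarrow> (real \<times> (real^'d)) set \<Rightarrow> 'd pde_fun \<Rightarrow> (real \<Rightarrow> real^'d \<Rightarrow> real) \<Rightarrow> bool"
where
  "viscosity_subsolution T D W G u \<longleftrightarrow>
     {0<..<T} \<times> D \<subseteq> W \<and> usc_on W (\<lambda>(t, x). u t x) \<and>
     (\<forall>t\<in>{0<..<T}. \<forall>x\<in>D. \<forall>\<phi>.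
        C12_on {0<..<T} D \<phi> \<longrightarrow> \<phi> t x = u t x \<longrightarrow> (\<forall>s\<in>{0<..<T}. \<forall>y\<in>D. \<phi> s y \<ge> u s y) \<longrightarrow>
        time_deriv {0<..<T} \<phi> t x + G t x (\<phi> t x) (space_grad \<phi> t x) (space_hess \<phi> t x) \<ge> 0)"

definition viscosity_supersolution ::
  "real \<Rightarrow> (real^'d) set \<Rightarrow> (real \<times> (real^'d)) set \<Rightarrow> 'd pde_fun \<Rightarrow> (real \<Rightarrow> real^'d \<Rightarrow> real) \<Rightarrow> bool"
where
  "viscosity_supersolution T D W G u \<longleftrightarrow>
     {0<..<T} \<times> D \<subseteq> W \<and> lsc_on W (\<lambda>(t, x). u t x) \<and>
     (\<forall>t\<in>{0<..<T}. \<forall>x\<in>D. \<forall>\<phi>.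
        C12_on {0<..<T} D \<phi> \<longrightarrow> \<phi> t x = u t x \<longrightarrow> (\<forall>s\<in>{0<..<T}. \<forall>y\<in>D. \<phi> s y \<le> u s y) \<longrightarrow>
        time_deriv {0<..<T} \<phi> t x + G t x (\<phi> t x) (space_grad \<phi> t x) (space_hess \<phi> t x) \<le> 0)"

definition viscosity_solution ::
  "real \<Rightarrow> (real^'d) set \<Rightarrow> (real \<times> (real^'d)) set \<Rightarrow> 'd pde_fun \<Rightarrow> (real \<Rightarrow> real^'d \<Rightarrow> real) \<Rightarrow> bool"
where
  "viscosity_solution T D W G u \<longleftrightarrow>
     viscosity_subsolution T D W G u \<and> viscosity_supersolution T D W G u"

definition semilinear_op ::
  "(real \<Rightarrow> real^'d \<Rightarrow> real^'d) \<Rightarrow> (real \<Rightarrow> real^'d \<Rightarrow> real^'m^'d) \<Rightarrow>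
   (real \<Rightarrow> real^'d \<Rightarrow> real \<Rightarrow> real) \<Rightarrow> 'd pde_fun"
where
  "semilinear_op \<mu> \<sigma> f t x r p A =
     1/2 * trace (\<sigma> t x ** transpose (\<sigma> t x) ** A) + \<mu> t x \<bullet> p + f t x r"

definition inner_region :: "(real^'d) set \<Rightarrow> real \<Rightarrow> (real^'d) set" where
  "inner_region D r = {x \<in> D. norm x \<le> r \<and> {y. norm (y - x) < 1 / r} \<subseteq> D}"

text \<open>
  Suprema and limits superior are taken in \<^typ>\<open>ereal\<close>, since the inner supremum may be infinite
  for small \<open>r\<close>.
\<close>

definition vanishes_relative_to ::
  "real \<Rightarrow> (real^'d) set \<Rightarrow> (real \<Rightarrow> real^'d \<Rightarrow> real) \<Rightarrow> (real \<Rightarrow> real^'d \<Rightarrow> real) \<Rightarrow> bool"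
where
  "vanishes_relative_to T D V h \<longleftrightarrow>
     Limsup at_top (\<lambda>r::real. SUP t\<in>{0..T}. SUP x\<in>D - inner_region D r. ereal (\<bar>h t x\<bar> / V t x)) = 0"

lemma degenerate_elliptic_semilinear_op: "degenerate_elliptic T D (semilinear_op \<mu> \<sigma> f)"
proof -
  have eq: "trace (S ** transpose S ** A) = (\<Sum>k\<in>UNIV. (A *v column k S) \<bullet> column k S)"
    for S :: "real^'m^'d" and A :: "real^'d^'d"
  proof -
    have "trace (S ** transpose S ** A) = trace (A ** (S ** transpose S))"
      by (rule trace_mul_sym)
    also have "\<dots> = (\<Sum>i\<in>UNIV. \<Sum>j\<in>UNIV. \<Sum>k\<in>UNIV. A$i$j * (S$j$k * S$i$k))"
      by (simp add: trace_def matrix_matrix_mult_def transpose_def sum_distrib_left)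
    also have "\<dots> = (\<Sum>i\<in>UNIV. \<Sum>k\<in>UNIV. \<Sum>j\<in>UNIV. A$i$j * (S$j$k * S$i$k))"
      by (intro sum.cong refl sum.swap)
    also have "\<dots> = (\<Sum>k\<in>UNIV. \<Sum>i\<in>UNIV. \<Sum>j\<in>UNIV. A$i$j * (S$j$k * S$i$k))"
      by (rule sum.swap)
    also have "\<dots> = (\<Sum>k\<in>UNIV. (A *v column k S) \<bullet> column k S)"
      by (simp add: inner_vec_def matrix_vector_mult_def column_def sum_distrib_right mult.assoc)
    finally show ?thesis .
  qed
  show ?thesis
    unfolding degenerate_elliptic_def semilinear_op_def eq
    by (auto intro!: sum_mono)
qed

end

(*
  Comparison principle for viscosity solutions, applied to (u1, u2) and to (u2, u1).  With
  W = exp (-2 L t) V one has W_t + A W <= -2 L W for the linear part A of the operator.  If u1 > u2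
  somewhere, let theta > 0 be the supremum of (u1 - u2) / W and maximize
  u1 - u2 - (3/4) theta W - eta / t; since the u_i are small relative to V near the boundary and at
  infinity, the maximum is attained in the interior of a compact set.  If a maximum point could be
  treated as for smooth functions, one would obtain f(u1) - f(u2) >= (3/2) L theta W there, against
  f(u1) - f(u2) <= L (u1 - u2) <= L theta W.

  Doubling the variables makes this rigorous.  The doubled function with penalization
  B (x - y) . (x - y) / 2, B >= 0, is regularized by sup-convolution, which becomes convex after adding
  a quadratic.  Jensen's lemma yields maximum points of slightly tilted functions where the
  sup-convolutions have second order expansions; these pass to u1 and -u2 as superjets (p, X) and
  (q, Y) with X + Y <= B in the sense of quadratic forms.  Second order differentiability
  (Aleksandrov's theorem) comes from Rademacher's theorem for the nonexpansive resolvent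
  (I + df)^{-1}: at points touched from above by a paraboloid its derivative is invertible.
  Rademacher's theorem follows from the one-dimensional case, Fubini, and the fact that porous sets
  are null.
*)

theory Submission
  imports Defs
begin

text \<open>Since \<open>f\<close> may increase in its last argument, with slope up to
  \<open>L\<close>, the equation by itself has the wrong sign for a maximum principle; the
  exponential factor in W supplies the missing decay. A second obstacle is the gap between jets and
  test functions. Superjets are known only relative to a compact set, while a test function has to
  lie above u on all of (0,T) x D, where u may be unbounded. A penalty of fourth order multiplied by
  1 + V closes this gap without changing derivatives up to second order at the point of contact.
  Second order expansions of convex functions are needed only at maximum points, which are indexed
  by the slope of the tilt. Bad slopes are a Lipschitz image of a null set, and this replaces the
  area formula in the usual proof of Jensen's lemma. Once u is inserted into f, the nonlinearity is
  a continuous source term, so u1 and -u2 are handled as subsolutions of linear equations; f returns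
  only in the last lines of the comparison.\<close>

subsection \<open>Null sets by Vitali covering\<close>

text \<open>Vitali's theorem selects disjoint small balls inside an open \<open>U\<close>, in each
  of which \<open>S\<close> fills at most the fraction \<open>c\<close>. Hence the outer measure
  \<open>m\<close> of a bounded piece is at most \<open>c\<close> times the measure of
  \<open>U\<close>, and choosing \<open>U\<close> close to optimal forces \<open>m = 0\<close>.
  \<open>S\<close> may be non-measurable, so in each ball it is enclosed in a measurable
  \<open>H\<close>. The balls contain \<open>x\<close> but need not be centred there.\<close>

lemma negligible_sparse_cover:
  fixes S :: "'a::euclidean_space set"
  assumes c: "0 \<le> c" "c < 1"
    and cov: "\<And>x d. x \<in> S \<Longrightarrow> 0 < d \<Longrightarrow> \<exists>a r H. 0 < r \<and> r < d \<and> x \<in> cball a r \<and> H \<in> sets lebesgue \<and>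
       S \<inter> cball a r \<subseteq> H \<and> H \<subseteq> cball a r \<and>
       emeasure lebesgue H \<le> ennreal c * emeasure lebesgue (cball a r)"
  shows "negligible S"
proof -
  have bdd: "negligible B" if B: "B \<subseteq> S" "bounded B" for B
  proof -
    define m where "m = (INF U\<in>{U. open U \<and> B \<subseteq> U}. emeasure lebesgue U)"
    obtain r0 where r0: "B \<subseteq> ball 0 r0"
      using B(2) by (meson bounded_subset_ballD)
    have m_fin: "m < \<infinity>"
    proof -
      have "m \<le> emeasure lebesgue (ball 0 r0 :: 'a set)"
        unfolding m_def by (rule INF_lower) (use r0 in auto)
      also have "\<dots> < \<infinity>"
        using emeasure_bounded_finite[of "ball 0 r0 :: 'a set"] by simp
      finally show ?thesis .
    qed
    have m_le: "m \<le> emeasure lebesgue T" if T: "T \<in> sets lebesgue" "B \<subseteq> T" for T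
    proof (rule ennreal_le_epsilon)
      fix e :: real assume e: "0 < e"
      obtain U where U: "open U" "T \<subseteq> U" "(U - T) \<in> lmeasurable" "emeasure lebesgue (U - T) < ennreal e"
        by (rule sets_lebesgue_outer_open[OF T(1) e])
      have "m \<le> emeasure lebesgue U"
        unfolding m_def by (rule INF_lower) (use U T in auto)
      also have "U = T \<union> (U - T)" using U by auto
      also have "emeasure lebesgue \<dots> \<le> emeasure lebesgue T + emeasure lebesgue (U - T)"
        by (rule emeasure_subadditive) (use T U in auto)
      also have "\<dots> \<le> emeasure lebesgue T + ennreal e"
        using U(4) by (intro add_left_mono) auto
      finally show "m \<le> emeasure lebesgue T + ennreal e" .
    qed
    have main: "m \<le> ennreal c * emeasure lebesgue U" if U: "open U" "B \<subseteq> U" for U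
    proof -
      define K where "K = {(a, r, H). 0 < r \<and> H \<in> sets lebesgue \<and> S \<inter> cball a r \<subseteq> H \<and> H \<subseteq> cball a r \<and>
         cball a r \<subseteq> U \<and> emeasure lebesgue H \<le> ennreal c * emeasure lebesgue (cball (a::'a) r)}"
      define ctr where "ctr = (\<lambda>i::'a \<times> real \<times> 'a set. fst i)"
      define rad where "rad = (\<lambda>i::'a \<times> real \<times> 'a set. fst (snd i))"
      define Hs where "Hs = (\<lambda>i::'a \<times> real \<times> 'a set. snd (snd i))"
      have K: "0 < rad i" "Hs i \<in> sets lebesgue" "S \<inter> cball (ctr i) (rad i) \<subseteq> Hs i"
        "Hs i \<subseteq> cball (ctr i) (rad i)" "cball (ctr i) (rad i) \<subseteq> U"
        "emeasure lebesgue (Hs i) \<le> ennreal c * emeasure lebesgue (cball (ctr i) (rad i))" if "i \<in> K" for i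
        using that by (auto simp: K_def ctr_def rad_def Hs_def)
      obtain C where C: "countable C" "C \<subseteq> K"
        "pairwise (\<lambda>i j. disjnt (cball (ctr i) (rad i)) (cball (ctr j) (rad j))) C"
        "negligible (B - (\<Union>i\<in>C. cball (ctr i) (rad i)))"
      proof (rule Vitali_covering_theorem_cballs[of K rad B ctr])
        show "0 < rad i" if "i \<in> K" for i using K that by blast
        fix x and d :: real assume x: "x \<in> B" "0 < d"
        obtain e where e: "0 < e" "ball x e \<subseteq> U"
          using U x open_contains_ball by blast
        \<comment> \<open>A ball of radius below \<open>e/2\<close> that contains \<open>x\<close>
          stays within \<open>ball x e\<close>, hence within \<open>U\<close>.\<close>
        obtain a r H where arH: "0 < r" "r < min d (e/2)" "x \<in> cball a r" "H \<in> sets lebesgue"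
          "S \<inter> cball a r \<subseteq> H" "H \<subseteq> cball a r"
          "emeasure lebesgue H \<le> ennreal c * emeasure lebesgue (cball a r)"
          using cov[of x "min d (e/2)"] x e B
          by (metis divide_pos_pos min_less_iff_conj subsetD zero_less_numeral)
        have "cball a r \<subseteq> ball x e"
        proof
          fix y assume "y \<in> cball a r"
          then have "dist x y \<le> dist x a + dist a y" "dist x a \<le> r" "dist a y \<le> r"
            using arH dist_triangle[of x y a] by (auto simp: dist_commute)
          then show "y \<in> ball x e" using arH by auto
        qed
        then have "(a, r, H) \<in> K" unfolding K_def using arH e by auto
        then show "\<exists>i. i \<in> K \<and> x \<in> cball (ctr i) (rad i) \<and> rad i < d"
          using arH by (intro exI[of _ "(a,r,H)"]) (auto simp: ctr_def rad_def)
      qed (use that in blast)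
      have disj: "disjoint_family_on (\<lambda>i. cball (ctr i) (rad i)) C"
        using C(3) by (auto simp: disjoint_family_on_def pairwise_def disjnt_def)
      have disjH: "disjoint_family_on Hs C"
        unfolding disjoint_family_on_def
      proof (intro ballI impI)
        fix i j assume "i \<in> C" "j \<in> C" "i \<noteq> j"
        then show "Hs i \<inter> Hs j = {}"
          using disj K(4) C(2) unfolding disjoint_family_on_def by blast
      qed
      define Z where "Z = B - (\<Union>i\<in>C. cball (ctr i) (rad i))"
      have Z: "Z \<in> null_sets lebesgue" using C(4) negligible_iff_null_sets Z_def by blast
      have HsM: "(\<Union>i\<in>C. Hs i) \<in> sets lebesgue"
        using C K(2) by (intro sets.countable_UN'') auto
      have "m \<le> emeasure lebesgue ((\<Union>i\<in>C. Hs i) \<union> Z)"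
      proof (rule m_le)
        show "(\<Union>i\<in>C. Hs i) \<union> Z \<in> sets lebesgue" using HsM Z by auto
        show "B \<subseteq> (\<Union>i\<in>C. Hs i) \<union> Z" using B C(2) K(3) unfolding Z_def by blast
      qed
      also have "\<dots> = emeasure lebesgue (\<Union>i\<in>C. Hs i)"
        using emeasure_Un_null_set[OF HsM Z] .
      also have "\<dots> = (\<integral>\<^sup>+ i. emeasure lebesgue (Hs i) \<partial>count_space C)"
        by (rule emeasure_UN_countable) (use C K(2) disjH in auto)
      also have "\<dots> \<le> (\<integral>\<^sup>+ i. ennreal c * emeasure lebesgue (cball (ctr i) (rad i)) \<partial>count_space C)"
        by (rule nn_integral_mono) (use C K(6) in auto)
      also have "\<dots> = ennreal c * (\<integral>\<^sup>+ i. emeasure lebesgue (cball (ctr i) (rad i)) \<partial>count_space C)"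
        by (rule nn_integral_cmult) auto
      also have "(\<integral>\<^sup>+ i. emeasure lebesgue (cball (ctr i) (rad i)) \<partial>count_space C)
          = emeasure lebesgue (\<Union>i\<in>C. cball (ctr i) (rad i))"
        by (rule emeasure_UN_countable[symmetric]) (use C disj in auto)
      also have "ennreal c * \<dots> \<le> ennreal c * emeasure lebesgue U"
      proof -
        have "(\<Union>i\<in>C. cball (ctr i) (rad i)) \<subseteq> U" using K(5) C(2) by blast
        then show ?thesis using U by (intro mult_left_mono emeasure_mono) auto
      qed
      finally show ?thesis .
    qed
    have "m = 0"
    proof (rule ccontr)
      assume "m \<noteq> 0"
      then obtain q where q: "m = ennreal q" "0 < q" using m_fin by (cases m) (auto simp: less_le)
      \<comment> \<open>A ratio strictly between \<open>c\<close> and 1. Since \<open>q / c'\<close>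
        exceeds \<open>q\<close>, some open \<open>U\<close> has smaller measure than
        \<open>q / c'\<close>, and then \<open>m\<close> would be at most
        \<open>c * q / c' < q\<close>.\<close>
      define c' where "c' = (c + 1) / 2"
      have c': "0 < c'" "c < c'" "c' < 1" using c by (auto simp: c'_def)
      have "m < ennreal (q / c')" using q c' by (auto intro!: ennreal_lessI simp: field_simps)
      then obtain U where U: "open U" "B \<subseteq> U" "emeasure lebesgue U < ennreal (q / c')"
        unfolding m_def INF_less_iff by auto
      have "m \<le> ennreal c * emeasure lebesgue U" by (rule main) (use U in auto)
      also have "\<dots> \<le> ennreal c * ennreal (q / c')" using U by (intro mult_left_mono) auto
      also have "\<dots> = ennreal (c * (q / c'))" using c c' q by (intro ennreal_mult[symmetric]) auto
      finally have "q \<le> c * (q / c')" using q c c' by simp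
      then show False using q c' by (simp add: field_simps)
    qed
    show "negligible B"
    proof (subst negligible_outer_le, intro allI impI)
      fix e :: real assume "0 < e"
      then have "m < ennreal e" using \<open>m = 0\<close> by simp
      then obtain U where U: "open U" "B \<subseteq> U" "emeasure lebesgue U < ennreal e"
        unfolding m_def INF_less_iff by auto
      then have "U \<in> lmeasurable" by (intro fmeasurableI) (auto simp: top.not_eq_extremum dest: less_top[THEN iffD2] intro: less_trans)
      moreover have "measure lebesgue U \<le> e"
        using U(3) \<open>0 < e\<close> unfolding measure_def by (intro enn2real_leI) auto
      ultimately show "\<exists>T. B \<subseteq> T \<and> T \<in> lmeasurable \<and> measure lebesgue T \<le> e" using U by auto
    qed
  qed
  have "S = (\<Union>n::nat. S \<inter> ball 0 (real n))"
    using reals_Archimedean2 by fastforce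
  moreover have "negligible (\<Union>n::nat. S \<inter> ball 0 (real n))"
    by (intro negligible_countable_Union) (auto intro!: bdd bounded_subset[OF bounded_ball])
  ultimately show ?thesis by metis
qed

text \<open>The hole \<open>ball y (\<kappa> * t)\<close> lies in \<open>cball x (2 * t)\<close>, so
  \<open>S\<close> misses at least the fraction \<open>(\<kappa> / 2) ^ n\<close> of that ball,
  \<open>n\<close> being the dimension, at arbitrarily small scales.\<close>

lemma negligible_porous:
  fixes S :: "'a::euclidean_space set"
  assumes \<kappa>: "0 < \<kappa>" "\<kappa> \<le> 1"
    and por: "\<And>x d. x \<in> S \<Longrightarrow> 0 < d \<Longrightarrow> \<exists>y t. 0 < t \<and> t < d \<and> dist y x \<le> t \<and> ball y (\<kappa> * t) \<inter> S = {}"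
  shows "negligible S"
proof (rule negligible_sparse_cover)
  let ?n = "DIM('a)" let ?c = "1 - (\<kappa> / 2) ^ ?n"
  show "0 \<le> ?c" using \<kappa> by (simp add: power_le_one)
  show "?c < 1" using \<kappa> by simp
  fix x :: 'a and d :: real assume x: "x \<in> S" "0 < d"
  obtain y t where y: "0 < t" "t < d / 2" "dist y x \<le> t" "ball y (\<kappa> * t) \<inter> S = {}"
    using por[of x "d / 2"] x by auto
  let ?H = "cball x (2 * t) - ball y (\<kappa> * t)"
  have sub: "ball y (\<kappa> * t) \<subseteq> cball x (2 * t)"
  proof
    fix z assume "z \<in> ball y (\<kappa> * t)"
    then have "dist y z < \<kappa> * t" by simp
    moreover have "\<kappa> * t \<le> 1 * t" using \<kappa> y by (intro mult_right_mono) auto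
    ultimately have "dist x z \<le> 2 * t" using y dist_triangle[of x z y] dist_commute[of x y] by linarith
    then show "z \<in> cball x (2 * t)" by simp
  qed
  have "emeasure lebesgue ?H = emeasure lebesgue (cball x (2 * t)) - emeasure lebesgue (ball y (\<kappa> * t))"
    using emeasure_bounded_finite[of "ball y (\<kappa>*t)"] by (intro emeasure_Diff sub) auto
  also have "\<dots> = ennreal (unit_ball_vol ?n * (2 * t) ^ ?n) - ennreal (unit_ball_vol ?n * (\<kappa> * t) ^ ?n)"
    using y \<kappa> by (simp add: emeasure_cball emeasure_ball)
  also have "\<dots> = ennreal (unit_ball_vol ?n * (2 * t) ^ ?n - unit_ball_vol ?n * (\<kappa> * t) ^ ?n)"
    using y \<kappa> by (intro ennreal_minus) auto
  also have "unit_ball_vol ?n * (2 * t) ^ ?n - unit_ball_vol ?n * (\<kappa> * t) ^ ?n = ?c * (unit_ball_vol ?n * (2 * t) ^ ?n)"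
    by (simp add: power_mult_distrib power_divide field_simps)
  also have "ennreal \<dots> = ennreal ?c * emeasure lebesgue (cball x (2 * t))"
    using y \<kappa> \<open>0 \<le> ?c\<close> by (simp add: emeasure_cball ennreal_mult)
  finally have "emeasure lebesgue ?H \<le> ennreal ?c * emeasure lebesgue (cball x (2 * t))" by simp
  then show "\<exists>a r H. 0 < r \<and> r < d \<and> x \<in> cball a r \<and> H \<in> sets lebesgue \<and>
       S \<inter> cball a r \<subseteq> H \<and> H \<subseteq> cball a r \<and> emeasure lebesgue H \<le> ennreal ?c * emeasure lebesgue (cball a r)"
    using y by (intro exI[of _ x] exI[of _ "2 * t"] exI[of _ ?H]) auto
qed

subsection \<open>Differentiability of Lipschitz functions almost everywhere\<close>

lemma cball_midpoint_real: "s \<le> t \<Longrightarrow> cball ((s + t) / 2) ((t - s) / 2) = {s..t::real}"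
  by (simp add: cball_eq_atLeastAtMost field_simps)

text \<open>Disjoint intervals on which \<open>f\<close> has average slope at least \<open>b\<close>
  have total length at most \<open>1 / b\<close> times their Stieltjes mass, and the mass of
  \<open>{p..q}\<close> is \<open>f q - f p\<close>. Vitali's theorem selects such intervals
  covering \<open>E\<close> up to a null set.\<close>

lemma steep_intervals_cover:
  fixes f :: "real \<Rightarrow> real"
  assumes f: "mono f" "continuous_on UNIV f" and b: "0 < b" and pq: "p \<le> q"
    and steep: "\<And>x d. x \<in> E \<Longrightarrow> 0 < d \<Longrightarrow> \<exists>s t. s < t \<and> t - s < d \<and> s \<le> x \<and> x \<le> t \<and> b * (t - s) \<le> f t - f s"
  obtains H where "H \<in> sets lebesgue" "E \<inter> {p..q} \<subseteq> H" "H \<subseteq> {p..q}"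
    "emeasure lebesgue H \<le> ennreal ((f q - f p) / b)"
proof -
  let ?M = "interval_measure f"
  have M: "emeasure ?M {s..t} = ennreal (f t - f s)" if "s \<le> t" for s t
    using f that by (intro emeasure_interval_measure_Icc) (auto dest: monoD)
  define K where "K = {(s, t). s < t \<and> {s..t} \<subseteq> {p..q} \<and> b * (t - s) \<le> f t - f s}"
  define I where "I = (\<lambda>(s, t). {s..t::real})"
  have I: "cball ((fst i + snd i) / 2) ((snd i - fst i) / 2) = I i" if "i \<in> K" for i
    using that by (auto simp: K_def I_def cball_midpoint_real)
  obtain C where C: "countable C" "C \<subseteq> K"
    "pairwise (\<lambda>i j. disjnt (cball ((fst i + snd i) / 2) ((snd i - fst i) / 2)) (cball ((fst j + snd j) / 2) ((snd j - fst j) / 2))) C"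
    "negligible (E \<inter> {p<..<q} - (\<Union>i\<in>C. cball ((fst i + snd i) / 2) ((snd i - fst i) / 2)))"
  proof (rule Vitali_covering_theorem_cballs[of K "\<lambda>i. (snd i - fst i) / 2" "E \<inter> {p<..<q}" "\<lambda>i. (fst i + snd i) / 2"])
    show "0 < (snd i - fst i) / 2" if "i \<in> K" for i using that by (auto simp: K_def)
    fix x d :: real assume x: "x \<in> E \<inter> {p<..<q}" "0 < d"
    obtain s t where st: "s < t" "t - s < Min {d, x - p, q - x}" "s \<le> x" "x \<le> t" "b * (t - s) \<le> f t - f s"
      using steep[of x "Min {d, x - p, q - x}"] x by auto
    then have "(s, t) \<in> K" unfolding K_def by auto
    then show "\<exists>i. i \<in> K \<and> x \<in> cball ((fst i + snd i) / 2) ((snd i - fst i) / 2) \<and> (snd i - fst i) / 2 < d"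
      using st by (intro exI[of _ "(s, t)"]) (auto simp: cball_midpoint_real)
  qed (use that in blast)
  have UI: "(\<Union>i\<in>C. cball ((fst i + snd i) / 2) ((snd i - fst i) / 2)) = (\<Union>i\<in>C. I i)"
    using I C(2) by auto
  have disj: "disjoint_family_on I C"
    unfolding disjoint_family_on_def
  proof (intro ballI impI)
    fix i j assume ij: "i \<in> C" "j \<in> C" "i \<noteq> j"
    then have "disjnt (I i) (I j)"
      using pairwiseD[OF C(3) ij] I[of i] I[of j] C(2) by (simp only: subset_iff)
    then show "I i \<inter> I j = {}" by (simp add: disjnt_def)
  qed
  \<comment> \<open>Vitali is applied to interior points only, so that short intervals stay inside
    \<open>{p..q}\<close>; the two endpoints go into the null set.\<close>
  define Z where "Z = E \<inter> {p..q} - (\<Union>i\<in>C. I i)"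
  have "negligible Z"
    by (rule negligible_subset[of "(E \<inter> {p<..<q} - (\<Union>i\<in>C. I i)) \<union> {p, q}"])
       (use C(4) UI in \<open>auto simp: Z_def negligible_Un\<close>)
  then have Z: "Z \<in> null_sets lebesgue" by (simp add: negligible_iff_null_sets)
  have Ib: "I i \<in> sets borel" for i by (cases i) (simp add: I_def)
  have UIm: "(\<Union>i\<in>C. I i) \<in> sets lebesgue"
    using C Ib by (intro sets.countable_UN'') auto
  have sub: "(\<Union>i\<in>C. I i) \<subseteq> {p..q}" using C(2) by (auto simp: K_def I_def)
  have "emeasure lebesgue ((\<Union>i\<in>C. I i) \<union> Z) = emeasure lebesgue (\<Union>i\<in>C. I i)"
    by (rule emeasure_Un_null_set[OF UIm Z])
  also have "\<dots> = (\<integral>\<^sup>+ i. emeasure lebesgue (I i) \<partial>count_space C)"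
    by (rule emeasure_UN_countable) (use C disj Ib in auto)
  also have "\<dots> \<le> (\<integral>\<^sup>+ i. ennreal (1 / b) * emeasure ?M (I i) \<partial>count_space C)"
  proof (rule nn_integral_mono)
    fix i assume "i \<in> space (count_space C)"
    then obtain s t where i: "i = (s, t)" "s < t" "b * (t - s) \<le> f t - f s"
      using C(2) by (auto simp: K_def)
    then have "ennreal (t - s) \<le> ennreal ((1 / b) * (f t - f s))"
      using b by (intro ennreal_leI) (simp add: field_simps)
    also have "\<dots> = ennreal (1 / b) * ennreal (f t - f s)"
      using b monoD[OF f(1), of s t] i by (intro ennreal_mult) simp_all
    finally show "emeasure lebesgue (I i) \<le> ennreal (1 / b) * emeasure ?M (I i)"
      using i M[of s t] by (simp add: I_def)
  qed
  also have "\<dots> = ennreal (1 / b) * (\<integral>\<^sup>+ i. emeasure ?M (I i) \<partial>count_space C)"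
    by (rule nn_integral_cmult) auto
  also have "(\<integral>\<^sup>+ i. emeasure ?M (I i) \<partial>count_space C) = emeasure ?M (\<Union>i\<in>C. I i)"
    by (rule emeasure_UN_countable[symmetric]) (use C disj Ib in auto)
  also have "ennreal (1 / b) * \<dots> \<le> ennreal (1 / b) * emeasure ?M {p..q}"
    by (intro mult_left_mono emeasure_mono sub) auto
  also have "\<dots> = ennreal ((f q - f p) / b)"
    using b pq M[of p q] f(1) by (simp add: ennreal_mult''[symmetric] monoD)
  finally have "emeasure lebesgue ((\<Union>i\<in>C. I i) \<union> Z) \<le> ennreal ((f q - f p) / b)" .
  moreover have "(\<Union>i\<in>C. I i) \<union> Z \<in> sets lebesgue"
    using UIm null_setsD2[OF Z] by (rule sets.Un)
  moreover have "E \<inter> {p..q} \<subseteq> (\<Union>i\<in>C. I i) \<union> Z" "(\<Union>i\<in>C. I i) \<union> Z \<subseteq> {p..q}"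
    using sub by (auto simp: Z_def)
  ultimately show thesis by (intro that[of "(\<Union>i\<in>C. I i) \<union> Z"])
qed

text \<open>Inside an interval of slope at most \<open>a\<close>, the steep points have outer
  measure at most \<open>(f t - f s) / b\<close>, which is at most the fraction
  \<open>a / b < 1\<close> of its length. Such intervals exist around each point at arbitrarily
  small scales, so the set is sparse.\<close>

lemma negligible_oscillating_slopes:
  fixes f :: "real \<Rightarrow> real"
  assumes f: "mono f" "continuous_on UNIV f" and ab: "0 \<le> a" "a < b"
  shows "negligible {x. (\<forall>d>0. \<exists>s t. s < t \<and> t - s < d \<and> s \<le> x \<and> x \<le> t \<and> f t - f s \<le> a * (t - s)) \<and>
                        (\<forall>d>0. \<exists>s t. s < t \<and> t - s < d \<and> s \<le> x \<and> x \<le> t \<and> b * (t - s) \<le> f t - f s)}"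
    (is "negligible ?E")
proof (rule negligible_sparse_cover)
  show "0 \<le> a / b" "a / b < 1" using ab by auto
  fix x d :: real assume x: "x \<in> ?E" "0 < d"
  then obtain s t where st: "s < t" "t - s < d" "s \<le> x" "x \<le> t" "f t - f s \<le> a * (t - s)" by auto
  obtain H where H: "H \<in> sets lebesgue" "?E \<inter> {s..t} \<subseteq> H" "H \<subseteq> {s..t}"
    "emeasure lebesgue H \<le> ennreal ((f t - f s) / b)"
    by (rule steep_intervals_cover[OF f, where p=s and q=t and b=b and E="?E"]) (use ab st in auto)
  have "(f t - f s) / b \<le> (a / b) * (t - s)"
    using divide_right_mono[OF st(5), of b] ab by simp
  then have "ennreal ((f t - f s) / b) \<le> ennreal (a / b) * ennreal (t - s)"
    using ab st by (simp add: ennreal_mult''[symmetric] ennreal_leI)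
  then have "emeasure lebesgue H \<le> ennreal (a / b) * emeasure lebesgue (cball ((s + t) / 2) ((t - s) / 2))"
    using H(4) st by (simp add: cball_midpoint_real)
  then show "\<exists>c r H. 0 < r \<and> r < d \<and> x \<in> cball c r \<and> H \<in> sets lebesgue \<and>
       ?E \<inter> cball c r \<subseteq> H \<and> H \<subseteq> cball c r \<and> emeasure lebesgue H \<le> ennreal (a / b) * emeasure lebesgue (cball c r)"
    using st H(1-3) by (intro exI[of _ "(s + t) / 2"] exI[of _ "(t - s) / 2"] exI[of _ H]) (simp add: cball_midpoint_real)
qed

text \<open>If \<open>f\<close> is not differentiable at \<open>x\<close>, there are rationals
  \<open>a < b\<close> such that arbitrarily short intervals around \<open>x\<close> have slope at
  most \<open>a\<close> and others slope at least \<open>b\<close>. There are countably many such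
  pairs, each giving a null set.\<close>

lemma negligible_not_differentiable_mono_lipschitz:
  fixes f :: "real \<Rightarrow> real"
  assumes f: "mono f" and lip: "L-lipschitz_on UNIV f"
  shows "negligible {x. \<not> f differentiable (at x)}"
proof -
  define low where "low = (\<lambda>a x. \<forall>d>0. \<exists>s t. s < t \<and> t - s < d \<and> s \<le> x \<and> x \<le> t \<and> f t - f s \<le> a * (t - s))"
  define upp where "upp = (\<lambda>b x. \<forall>d>0. \<exists>s t. s < t \<and> t - s < d \<and> s \<le> x \<and> x \<le> t \<and> b * (t - s) \<le> f t - f s)"
  define N where "N = (\<Union>p\<in>{(a, b). a \<in> \<rat> \<and> b \<in> \<rat> \<and> 0 \<le> a \<and> a < b}. {x. low (fst p) x \<and> upp (snd p) x})"
  have cont: "continuous_on UNIV f" using lip by (rule lipschitz_on_continuous_on)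
  have "countable {(a, b). a \<in> \<rat> \<and> b \<in> \<rat> \<and> 0 \<le> a \<and> (a::real) < b}"
    by (rule countable_subset[of _ "\<rat> \<times> \<rat>"]) (auto intro: countable_rat)
  then have "negligible N"
    unfolding N_def negligible_iff_null_sets
  proof (rule null_sets_UN')
    fix p assume "p \<in> {(a, b). a \<in> \<rat> \<and> b \<in> \<rat> \<and> 0 \<le> a \<and> (a::real) < b}"
    then show "{x. low (fst p) x \<and> upp (snd p) x} \<in> null_sets lebesgue"
      using negligible_oscillating_slopes[OF f cont, of "fst p" "snd p"]
      by (auto simp: low_def upp_def negligible_iff_null_sets)
  qed
  moreover have "f differentiable (at x)" if x: "x \<notin> N" for x
  proof -
    have L: "0 \<le> L" using lip by (rule lipschitz_on_nonneg)
    \<comment> \<open>The candidate derivative is the infimum \<open>s\<close> of all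
      \<open>a\<close> that bound the average slope on arbitrarily short intervals around
      \<open>x\<close>. The Lipschitz bound puts \<open>L\<close> into this set, so it is not
      empty.\<close>
    define A where "A = {a. 0 \<le> a \<and> low a x}"
    define s where "s = Inf A"
    have "L \<in> A"
    proof -
      have 1: "f v - f u \<le> L * (v - u)" if "u < v" for u v
        using lipschitz_onD[OF lip, of v u] that by (simp add: dist_real_def)
      have "\<exists>s t. s < t \<and> t - s < d \<and> s \<le> x \<and> x \<le> t \<and> f t - f s \<le> L * (t - s)" if "0 < d" for d
        using that 1[of x "x + d / 2"] by (intro exI[of _ x] exI[of _ "x + d / 2"] conjI) linarith+
      then have "low L x" unfolding low_def by blast
      then show ?thesis unfolding A_def using L by simp
    qed
    then have Ane: "A \<noteq> {}" by auto
    have bdd: "bdd_below A" unfolding A_def by (rule bdd_belowI[of _ 0]) auto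
    have up: "a' \<in> A" if "a \<in> A" "a \<le> a'" for a a'
    proof -
      have "f t - f u \<le> a' * (t - u)" if "u < t" "f t - f u \<le> a * (t - u)" for u t
        using that \<open>a \<le> a'\<close> mult_right_mono[of a a' "t - u"] by linarith
      then show ?thesis using that unfolding A_def low_def by (auto, meson)
    qed
    have key: "\<exists>d>0. \<forall>u t. u < t \<and> t - u < d \<and> u \<le> x \<and> x \<le> t \<longrightarrow> \<bar>f t - f u - s * (t - u)\<bar> \<le> e * (t - u)" if e: "0 < e" for e
    proof -
      obtain a1 where a1: "a1 \<in> A" "a1 < s + e" using cInf_lessD[OF Ane, of "s + e"] e unfolding s_def by auto
      \<comment> \<open>Two rationals just above \<open>s\<close>. As \<open>a\<close> belongs to
        \<open>A\<close>, off \<open>N\<close> the slope \<open>b\<close> is not reached on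
        arbitrarily short intervals, so eventually all slopes are below
        \<open>b < s + e\<close>.\<close>
      obtain a where a: "a \<in> \<rat>" "a1 < a" "a < s + e" using Rats_dense_in_real[OF a1(2)] by auto
      obtain b where b: "b \<in> \<rat>" "a < b" "b < s + e" using Rats_dense_in_real[OF a(3)] by auto
      have "a \<in> A" using up a1 a by auto
      then have "\<not> upp b x" using x a b unfolding N_def A_def by auto
      then obtain d1 where d1: "0 < d1" "\<And>u t. u < t \<Longrightarrow> t - u < d1 \<Longrightarrow> u \<le> x \<Longrightarrow> x \<le> t \<Longrightarrow> f t - f u < b * (t - u)"
        unfolding upp_def by (meson not_less)
      obtain d2 where d2: "0 < d2" "\<And>u t. u < t \<Longrightarrow> t - u < d2 \<Longrightarrow> u \<le> x \<Longrightarrow> x \<le> t \<Longrightarrow> (s - e) * (t - u) \<le> f t - f u"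
      \<comment> \<open>\<open>A\<close> contains nonnegative numbers only, so a negative
        \<open>s - e\<close> says nothing about \<open>low\<close>; there the lower bound comes from
        monotonicity.\<close>
      proof (cases "s - e < 0")
        case True
        have "(s - e) * (t - u) \<le> f t - f u" if "u < t" for u t
        proof -
          have "(s - e) * (t - u) \<le> 0" using True that by (simp add: mult_le_0_iff)
          moreover have "0 \<le> f t - f u" using f that by (simp add: monoD)
          ultimately show ?thesis by linarith
        qed
        then show ?thesis by (intro that[of 1]) auto
      next
        case False
        have "s - e \<notin> A"
        proof
          assume "s - e \<in> A"
          then have "s \<le> s - e" unfolding s_def using bdd by (metis cInf_lower)
          then show False using e by simp
        qed
        then have "\<not> low (s - e) x" using False unfolding A_def by auto
        then obtain d where "0 < d" "\<And>u t. u < t \<Longrightarrow> t - u < d \<Longrightarrow> u \<le> x \<Longrightarrow> x \<le> t \<Longrightarrow> (s - e) * (t - u) < f t - f u"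
          unfolding low_def by (meson not_less)
        then show ?thesis by (intro that[of d]) (auto intro: less_imp_le)
      qed
      show ?thesis
      proof (intro exI[of _ "min d1 d2"] conjI allI impI)
        show "0 < min d1 d2" using d1 d2 by auto
        fix u t assume ut: "u < t \<and> t - u < min d1 d2 \<and> u \<le> x \<and> x \<le> t"
        have 1: "f t - f u < b * (t - u)" and 2: "(s - e) * (t - u) \<le> f t - f u" using d1(2)[of u t] d2(2)[of u t] ut by auto
        have "b * (t - u) \<le> (s + e) * (t - u)" using b ut by (intro mult_right_mono) auto
        with 1 2 show "\<bar>f t - f u - s * (t - u)\<bar> \<le> e * (t - u)" by (simp add: algebra_simps abs_le_iff)
      qed
    qed
    have "(f has_derivative (\<lambda>h. s * h)) (at x)"
      unfolding has_derivative_at_alt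
    proof (intro conjI allI impI)
      show "bounded_linear (\<lambda>h. s * h)" by (rule bounded_linear_mult_right)
      fix e :: real assume "0 < e"
      then obtain d where d: "0 < d" "\<And>u t. u < t \<Longrightarrow> t - u < d \<Longrightarrow> u \<le> x \<Longrightarrow> x \<le> t \<Longrightarrow> \<bar>f t - f u - s * (t - u)\<bar> \<le> e * (t - u)"
        using key by meson
      show "\<exists>d>0. \<forall>y. norm (y - x) < d \<longrightarrow> norm (f y - f x - s * (y - x)) \<le> e * norm (y - x)"
      proof (intro exI[of _ d] conjI allI impI d(1))
        fix y assume y: "norm (y - x) < d"
        consider "y = x" | "y > x" | "y < x" by linarith
        then show "norm (f y - f x - s * (y - x)) \<le> e * norm (y - x)"
        proof cases
          case 2 then show ?thesis using d(2)[of x y] y by auto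
        next
          case 3 then show ?thesis using d(2)[of y x] y by (auto simp: algebra_simps abs_minus_commute)
        qed auto
      qed
    qed
    then show ?thesis unfolding differentiable_def by blast
  qed
  ultimately show ?thesis by (meson mem_Collect_eq negligible_subset subsetI)
qed

text \<open>Adding \<open>L * x\<close> makes \<open>f\<close> monotone and keeps it
  Lipschitz.\<close>

lemma negligible_not_differentiable_lipschitz_real:
  fixes f :: "real \<Rightarrow> real"
  assumes lip: "L-lipschitz_on UNIV f"
  shows "negligible {x. \<not> f differentiable (at x)}"
proof -
  define g where "g = (\<lambda>x. f x + L * x)"
  have L: "0 \<le> L" using lip by (rule lipschitz_on_nonneg)
  have "mono g"
  proof (rule monoI)
    fix x y :: real assume "x \<le> y"
    then show "g x \<le> g y"
      using lipschitz_onD[OF lip, of x y] by (simp add: g_def dist_real_def abs_le_iff algebra_simps)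
  qed
  moreover have "(L + L)-lipschitz_on UNIV g"
    unfolding g_def using L
    by (intro lipschitz_on_add lip) (auto simp: lipschitz_on_def dist_real_def abs_mult simp flip: right_diff_distrib)
  ultimately have "negligible {x. \<not> g differentiable (at x)}"
    by (rule negligible_not_differentiable_mono_lipschitz)
  moreover have "f differentiable (at x)" if "g differentiable (at x)" for x
  proof -
    have "(\<lambda>x. g x - L * x) differentiable (at x)"
      by (intro differentiable_diff that) simp
    then show ?thesis by (simp add: g_def)
  qed
  ultimately show ?thesis by (auto intro: negligible_subset)
qed

section \<open>From lines to several dimensions\<close>

lemma differentiable_at_approxI:
  fixes f :: "'a::euclidean_space \<Rightarrow> real"
  assumes appr: "\<And>e. 0 < e \<Longrightarrow> \<exists>w. \<exists>d>0. \<forall>h. norm h < d \<longrightarrow> \<bar>f (x + h) - f x - w \<bullet> h\<bar> \<le> e * norm h"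
  shows "f differentiable (at x)"
proof -
  have "\<forall>n. \<exists>w. \<exists>d>0. \<forall>h. norm h < d \<longrightarrow> \<bar>f (x + h) - f x - w \<bullet> h\<bar> \<le> inverse (real (Suc n)) * norm h"
    using appr by (auto simp del: of_nat_Suc)
  then obtain w where w: "\<And>n. \<exists>d>0. \<forall>h. norm h < d \<longrightarrow> \<bar>f (x + h) - f x - w n \<bullet> h\<bar> \<le> inverse (real (Suc n)) * norm h"
    by metis
  \<comment> \<open>Two approximate gradients differ by at most the sum of their tolerances, as
    testing along their difference shows. So they form a Cauchy sequence, and its limit is the
    gradient.\<close>
  have close: "norm (w n - w m) \<le> inverse (real (Suc n)) + inverse (real (Suc m))" for n m
  proof (cases "w n = w m")
    case False
    obtain d1 where d1: "0 < d1" "\<And>h. norm h < d1 \<Longrightarrow> \<bar>f (x + h) - f x - w n \<bullet> h\<bar> \<le> inverse (real (Suc n)) * norm h" using w by meson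
    obtain d2 where d2: "0 < d2" "\<And>h. norm h < d2 \<Longrightarrow> \<bar>f (x + h) - f x - w m \<bullet> h\<bar> \<le> inverse (real (Suc m)) * norm h" using w by meson
    define z where "z = w n - w m"
    define c where "c = min d1 d2 / (2 * norm z)"
    have z: "0 < norm z" using False by (simp add: z_def)
    have c: "0 < c" using z d1 d2 by (simp add: c_def)
    have nc: "norm (c *\<^sub>R z) < d1" "norm (c *\<^sub>R z) < d2" using z d1(1) d2(1) by (auto simp: c_def)
    have "\<bar>w n \<bullet> (c *\<^sub>R z) - w m \<bullet> (c *\<^sub>R z)\<bar> \<le> (inverse (real (Suc n)) + inverse (real (Suc m))) * norm (c *\<^sub>R z)"
      using d1(2)[OF nc(1)] d2(2)[OF nc(2)] unfolding distrib_right by linarith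
    also have "w n \<bullet> (c *\<^sub>R z) - w m \<bullet> (c *\<^sub>R z) = c * norm z * norm z"
      by (simp add: z_def inner_diff_left[symmetric] dot_square_norm power2_eq_square flip: right_diff_distrib)
    finally have "(c * norm z) * norm z \<le> (c * norm z) * (inverse (real (Suc n)) + inverse (real (Suc m)))"
      using c z by (simp add: abs_mult mult_ac del: of_nat_Suc)
    then show ?thesis using c z by (simp add: z_def del: of_nat_Suc)
  qed simp
  have inv: "(\<lambda>n. inverse (real (Suc n))) \<longlonglongrightarrow> 0" by (rule LIMSEQ_inverse_real_of_nat)
  have "Cauchy w"
  proof (rule CauchyI)
    fix e :: real assume "0 < e"
    then obtain M where M: "inverse (real (Suc M)) < e / 2" using reals_Archimedean[of "e/2"] by auto
    show "\<exists>M. \<forall>m\<ge>M. \<forall>n\<ge>M. norm (w m - w n) < e"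
    proof (intro exI[of _ M] allI impI)
      fix m n assume mn: "M \<le> m" "M \<le> n"
      then have "inverse (real (Suc m)) \<le> inverse (real (Suc M))" "inverse (real (Suc n)) \<le> inverse (real (Suc M))"
        by (auto intro!: le_imp_inverse_le)
      then show "norm (w m - w n) < e" using close[of m n] M by linarith
    qed
  qed
  then obtain W where W: "w \<longlonglongrightarrow> W" using Cauchy_convergent_iff convergent_def by blast
  have Wn: "norm (w n - W) \<le> inverse (real (Suc n))" for n
  proof (rule tendsto_le[OF trivial_limit_sequentially])
    show "(\<lambda>m. norm (w n - w m)) \<longlonglongrightarrow> norm (w n - W)" by (intro tendsto_intros W)
    show "(\<lambda>m. inverse (real (Suc n)) + inverse (real (Suc m))) \<longlonglongrightarrow> inverse (real (Suc n))"
      using tendsto_add[OF tendsto_const inv] by simp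
  qed (use close in auto)
  have "(f has_derivative (\<lambda>h. W \<bullet> h)) (at x)"
    unfolding has_derivative_at_alt
  proof (intro conjI allI impI)
    show "bounded_linear (\<lambda>h. W \<bullet> h)" by (rule bounded_linear_inner_right)
    fix e :: real assume "0 < e"
    then obtain n where n: "inverse (real (Suc n)) < e / 2" using reals_Archimedean[of "e/2"] by auto
    obtain d where d: "0 < d" "\<And>h. norm h < d \<Longrightarrow> \<bar>f (x + h) - f x - w n \<bullet> h\<bar> \<le> inverse (real (Suc n)) * norm h" using w by meson
    show "\<exists>d>0. \<forall>y. norm (y - x) < d \<longrightarrow> norm (f y - f x - W \<bullet> (y - x)) \<le> e * norm (y - x)"
    proof (intro exI[of _ d] conjI allI impI d(1))
      fix y assume "norm (y - x) < d"
      then have 1: "\<bar>f y - f x - w n \<bullet> (y - x)\<bar> \<le> inverse (real (Suc n)) * norm (y - x)" using d(2)[of "y - x"] by simp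
      have "\<bar>(w n - W) \<bullet> (y - x)\<bar> \<le> norm (w n - W) * norm (y - x)" by (rule Cauchy_Schwarz_ineq2)
      also have "\<dots> \<le> inverse (real (Suc n)) * norm (y - x)" by (intro mult_right_mono Wn) auto
      finally have 2: "\<bar>w n \<bullet> (y - x) - W \<bullet> (y - x)\<bar> \<le> inverse (real (Suc n)) * norm (y - x)" by (simp add: inner_diff_left)
      have "2 * (inverse (real (Suc n)) * norm (y - x)) \<le> e * norm (y - x)"
        using mult_right_mono[of "2 * inverse (real (Suc n))" e "norm (y - x)"] n by simp
      with 1 2 show "norm (f y - f x - W \<bullet> (y - x)) \<le> e * norm (y - x)" by (simp only: real_norm_def)
    qed
  qed
  then show ?thesis unfolding differentiable_def by blast
qed

text \<open>Points at which every difference quotient in direction \<open>v\<close> at a scale below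
  \<open>1 / (k + 1)\<close> agrees with \<open>q\<close> up to \<open>1 / (m + 1)\<close>. For
  rational \<open>q\<close> these sets form a countable family, and for continuous \<open>f\<close>
  each is closed, hence Borel as Fubini requires.\<close>

definition slope_set :: "('a::euclidean_space \<Rightarrow> real) \<Rightarrow> 'a \<Rightarrow> nat \<Rightarrow> real \<Rightarrow> nat \<Rightarrow> 'a set" where
  "slope_set f v m q k = {x. \<forall>h. \<bar>h\<bar> < inverse (real (Suc k)) \<longrightarrow>
      \<bar>f (x + h *\<^sub>R v) - f x - q * h\<bar> \<le> inverse (real (Suc m)) * \<bar>h\<bar>}"

lemma closed_slope_set:
  assumes "continuous_on UNIV f"
  shows "closed (slope_set f v m q k)"
proof -
  have c: "continuous_on UNIV (\<lambda>x. f (x + h *\<^sub>R v))" for h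
    by (rule continuous_on_compose2[OF assms]) (auto intro: continuous_intros)
  have "slope_set f v m q k = (\<Inter>h\<in>{h. \<bar>h\<bar> < inverse (real (Suc k))}.
     {x. \<bar>f (x + h *\<^sub>R v) - f x - q * h\<bar> \<le> inverse (real (Suc m)) * \<bar>h\<bar>})"
    by (auto simp: slope_set_def)
  also have "closed \<dots>"
    by (intro closed_INT ballI closed_Collect_le continuous_intros assms c)
  finally show ?thesis .
qed

text \<open>By translation invariance and Fubini on \<open>{(x, t). x + t v \<in> B}\<close>, a Borel set \<open>B\<close> meeting each
  line parallel to \<open>v\<close> in a null set is null.\<close>

lemma negligible_null_on_lines:
  fixes B :: "'a::euclidean_space set"
  assumes B: "B \<in> sets borel" and lines: "\<And>x. negligible {t. x + t *\<^sub>R v \<in> B}"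
  shows "negligible B"
proof -
  have m: "(\<lambda>p. fst p + snd p *\<^sub>R v) \<in> borel_measurable (lborel \<Otimes>\<^sub>M lborel)"
    by measurable
  have P: "{p \<in> space (lborel \<Otimes>\<^sub>M lborel). fst p + snd p *\<^sub>R v \<notin> B} \<in> sets (lborel \<Otimes>\<^sub>M (lborel :: real measure))"
  proof -
    have "{p \<in> space (lborel \<Otimes>\<^sub>M (lborel :: real measure)). fst p + snd p *\<^sub>R v \<notin> B}
        = (\<lambda>p. fst p + snd p *\<^sub>R v) -` (- B) \<inter> space (lborel \<Otimes>\<^sub>M lborel)" by blast
    also have "\<dots> \<in> sets (lborel \<Otimes>\<^sub>M lborel)"
      by (rule measurable_sets[OF m borel_comp[OF B]])
    finally show ?thesis .
  qed
  have "AE t in lborel. x + t *\<^sub>R v \<notin> B" for x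
  proof -
    have meas: "{t. x + t *\<^sub>R v \<in> B} \<in> sets borel"
    proof -
      have "(\<lambda>t. x + t *\<^sub>R v) -` B \<inter> space borel \<in> sets borel"
        by (rule measurable_sets[OF _ B]) measurable
      then show ?thesis by (simp add: vimage_def)
    qed
    have "{t. x + t *\<^sub>R v \<in> B} \<in> null_sets lborel"
      using lines[of x] meas by (auto simp: negligible_iff_null_sets null_sets_def)
    then show ?thesis by (rule AE_I'[where N="{t. x + t *\<^sub>R v \<in> B}"]) auto
  qed
  then have "AE x in lborel. AE t in lborel. x + t *\<^sub>R v \<notin> B" by simp
  then have "AE t in lborel. AE x in lborel. x + t *\<^sub>R v \<notin> B"
    using lborel_pair.AE_commute[of "\<lambda>x t. x + t *\<^sub>R v \<notin> B"] P by (simp add: lborel_prod)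
  \<comment> \<open>One value of \<open>t\<close> that is good for almost every \<open>x\<close>
    suffices: the exceptional set for this \<open>t\<close> is a translate of
    \<open>B\<close>.\<close>
  then obtain t where t: "AE x in lborel. x + t *\<^sub>R v \<notin> B"
    using eventually_happens[of _ "ae_filter (lborel :: real measure)"] by (auto simp: ae_filter_eq_bot_iff)
  have "negligible {x. x + t *\<^sub>R v \<in> B}"
  proof -
    obtain N where N: "{x \<in> space lborel. \<not> x + t *\<^sub>R v \<notin> B} \<subseteq> N" "N \<in> null_sets lborel"
      using AE_E[OF t] by (auto simp: null_sets_def)
    then have "negligible N" using null_sets_completionI[OF N(2)] by (simp add: negligible_iff_null_sets)
    then show ?thesis by (rule negligible_subset) (use N(1) in auto)
  qed
  then have "negligible ((+) (t *\<^sub>R v) ` {x. x + t *\<^sub>R v \<in> B})" by (rule negligible_translation)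
  moreover have "(+) (t *\<^sub>R v) ` {x. x + t *\<^sub>R v \<in> B} = B"
    by (auto simp: image_iff add.commute intro!: exI[of _ "_ - t *\<^sub>R v"])
  ultimately show ?thesis by simp
qed

text \<open>On each line parallel to \<open>v\<close> the function is Lipschitz in one variable,
  hence differentiable almost everywhere, and a rational number approximates the derivative within
  the tolerance.\<close>

lemma negligible_no_slope:
  fixes f :: "'a::euclidean_space \<Rightarrow> real"
  assumes lip: "L-lipschitz_on UNIV f"
  shows "negligible (- (\<Union>q\<in>\<rat>. \<Union>k. slope_set f v m q k))" (is "negligible ?B")
proof (rule negligible_null_on_lines)
  have cont: "continuous_on UNIV f" using lip by (rule lipschitz_on_continuous_on)
  have "(\<Union>q\<in>\<rat>. \<Union>k. slope_set f v m q k) \<in> sets borel"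
    by (intro sets.countable_UN'' countable_rat) (auto intro: borel_closed closed_slope_set cont)
  then show "?B \<in> sets borel" by (rule borel_comp)
  fix x
  define g where "g = (\<lambda>t. f (x + t *\<^sub>R v))"
  have "(L * norm v)-lipschitz_on UNIV g"
  proof (rule lipschitz_onI)
    show "0 \<le> L * norm v" using lipschitz_on_nonneg[OF lip] by simp
    fix s t :: real
    have "dist (g s) (g t) \<le> L * dist (x + s *\<^sub>R v) (x + t *\<^sub>R v)"
      using lipschitz_onD[OF lip UNIV_I UNIV_I] by (simp only: g_def)
    also have "dist (x + s *\<^sub>R v) (x + t *\<^sub>R v) = norm v * dist s t"
      by (simp add: dist_norm flip: scaleR_left_diff_distrib)
    finally show "dist (g s) (g t) \<le> L * norm v * dist s t" by (simp add: mult.assoc)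
  qed
  then have neg: "negligible {t. \<not> g differentiable (at t)}" by (rule negligible_not_differentiable_lipschitz_real)
  show "negligible {t. x + t *\<^sub>R v \<in> ?B}"
  proof (rule negligible_subset[OF neg], rule subsetI, rule CollectI, rule notI)
    fix t assume "t \<in> {t. x + t *\<^sub>R v \<in> ?B}" "g differentiable (at t)"
    then have tB: "x + t *\<^sub>R v \<in> ?B" and "g differentiable (at t)" by auto
    then obtain D where D: "(g has_derivative (\<lambda>h. h * D)) (at t)"
      by (metis has_field_derivative_def mult_commute_abs real_differentiable_def)
    \<comment> \<open>Half of the tolerance is spent on the difference quotient, half on replacing
      \<open>D\<close> by the rational \<open>q\<close>.\<close>
    define e where "e = inverse (real (Suc m)) / 2"
    have e: "0 < e" by (simp add: e_def)
    obtain d where d: "0 < d" "\<And>s. norm (s - t) < d \<Longrightarrow> norm (g s - g t - (s - t) * D) \<le> e * norm (s - t)"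
      using D e unfolding has_derivative_at_alt by blast
    obtain q where q: "q \<in> \<rat>" "D < q" "q < D + e" using Rats_dense_in_real[of D "D + e"] e by auto
    obtain k where k: "inverse (real (Suc k)) < d" using reals_Archimedean[OF d(1)] by auto
    have "x + t *\<^sub>R v \<in> slope_set f v m q k"
      unfolding slope_set_def
    proof (rule CollectI, intro allI impI)
      fix h :: real assume h: "\<bar>h\<bar> < inverse (real (Suc k))"
      have 1: "\<bar>g (t + h) - g t - h * D\<bar> \<le> e * \<bar>h\<bar>" using d(2)[of "t + h"] h k by simp
      have "\<bar>h * (q - D)\<bar> \<le> \<bar>h\<bar> * e" unfolding abs_mult using q by (intro mult_left_mono) auto
      then have 2: "\<bar>q * h - h * D\<bar> \<le> e * \<bar>h\<bar>" by (simp add: algebra_simps)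
      have "\<bar>g (t + h) - g t - q * h\<bar> \<le> 2 * (e * \<bar>h\<bar>)" using 1 2 by linarith
      then show "\<bar>f (x + t *\<^sub>R v + h *\<^sub>R v) - f (x + t *\<^sub>R v) - q * h\<bar> \<le> inverse (real (Suc m)) * \<bar>h\<bar>"
        by (simp add: g_def e_def scaleR_add_left add.assoc)
    qed
    then show False using tB q by blast
  qed
qed

text \<open>Outside a null set, \<open>x\<close> lies for every basis vector and every tolerance in
  some slope set that is not porous at \<open>x\<close>. On the way from \<open>x\<close> to
  \<open>x + h\<close>, one coordinate at a time, each intermediate point is replaced by a point of
  the slope set for the next direction. The absence of holes makes the displacement small relative
  to \<open>norm h\<close>, and the Lipschitz bound controls its effect.\<close>

theorem Rademacher_real:
  fixes f :: "'a::euclidean_space \<Rightarrow> real"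
  assumes lip: "L-lipschitz_on UNIV f"
  shows "negligible {x. \<not> f differentiable (at x)}"
proof -
  \<comment> \<open>The relative size of the holes is tied to the tolerance \<open>m\<close> of the
    slope set, so that both errors tend to 0 together.\<close>
  define por where "por = (\<lambda>i m q k. {x \<in> slope_set f i m q k. \<forall>d>0. \<exists>y t. 0 < t \<and> t < d \<and> dist y x \<le> t \<and>
      ball y (inverse (real (Suc m)) * t) \<inter> slope_set f i m q k = {}})"
  define N where "N = (\<Union>i\<in>Basis. \<Union>m. - (\<Union>q\<in>\<rat>. \<Union>k. slope_set f i m q k)) \<union>
     (\<Union>i\<in>Basis. \<Union>m. \<Union>q\<in>\<rat>. \<Union>k. por i m q k)"
  have L: "0 \<le> L" using lip by (rule lipschitz_on_nonneg)
  have "negligible (por i m q k)" for i m q k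
    by (rule negligible_porous[of "inverse (real (Suc m))"])
       (auto simp: por_def inverse_le_1_iff simp del: of_nat_Suc, fastforce)
  then have "N \<in> null_sets lebesgue"
    unfolding N_def using negligible_no_slope[OF lip]
    by (intro null_sets.Un null_sets_UN' countable_rat countableI_type countable_finite[OF finite_Basis]) (auto simp: negligible_iff_null_sets)
  moreover have "f differentiable (at x)" if x: "x \<notin> N" for x
  proof (rule differentiable_at_approxI)
    fix e :: real assume e: "0 < e"
    define D where "D = real DIM('a)"
    have D: "1 \<le> D" unfolding D_def using DIM_positive[where 'a='a] by linarith
    \<comment> \<open>Each of the \<open>D\<close> coordinate steps costs
      \<open>\<kappa> * (2 * L * D + 1) * norm h\<close>: the 1 is the slope tolerance, and
      \<open>2 * L * D\<close> pays for displacing both ends of the step by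
      \<open>\<kappa> * D * norm h\<close>.\<close>
    define C where "C = D * (2 * L * D + 1)"
    have C: "0 < C" unfolding C_def using D L by (intro mult_pos_pos add_nonneg_pos mult_nonneg_nonneg) auto
    obtain m where m: "inverse (real (Suc m)) < e / C" using reals_Archimedean[of "e / C"] e C by auto
    define \<kappa> where "\<kappa> = inverse (real (Suc m))"
    have \<kappa>: "0 < \<kappa>" "C * \<kappa> \<le> e" 
    proof -
      show "0 < \<kappa>" by (simp add: \<kappa>_def)
      have "C * \<kappa> \<le> C * (e / C)" unfolding \<kappa>_def using m C by (intro mult_left_mono) auto
      then show "C * \<kappa> \<le> e" using C by simp
    qed
    have "\<forall>i\<in>Basis. \<exists>q k. \<exists>d>0. x \<in> slope_set f i m q k \<and>
       (\<forall>y t. 0 < t \<longrightarrow> t < d \<longrightarrow> dist y x \<le> t \<longrightarrow> ball y (\<kappa> * t) \<inter> slope_set f i m q k \<noteq> {})"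
    proof
      fix i :: 'a assume i: "i \<in> Basis"
      have "x \<notin> - (\<Union>q\<in>\<rat>. \<Union>k. slope_set f i m q k)"
      proof
        assume "x \<in> - (\<Union>q\<in>\<rat>. \<Union>k. slope_set f i m q k)"
        then have "x \<in> N" unfolding N_def by (intro UnI1 UN_I[OF i] UN_I[OF UNIV_I])
        with x show False ..
      qed
      then obtain q k where qk: "q \<in> \<rat>" "x \<in> slope_set f i m q k" by auto
      have "x \<notin> por i m q k"
      proof
        assume "x \<in> por i m q k"
        then have "x \<in> N" unfolding N_def by (intro UnI2 UN_I[OF i] UN_I[OF UNIV_I] UN_I[OF qk(1)])
        with x show False ..
      qed
      then show "\<exists>q k. \<exists>d>0. x \<in> slope_set f i m q k \<and>
       (\<forall>y t. 0 < t \<longrightarrow> t < d \<longrightarrow> dist y x \<le> t \<longrightarrow> ball y (\<kappa> * t) \<inter> slope_set f i m q k \<noteq> {})"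
        using qk(2) unfolding por_def \<kappa>_def by blast
    qed
    then obtain q k d where qkd: "\<And>i. i \<in> Basis \<Longrightarrow> 0 < d i"
      "\<And>i y t. i \<in> Basis \<Longrightarrow> 0 < t \<Longrightarrow> t < d i \<Longrightarrow> dist y x \<le> t \<Longrightarrow> ball y (\<kappa> * t) \<inter> slope_set f i m (q i) (k i) \<noteq> {}"
      by metis
    define w where "w = (\<Sum>i\<in>Basis. q i *\<^sub>R i)"
    \<comment> \<open>For \<open>norm h < r\<close> every coordinate step is below the scale of its
      slope set, and \<open>D * norm h\<close>, which bounds the distance of the intermediate points
      from \<open>x\<close>, is below the scale \<open>d i\<close> at which holes are
      excluded.\<close>
    define r where "r = Min ((\<lambda>i. min (inverse (real (Suc (k i)))) (d i / D)) ` Basis)"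
    have r: "0 < r" "\<And>i. i \<in> Basis \<Longrightarrow> r \<le> inverse (real (Suc (k i)))" "\<And>i. i \<in> Basis \<Longrightarrow> r \<le> d i / D"
    proof -
      show "0 < r" unfolding r_def using qkd(1) D by (simp add: Min_gr_iff)
      have "r \<le> min (inverse (real (Suc (k i)))) (d i / D)" if "i \<in> Basis" for i
        unfolding r_def using that by (intro Min_le) auto
      then show "\<And>i. i \<in> Basis \<Longrightarrow> r \<le> inverse (real (Suc (k i)))" "\<And>i. i \<in> Basis \<Longrightarrow> r \<le> d i / D"
        by (meson min.bounded_iff)+
    qed
    show "\<exists>w. \<exists>d>0. \<forall>h. norm h < d \<longrightarrow> \<bar>f (x + h) - f x - w \<bullet> h\<bar> \<le> e * norm h"
    proof (intro exI[of _ w] exI[of _ r] conjI allI impI r(1))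
      fix h :: 'a assume h: "norm h < r"
      define P where "P = (\<lambda>F. x + (\<Sum>i\<in>F. (h \<bullet> i) *\<^sub>R i))"
      have PD: "dist (P F) x \<le> D * norm h" if "F \<subseteq> Basis" for F
      proof -
        have "dist (P F) x = norm (\<Sum>i\<in>F. (h \<bullet> i) *\<^sub>R i)" by (simp add: P_def dist_norm)
        also have "\<dots> \<le> (\<Sum>i\<in>F. norm ((h \<bullet> i) *\<^sub>R i))" by (rule norm_sum)
        also have "\<dots> \<le> (\<Sum>i\<in>F. norm h)"
          using that by (intro sum_mono) (auto simp: Basis_le_norm subset_eq)
        also have "\<dots> \<le> D * norm h"
          using card_mono[OF finite_Basis that] by (simp add: D_def mult_right_mono)
        finally show ?thesis .
      qed
      have step: "\<bar>f (P (insert i F)) - f (P F) - q i * (h \<bullet> i)\<bar> \<le> \<kappa> * ((2 * L * D + 1) * norm h)"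
        if F: "F \<subseteq> Basis" "i \<in> Basis" "i \<notin> F" for i F
      proof (cases "h = 0")
        case False
        have nh: "0 < D * norm h" using D False by simp
        have "D * norm h < D * (d i / D)" using D h r(3)[OF F(2)] by (intro mult_strict_left_mono) auto
        then have "D * norm h < d i" using D by simp
        \<comment> \<open>\<open>P F\<close> may lie off the slope set; without a hole of relative
          size \<open>\<kappa>\<close> around it, some point of the set is close.\<close>
        then obtain z where z: "dist (P F) z < \<kappa> * (D * norm h)" "z \<in> slope_set f i m (q i) (k i)"
          using qkd(2)[OF F(2) nh _ PD[OF F(1)]] by auto
        have hi: "\<bar>h \<bullet> i\<bar> \<le> norm h" using F by (simp add: Basis_le_norm)
        have 1: "\<bar>f (z + (h \<bullet> i) *\<^sub>R i) - f z - q i * (h \<bullet> i)\<bar> \<le> \<kappa> * \<bar>h \<bullet> i\<bar>"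
          using z(2) hi h r(2)[OF F(2)] unfolding slope_set_def \<kappa>_def by auto
        have PF: "P (insert i F) = P F + (h \<bullet> i) *\<^sub>R i"
          using F finite_subset[OF F(1)] by (simp add: P_def algebra_simps)
        have 2: "\<bar>f (P F + (h \<bullet> i) *\<^sub>R i) - f (z + (h \<bullet> i) *\<^sub>R i)\<bar> \<le> L * dist (P F) z"
          using lipschitz_onD[OF lip, of "P F + (h \<bullet> i) *\<^sub>R i" "z + (h \<bullet> i) *\<^sub>R i"] by (simp add: dist_real_def)
        have 3: "\<bar>f (P F) - f z\<bar> \<le> L * dist (P F) z"
          using lipschitz_onD[OF lip, of "P F" z] by (simp add: dist_real_def)
        have 4: "L * dist (P F) z \<le> L * (\<kappa> * (D * norm h))" using z L by (intro mult_left_mono) auto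
        have 5: "\<kappa> * \<bar>h \<bullet> i\<bar> \<le> \<kappa> * norm h" using hi \<kappa> by (intro mult_left_mono) auto
        have "\<bar>f (P (insert i F)) - f (P F) - q i * (h \<bullet> i)\<bar> \<le> 2 * (L * (\<kappa> * (D * norm h))) + \<kappa> * norm h"
          unfolding PF using 1 2 3 4 5 by linarith
        then show ?thesis by (simp add: algebra_simps)
      qed (simp add: P_def)
      have "\<bar>f (P F) - f x - (\<Sum>i\<in>F. q i * (h \<bullet> i))\<bar> \<le> real (card F) * (\<kappa> * ((2 * L * D + 1) * norm h))"
        if "F \<subseteq> Basis" for F
        using finite_subset[OF that finite_Basis] that
      proof (induction F rule: finite_induct)
        case empty then show ?case by (simp add: P_def)
      next
        case (insert i F)
        then have IH: "\<bar>f (P F) - f x - (\<Sum>i\<in>F. q i * (h \<bullet> i))\<bar> \<le> real (card F) * (\<kappa> * ((2 * L * D + 1) * norm h))" by auto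
        have st: "\<bar>f (P (insert i F)) - f (P F) - q i * (h \<bullet> i)\<bar> \<le> \<kappa> * ((2 * L * D + 1) * norm h)"
          using insert by (intro step) auto
        have "(\<Sum>i\<in>insert i F. q i * (h \<bullet> i)) = q i * (h \<bullet> i) + (\<Sum>i\<in>F. q i * (h \<bullet> i))" using insert by simp
        moreover have "real (card (insert i F)) * X = real (card F) * X + X" for X :: real
          using insert by (simp add: algebra_simps)
        ultimately show ?case using IH st by (simp only:)
      qed
      from this[of Basis] have "\<bar>f (x + h) - f x - (\<Sum>i\<in>Basis. q i * (h \<bullet> i))\<bar> \<le> D * (\<kappa> * ((2 * L * D + 1) * norm h))"
        by (simp add: P_def euclidean_representation D_def)
      also have "(\<Sum>i\<in>Basis. q i * (h \<bullet> i)) = w \<bullet> h"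
        by (simp add: w_def inner_sum_left inner_commute[of h])
      also have "D * (\<kappa> * ((2 * L * D + 1) * norm h)) = (C * \<kappa>) * norm h" by (simp add: C_def)
      also have "\<dots> \<le> e * norm h" using \<kappa> by (intro mult_right_mono) auto
      finally show "\<bar>f (x + h) - f x - w \<bullet> h\<bar> \<le> e * norm h" .
    qed
  qed
  ultimately show ?thesis by (metis (mono_tags, lifting) mem_Collect_eq negligible_iff_null_sets negligible_subset subsetI)
qed

corollary Rademacher:
  fixes f :: "'a::euclidean_space \<Rightarrow> 'b::euclidean_space"
  assumes lip: "L-lipschitz_on UNIV f"
  shows "negligible {x. \<not> f differentiable (at x)}"
proof -
  have "L-lipschitz_on UNIV (\<lambda>x. f x \<bullet> i)" if "i \<in> Basis" for i
  proof (rule lipschitz_onI)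
    fix x y
    have "dist (f x \<bullet> i) (f y \<bullet> i) = \<bar>(f x - f y) \<bullet> i\<bar>" by (simp add: dist_real_def inner_diff_left)
    also have "\<dots> \<le> dist (f x) (f y)" using that by (simp add: Basis_le_norm dist_norm)
    also have "\<dots> \<le> L * dist x y" using lipschitz_onD[OF lip] by simp
    finally show "dist (f x \<bullet> i) (f y \<bullet> i) \<le> L * dist x y" .
  qed (rule lipschitz_on_nonneg[OF lip])
  then have "negligible (\<Union>i\<in>Basis. {x. \<not> (\<lambda>x. f x \<bullet> i) differentiable (at x)})"
    by (intro negligible_Union) (auto intro: Rademacher_real)
  then show ?thesis
    by (rule negligible_subset) (auto simp: differentiable_componentwise_within[of f])
qed

subsection \<open>Second order expansions of convex functions\<close>

definition subgradient :: "('a::euclidean_space \<Rightarrow> real) \<Rightarrow> 'a \<Rightarrow> 'a \<Rightarrow> bool" where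
  "subgradient f x p \<longleftrightarrow> (\<forall>y. f x + p \<bullet> (y - x) \<le> f y)"

text \<open>Only the quadratic form of \<open>H\<close> enters, so \<open>H\<close> is an arbitrary
  bounded linear map, symmetric or not.\<close>

definition second_order_expansion :: "('a::euclidean_space \<Rightarrow> real) \<Rightarrow> 'a \<Rightarrow> 'a \<Rightarrow> ('a \<Rightarrow> 'a) \<Rightarrow> bool" where
  "second_order_expansion f x p H \<longleftrightarrow> bounded_linear H \<and>
     (\<forall>e>0. \<exists>d>0. \<forall>h. norm h < d \<longrightarrow> \<bar>f (x + h) - f x - p \<bullet> h - H h \<bullet> h / 2\<bar> \<le> e * (norm h)\<^sup>2)"

text \<open>Convexity is kept in the form that every point has a subgradient, which a maximum of
  affine functions supplies at once. The translation gives access to the continuity of convex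
  functions.\<close>

lemma convex_on_if_subgradient:
  assumes "\<And>x. \<exists>p. subgradient f x p"
  shows "convex_on UNIV f"
proof (rule convex_onI)
  fix t :: real and x y :: 'a assume t: "0 < t" "t < 1"
  define z where "z = (1 - t) *\<^sub>R x + t *\<^sub>R y"
  obtain p where p: "\<And>w. f z + p \<bullet> (w - z) \<le> f w" using assms unfolding subgradient_def by blast
  have "(1 - t) * (f z + p \<bullet> (x - z)) + t * (f z + p \<bullet> (y - z)) \<le> (1 - t) * f x + t * f y"
    using t by (intro add_mono mult_left_mono p) auto
  moreover have "(1 - t) * (f z + p \<bullet> (x - z)) + t * (f z + p \<bullet> (y - z)) = f z + p \<bullet> ((1 - t) *\<^sub>R (x - z) + t *\<^sub>R (y - z))"
    by (simp add: algebra_simps)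
  moreover have "(1 - t) *\<^sub>R (x - z) + t *\<^sub>R (y - z) = 0"
    by (simp add: z_def algebra_simps)
  ultimately show "f ((1 - t) *\<^sub>R x + t *\<^sub>R y) \<le> (1 - t) * f x + t * f y"
    by (simp add: z_def)
qed simp

section \<open>Resolvent of the subdifferential\<close>

lemma resolvent_point_exists:
  assumes sub: "\<And>x. \<exists>p. subgradient f x p"
  shows "\<exists>x. subgradient f x (\<xi> - x)"
proof -
  have conv: "convex_on UNIV f" by (rule convex_on_if_subgradient[OF sub])
  have cont: "continuous_on UNIV f" by (rule convex_on_continuous[OF open_UNIV conv])
  \<comment> \<open>The resolvent point is the minimizer of \<open>f\<close> plus half the squared
    distance to \<open>\<xi>\<close>; the optimality condition at \<open>x\<close> says that
    \<open>\<xi> - x\<close> is a subgradient.\<close>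
  define h where "h = (\<lambda>x. f x + (norm (x - \<xi>))\<^sup>2 / 2)"
  \<comment> \<open>The affine minorant at \<open>\<xi>\<close> shows that outside the ball of
    radius \<open>2 * norm p\<close> the value of \<open>h\<close> is at least
    \<open>h \<xi>\<close>, so a minimum over the ball is global.\<close>
  obtain p where p: "\<And>w. f \<xi> + p \<bullet> (w - \<xi>) \<le> f w" using sub unfolding subgradient_def by blast
  have "continuous_on (cball \<xi> (2 * norm p)) h"
    unfolding h_def by (intro continuous_intros continuous_on_subset[OF cont]) auto
  moreover have "compact (cball \<xi> (2 * norm p))" "cball \<xi> (2 * norm p) \<noteq> {}" by auto
  ultimately obtain x where x: "x \<in> cball \<xi> (2 * norm p)" "\<And>y. y \<in> cball \<xi> (2 * norm p) \<Longrightarrow> h x \<le> h y"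
    using continuous_attains_inf[of "cball \<xi> (2 * norm p)" h] by blast
  have min: "h x \<le> h y" for y
  proof (cases "y \<in> cball \<xi> (2 * norm p)")
    case False
    then have ny: "2 * norm p < norm (y - \<xi>)" by (simp add: dist_norm norm_minus_commute)
    have "h x \<le> h \<xi>" by (rule x(2)) simp
    also have "h \<xi> = f \<xi>" by (simp add: h_def)
    also have "f \<xi> \<le> h y"
    proof -
      have "- (norm p * norm (y - \<xi>)) \<le> p \<bullet> (y - \<xi>)"
        using Cauchy_Schwarz_ineq2[of p "y - \<xi>"] by linarith
      moreover have "norm p * norm (y - \<xi>) \<le> norm (y - \<xi>) / 2 * norm (y - \<xi>)"
        using ny by (intro mult_right_mono) auto
      ultimately show ?thesis using p[of y] by (simp add: h_def power2_eq_square)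
    qed
    finally show ?thesis .
  qed (use x in auto)
  have "f x + (\<xi> - x) \<bullet> (y - x) \<le> f y" for y
  proof -
    define c where "c = (norm (y - x))\<^sup>2"
    have c: "0 \<le> c" by (simp add: c_def)
    \<comment> \<open>Minimality is compared with the point at parameter \<open>s\<close> on the
      segment from \<open>x\<close> to \<open>y\<close> and divided by \<open>s\<close>; the
      quadratic term disappears as \<open>s\<close> tends to 0.\<close>
    have key: "(\<xi> - x) \<bullet> (y - x) - s * c / 2 \<le> f y - f x" if s: "0 < s" "s < 1" for s
    proof -
      have "f ((1 - s) *\<^sub>R x + s *\<^sub>R y) \<le> (1 - s) * f x + s * f y"
        using convex_onD[OF conv, of s x y] s by auto
      moreover have "f x + (norm (x - \<xi>))\<^sup>2 / 2 \<le> f ((1 - s) *\<^sub>R x + s *\<^sub>R y) + (norm ((1 - s) *\<^sub>R x + s *\<^sub>R y - \<xi>))\<^sup>2 / 2"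
        using min by (simp add: h_def)
      moreover have "(norm ((1 - s) *\<^sub>R x + s *\<^sub>R y - \<xi>))\<^sup>2 = (norm (x - \<xi>))\<^sup>2 - 2 * s * ((\<xi> - x) \<bullet> (y - x)) + s\<^sup>2 * c"
      proof -
        have e1: "(1 - s) *\<^sub>R x + s *\<^sub>R y - \<xi> = s *\<^sub>R (y - x) - (\<xi> - x)" by (simp add: algebra_simps)
        have e2: "(norm (s *\<^sub>R a - b))\<^sup>2 = (norm b)\<^sup>2 - 2 * s * (b \<bullet> a) + s\<^sup>2 * (norm a)\<^sup>2" for a b :: 'a
          unfolding power2_norm_eq_inner
          by (simp add: inner_diff_left inner_diff_right inner_commute power2_eq_square)
        show ?thesis unfolding e1 e2 c_def by (simp add: norm_minus_commute)
      qed
      ultimately have "s * ((\<xi> - x) \<bullet> (y - x)) - s * (s * c / 2) \<le> s * (f y - f x)"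
        by (simp add: algebra_simps power2_eq_square)
      then have "s * ((\<xi> - x) \<bullet> (y - x) - s * c / 2) \<le> s * (f y - f x)" by (simp add: right_diff_distrib)
      then show ?thesis using s by simp
    qed
    have "(\<xi> - x) \<bullet> (y - x) \<le> f y - f x"
    proof (rule field_le_epsilon)
      fix e :: real assume e: "0 < e"
      define s where "s = min (1/2) (e / (c + 1))"
      have s: "0 < s" "s < 1" using e c by (auto simp: s_def)
      have "s * c \<le> e / (c + 1) * c" using c by (intro mult_right_mono) (auto simp: s_def)
      also have "\<dots> \<le> e" using c e by (simp add: field_simps)
      finally show "(\<xi> - x) \<bullet> (y - x) \<le> f y - f x + e" using key[OF s] e by linarith
    qed
    then show ?thesis by simp
  qed
  then show ?thesis unfolding subgradient_def by blast
qed

text \<open>Monotonicity of the subdifferential: the two subgradient inequalities add up to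
  \<open>(norm (x - y))\<^sup>2 \<le> (\<xi> - \<zeta>) \<bullet> (x - y)\<close>. The case
  \<open>\<xi> = \<zeta>\<close> is the uniqueness of the resolvent point.\<close>

lemma resolvent_nonexpansive:
  assumes "subgradient f x (\<xi> - x)" "subgradient f y (\<zeta> - y)"
  shows "norm (x - y) \<le> norm (\<xi> - \<zeta>)"
proof -
  have "f x + (\<xi> - x) \<bullet> (y - x) \<le> f y" "f y + (\<zeta> - y) \<bullet> (x - y) \<le> f x"
    using assms by (auto simp: subgradient_def)
  then have "(norm (x - y))\<^sup>2 \<le> (\<xi> - \<zeta>) \<bullet> (x - y)"
    by (simp add: power2_norm_eq_inner algebra_simps inner_commute)
  also have "\<dots> \<le> norm (\<xi> - \<zeta>) * norm (x - y)" by (rule norm_cauchy_schwarz)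
  finally have "norm (x - y) * norm (x - y) \<le> norm (\<xi> - \<zeta>) * norm (x - y)" by (simp add: power2_eq_square)
  then show ?thesis by (cases "x = y") auto
qed

lemma resolvent_exists:
  assumes sub: "\<And>x. \<exists>p. subgradient f x p"
  obtains J where "\<And>\<xi>. subgradient f (J \<xi>) (\<xi> - J \<xi>)" "1-lipschitz_on UNIV J"
    "\<And>x p. subgradient f x p \<Longrightarrow> J (x + p) = x"
proof -
  obtain J where J: "\<And>\<xi>. subgradient f (J \<xi>) (\<xi> - J \<xi>)"
    using resolvent_point_exists[OF sub] by metis
  have ne: "norm (J \<xi> - J \<zeta>) \<le> norm (\<xi> - \<zeta>)" for \<xi> \<zeta>
    by (rule resolvent_nonexpansive[OF J J])
  then have "1-lipschitz_on UNIV J" by (auto simp: lipschitz_on_def dist_norm)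
  moreover have "J (x + p) = x" if "subgradient f x p" for x p
    using resolvent_nonexpansive[OF J[of "x + p"], of x "x + p"] that by simp
  ultimately show thesis using J that by blast
qed

text \<open>At \<open>y + s *\<^sub>R (q - p)\<close> the affine minorant at \<open>y\<close> lies
  below the paraboloid. With \<open>D = norm (q - p)\<close> and \<open>r = norm (y - x)\<close>
  this reads \<open>s * D\<^sup>2 \<le> C * (r + s * D)\<^sup>2\<close>, and
  \<open>s = r / D\<close> gives the constant 4.\<close>

lemma subgradient_close_if_touched_above:
  assumes p: "subgradient f x p" and C: "0 < C"
    and up: "\<And>y. f y \<le> f x + p \<bullet> (y - x) + C * (norm (y - x))\<^sup>2"
    and q: "subgradient f y q"
  shows "norm (q - p) \<le> 4 * C * norm (y - x)"
proof (cases "q = p")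
  case False
  define D where "D = norm (q - p)" define r where "r = norm (y - x)"
  have D: "0 < D" using False by (simp add: D_def)
  have key: "s * D\<^sup>2 \<le> C * (r + s * D)\<^sup>2" if s: "0 < s" for s
  proof -
    define w where "w = y + s *\<^sub>R (q - p)"
    have "f y + q \<bullet> (w - y) \<le> f w" using q by (simp add: subgradient_def)
    moreover have "f w \<le> f x + p \<bullet> (w - x) + C * (norm (w - x))\<^sup>2" by (rule up)
    moreover have "f x + p \<bullet> (y - x) \<le> f y" using p by (simp add: subgradient_def)
    ultimately have "(q - p) \<bullet> (w - y) \<le> C * (norm (w - x))\<^sup>2"
      by (simp add: inner_diff_left inner_diff_right)
    moreover have "(q - p) \<bullet> (w - y) = s * D\<^sup>2" by (simp add: w_def D_def dot_square_norm)
    moreover have "norm (w - x) \<le> r + s * D"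
    proof -
      have "w - x = (y - x) + s *\<^sub>R (q - p)" by (simp add: w_def)
      then show ?thesis using norm_triangle_ineq[of "y - x" "s *\<^sub>R (q - p)"] s by (simp only:) (simp add: r_def D_def)
    qed
    then have "C * (norm (w - x))\<^sup>2 \<le> C * (r + s * D)\<^sup>2" using C by (intro mult_left_mono power_mono) auto
    ultimately show ?thesis by linarith
  qed
  \<comment> \<open>For \<open>r = 0\<close> the choice \<open>s = 1 / (2 * C)\<close> would give
    \<open>D\<^sup>2 / (2 * C) \<le> D\<^sup>2 / (4 * C)\<close>.\<close>
  have "r \<noteq> 0"
  proof
    assume "r = 0"
    then have "(1 / (2 * C)) * D\<^sup>2 \<le> C * ((1 / (2 * C)) * D)\<^sup>2" using key[of "1 / (2 * C)"] C by simp
    then show False using C D by (simp add: power2_eq_square field_simps)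
  qed
  then have r: "0 < r" by (simp add: r_def)
  then have "(r / D) * D\<^sup>2 \<le> C * (r + (r / D) * D)\<^sup>2" using key[of "r / D"] D by simp
  then have "r * D \<le> r * (4 * C * r)" using D by (simp add: power2_eq_square algebra_simps)
  then show ?thesis using r by (simp add: D_def r_def)
qed (use C in simp)

text \<open>Over \<open>n\<close> equal pieces of the unit interval the quadratic errors add up to
  \<open>K / n\<close> only. This stands in for integrating a gradient along a segment when only
  subgradients at each point are at hand.\<close>

lemma increment_le_if_locally_lipschitz:
  fixes g :: "real \<Rightarrow> real"
  assumes g: "\<And>s t. 0 \<le> s \<Longrightarrow> s \<le> t \<Longrightarrow> t \<le> 1 \<Longrightarrow> \<bar>g t - g s\<bar> \<le> a * (t - s) + K * (t - s)\<^sup>2"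
  shows "\<bar>g 1 - g 0\<bar> \<le> a"
proof -
  have bound: "\<bar>g 1 - g 0\<bar> \<le> a + K * inverse (real (Suc n))" for n
  proof -
    define N where "N = real (Suc n)"
    have N: "0 < N" by (simp add: N_def)
    have "g 1 - g 0 = (\<Sum>i<Suc n. g (real (Suc i) / N) - g (real i / N))"
      using sum_lessThan_telescope[of "\<lambda>i. g (real i / N)" "Suc n"] N by (simp add: N_def)
    also have "\<bar>\<dots>\<bar> \<le> (\<Sum>i<Suc n. a / N + K / N\<^sup>2)"
    proof (rule order_trans[OF sum_abs sum_mono])
      fix i assume "i \<in> {..<Suc n}"
      then have "real (Suc i) \<le> N" by (simp add: N_def)
      moreover have "real (Suc i) / N - real i / N = 1 / N" by (simp add: diff_divide_distrib[symmetric])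
      ultimately show "\<bar>g (real (Suc i) / N) - g (real i / N)\<bar> \<le> a / N + K / N\<^sup>2"
        using g[of "real i / N" "real (Suc i) / N"] N by (simp add: divide_right_mono power_divide)
    qed
    also have "\<dots> = N * (a / N + K / N\<^sup>2)" by (simp add: N_def)
    also have "\<dots> = a + K / N" using N by (simp add: field_simps power2_eq_square)
    finally show ?thesis by (simp add: N_def divide_inverse)
  qed
  show ?thesis
  proof (rule LIMSEQ_le_const)
    show "(\<lambda>n. a + K * inverse (real (Suc n))) \<longlonglongrightarrow> a"
      using tendsto_add[OF tendsto_const tendsto_mult[OF tendsto_const LIMSEQ_inverse_real_of_nat], of a K] by simp
  qed (use bound in auto)
qed

text \<open>Being touched from above by a paraboloid makes the derivative of the resolvent invertible;
  its inverse minus the identity is the Hessian.\<close>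

lemma second_order_expansion_if_resolvent_differentiable:
  fixes f :: "'a::euclidean_space \<Rightarrow> real"
  assumes sub: "\<And>x. \<exists>p. subgradient f x p"
    and J: "\<And>\<xi>. subgradient f (J \<xi>) (\<xi> - J \<xi>)" "\<And>x p. subgradient f x p \<Longrightarrow> J (x + p) = x"
    and p: "subgradient f x p" and diff: "J differentiable (at (x + p))"
    and C: "0 < C" and up: "\<And>y. f y \<le> f x + p \<bullet> (y - x) + C * (norm (y - x))\<^sup>2"
  shows "\<exists>H. second_order_expansion f x p H"
proof -
  define M where "M = 1 + 4 * C"
  have M: "1 \<le> M" using C by (simp add: M_def)
  obtain A where A: "(J has_derivative A) (at (x + p))" using diff unfolding differentiable_def by blast
  interpret A: bounded_linear A using A by (rule has_derivative_bounded_linear)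
  have Jx: "J (x + p) = x" using J(2)[OF p] .
  \<comment> \<open>The map from \<open>y\<close> to \<open>y + q\<close>, inverse to the resolvent,
    expands distances from \<open>x\<close> at most by the factor \<open>M\<close>. So
    \<open>J\<close> shrinks distances from \<open>x + p\<close> at most by \<open>M\<close>, its
    derivative \<open>A\<close> inherits this, and \<open>A\<close> is injective.\<close>
  have kM: "norm ((y - x) + (q - p)) \<le> M * norm (y - x)" if "subgradient f y q" for y q
    using subgradient_close_if_touched_above[OF p C up that] norm_triangle_ineq[of "y - x" "q - p"]
    by (simp add: M_def algebra_simps)
  have Jexp: "norm k \<le> M * norm (J (x + p + k) - x)" for k
    using kM[OF J(1)[of "x + p + k"]] by (simp add: algebra_simps)
  have Aexp: "norm k \<le> M * norm (A k)" for k
  proof (rule field_le_epsilon)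
    fix e :: real assume e: "0 < e"
    show "norm k \<le> M * norm (A k) + e"
    proof (cases "k = 0")
      case False
      then have k: "0 < norm k" by simp
      define \<eta> where "\<eta> = e / (M * norm k)"
      have \<eta>: "0 < \<eta>" using e k M by (simp add: \<eta>_def)
      obtain d where d: "0 < d" "\<And>y. norm (y - (x + p)) < d \<Longrightarrow> norm (J y - J (x + p) - A (y - (x + p))) \<le> \<eta> * norm (y - (x + p))"
        using A \<eta> unfolding has_derivative_at_alt by blast
      define s where "s = d / (2 * norm k)"
      have s: "0 < s" "norm (s *\<^sub>R k) < d" using d k by (auto simp: s_def)
      have 1: "norm (J (x + p + s *\<^sub>R k) - x - A (s *\<^sub>R k)) \<le> \<eta> * norm (s *\<^sub>R k)"
        using d(2)[of "x + p + s *\<^sub>R k"] s Jx by simp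
      have "norm (s *\<^sub>R k) \<le> M * norm (J (x + p + s *\<^sub>R k) - x)" by (rule Jexp)
      also have "\<dots> \<le> M * (norm (A (s *\<^sub>R k)) + \<eta> * norm (s *\<^sub>R k))"
        using 1 norm_triangle_sub[of "J (x + p + s *\<^sub>R k) - x" "A (s *\<^sub>R k)"] M by (intro mult_left_mono) auto
      also have "\<dots> = s * (M * norm (A k) + M * \<eta> * norm k)" using s by (simp add: A.scaleR algebra_simps)
      also have "M * \<eta> * norm k = e" using M k by (simp add: \<eta>_def)
      finally have "s * norm k \<le> s * (M * norm (A k) + e)" using s by simp
      then show ?thesis using s by simp
    qed (use e in \<open>simp add: A.zero\<close>)
  qed
  have "inj A"
  proof (rule injI)
    fix a b assume "A a = A b"
    then have "A (a - b) = 0" by (simp add: A.diff)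
    then show "a = b" using Aexp[of "a - b"] by simp
  qed
  then obtain B where B: "linear B" "\<And>k. B (A k) = k" "\<And>k. A (B k) = k"
    using linear_injective_isomorphism[OF A.linear] by metis
  have Bnorm: "norm (B z) \<le> M * norm z" for z using Aexp[of "B z"] B(3) by simp
  define H where "H = (\<lambda>h. B h - h)"
  have H: "bounded_linear H"
    unfolding H_def
    by (intro bounded_linear_sub bounded_linear_ident linear_conv_bounded_linear[THEN iffD1, OF B(1)])
  \<comment> \<open>First order expansion of all subgradients near \<open>x\<close>;
    \<open>f\<close> may fail to be differentiable at the nearby points \<open>y\<close>.\<close>
  have grad: "\<exists>d>0. \<forall>y q. norm (y - x) < d \<longrightarrow> subgradient f y q \<longrightarrow> norm (q - p - H (y - x)) \<le> e * norm (y - x)"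
    if e: "0 < e" for e
  proof -
    define \<eta> where "\<eta> = e / (M * M)"
    have \<eta>: "0 < \<eta>" using e M by (simp add: \<eta>_def)
    obtain d where d: "0 < d" "\<And>y. norm (y - (x + p)) < d \<Longrightarrow> norm (J y - J (x + p) - A (y - (x + p))) \<le> \<eta> * norm (y - (x + p))"
      using A \<eta> unfolding has_derivative_at_alt by blast
    show ?thesis
    proof (intro exI[of _ "d / M"] conjI allI impI)
      show "0 < d / M" using d M by simp
      fix y q assume y: "norm (y - x) < d / M" and q: "subgradient f y q"
      define k where "k = (y - x) + (q - p)"
      have kle: "norm k \<le> M * norm (y - x)" unfolding k_def by (rule kM[OF q])
      also have "\<dots> < d" using y M by (simp add: field_simps)
      finally have "norm k < d" .
      moreover have "J (x + p + k) = y" using J(2)[OF q] by (simp add: k_def algebra_simps)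
      ultimately have "norm (y - x - A k) \<le> \<eta> * norm k"
        using d(2)[of "x + p + k"] Jx by simp
      also have "\<dots> \<le> \<eta> * (M * norm (y - x))" using kle \<eta> by (intro mult_left_mono) auto
      finally have 1: "norm (y - x - A k) \<le> \<eta> * (M * norm (y - x))" .
      have "q - p - H (y - x) = - B (y - x - A k)"
        using B(2)[of k] by (simp add: H_def k_def linear_diff[OF B(1)])
      then have "norm (q - p - H (y - x)) \<le> M * norm (y - x - A k)" using Bnorm by simp
      also have "\<dots> \<le> M * (\<eta> * (M * norm (y - x)))" using 1 M by (intro mult_left_mono) auto
      also have "\<dots> = e * norm (y - x)" using M by (simp add: \<eta>_def)
      finally show "norm (q - p - H (y - x)) \<le> e * norm (y - x)" .
    qed
  qed
  have "second_order_expansion f x p H"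
    unfolding second_order_expansion_def
  proof (intro conjI H allI impI)
    fix e :: real assume "0 < e"
    then obtain d where d: "0 < d" "\<And>y q. norm (y - x) < d \<Longrightarrow> subgradient f y q \<Longrightarrow> norm (q - p - H (y - x)) \<le> e * norm (y - x)"
      using grad by meson
    show "\<exists>d>0. \<forall>h. norm h < d \<longrightarrow> \<bar>f (x + h) - f x - p \<bullet> h - H h \<bullet> h / 2\<bar> \<le> e * (norm h)\<^sup>2"
    proof (intro exI[of _ d] conjI allI impI d(1))
      fix h :: 'a assume h: "norm h < d"
      define c where "c = H h \<bullet> h"
      \<comment> \<open>The remainder along the segment from \<open>x\<close> to
        \<open>x + h\<close>. Subgradients at two of its points bound the increment of
        \<open>f\<close> from both sides, so \<open>g\<close> changes by at most
        \<open>e * (norm h)\<^sup>2 * (t - s)\<close> up to a term quadratic in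
        \<open>t - s\<close>.\<close>
      define g where "g = (\<lambda>s. f (x + s *\<^sub>R h) - f x - s * (p \<bullet> h) - s\<^sup>2 * c / 2)"
      have gr: "\<bar>q \<bullet> h - p \<bullet> h - s * c\<bar> \<le> e * (norm h)\<^sup>2" if s: "0 \<le> s" "s \<le> 1" and q: "subgradient f (x + s *\<^sub>R h) q" for s q
      proof -
        have sh: "norm (s *\<^sub>R h) \<le> norm h" using s by (simp add: mult_left_le_one_le)
        have "norm (q - p - H (s *\<^sub>R h)) \<le> e * norm (s *\<^sub>R h)" using d(2)[OF _ q] sh h by simp
        also have "\<dots> \<le> e * norm h" using sh \<open>0 < e\<close> by (intro mult_left_mono) auto
        finally have "norm (q - p - H (s *\<^sub>R h)) * norm h \<le> e * norm h * norm h" by (intro mult_right_mono) auto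
        moreover have "q \<bullet> h - p \<bullet> h - s * c = (q - p - H (s *\<^sub>R h)) \<bullet> h"
          by (simp add: c_def inner_diff_left linear_cmul[OF bounded_linear.linear[OF H]])
        moreover have "\<bar>(q - p - H (s *\<^sub>R h)) \<bullet> h\<bar> \<le> norm (q - p - H (s *\<^sub>R h)) * norm h" by (rule Cauchy_Schwarz_ineq2)
        ultimately show ?thesis by (simp add: power2_eq_square mult.assoc)
      qed
      have "\<bar>g 1 - g 0\<bar> \<le> e * (norm h)\<^sup>2"
      proof (rule increment_le_if_locally_lipschitz)
        fix s t :: real assume st: "0 \<le> s" "s \<le> t" "t \<le> 1"
        obtain q1 where q1: "subgradient f (x + s *\<^sub>R h) q1" using sub by blast
        obtain q2 where q2: "subgradient f (x + t *\<^sub>R h) q2" using sub by blast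
        have "f (x + s *\<^sub>R h) + q1 \<bullet> ((t - s) *\<^sub>R h) \<le> f (x + t *\<^sub>R h)"
          using q1 unfolding subgradient_def by (metis add_diff_cancel_left scaleR_diff_left)
        then have l: "(t - s) * (q1 \<bullet> h) \<le> f (x + t *\<^sub>R h) - f (x + s *\<^sub>R h)" by simp
        have "f (x + t *\<^sub>R h) + q2 \<bullet> ((s - t) *\<^sub>R h) \<le> f (x + s *\<^sub>R h)"
          using q2 unfolding subgradient_def by (metis add_diff_cancel_left scaleR_diff_left)
        then have u: "f (x + t *\<^sub>R h) - f (x + s *\<^sub>R h) \<le> (t - s) * (q2 \<bullet> h)" by (simp add: algebra_simps)
        define E where "E = e * (norm h)\<^sup>2"
        have "q2 \<bullet> h - p \<bullet> h - t * c \<le> E" "- E \<le> q1 \<bullet> h - p \<bullet> h - s * c"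
          using gr[OF _ _ q1] gr[OF _ _ q2] st unfolding E_def by (auto simp: abs_le_iff)
        then have m: "(t - s) * (q2 \<bullet> h - p \<bullet> h - t * c) \<le> (t - s) * E" "(t - s) * (- E) \<le> (t - s) * (q1 \<bullet> h - p \<bullet> h - s * c)"
          using st by (intro mult_left_mono; simp)+
        have gd: "g t - g s = f (x + t *\<^sub>R h) - f (x + s *\<^sub>R h) - (t - s) * (p \<bullet> h) - (t\<^sup>2 - s\<^sup>2) * c / 2"
          by (simp add: g_def algebra_simps diff_divide_distrib)
        have a: "(t - s) * (q2 \<bullet> h) - (t - s) * (p \<bullet> h) - (t\<^sup>2 - s\<^sup>2) * c / 2 = (t - s) * (q2 \<bullet> h - p \<bullet> h - t * c) + (t - s)\<^sup>2 * (c / 2)"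
          by (simp add: power2_eq_square algebra_simps diff_divide_distrib add_divide_distrib)
        have b: "(t - s) * (q1 \<bullet> h) - (t - s) * (p \<bullet> h) - (t\<^sup>2 - s\<^sup>2) * c / 2 = (t - s) * (q1 \<bullet> h - p \<bullet> h - s * c) - (t - s)\<^sup>2 * (c / 2)"
          by (simp add: power2_eq_square algebra_simps diff_divide_distrib add_divide_distrib)
        have "(t - s)\<^sup>2 * (c / 2) \<le> (t - s)\<^sup>2 * \<bar>c / 2\<bar>" by (intro mult_left_mono) auto
        then have "\<bar>g t - g s\<bar> \<le> E * (t - s) + \<bar>c / 2\<bar> * (t - s)\<^sup>2"
          using gd a b m l u by (simp add: abs_le_iff mult.commute)
        then show "\<bar>g t - g s\<bar> \<le> e * (norm h)\<^sup>2 * (t - s) + \<bar>c / 2\<bar> * (t - s)\<^sup>2"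
          by (simp add: E_def)
      qed
      then show "\<bar>f (x + h) - f x - p \<bullet> h - H h \<bullet> h / 2\<bar> \<le> e * (norm h)\<^sup>2"
        by (simp add: g_def c_def)
    qed
  qed
  then show ?thesis by blast
qed

subsection \<open>Jensen's lemma and the theorem on sums\<close>

text \<open>Jensen's lemma. A slope \<open>p\<close> is bad if the resolvent \<open>J\<close> is not differentiable at the point
  \<open>\<xi> = z + (p + G z)\<close> that belongs to a maximizer \<open>z\<close>. Since \<open>z = J \<xi>\<close>, the bad slopes lie in
  the image of a null set under the Lipschitz map \<open>\<xi> \<mapsto> \<xi> - J \<xi> - G (J \<xi>)\<close>.\<close>

lemma Jensen_maximum_with_expansion:
  fixes f :: "'a::euclidean_space \<Rightarrow> real"
  assumes sub: "\<And>x. \<exists>p. subgradient f x p" and growth: "\<And>z. f z \<le> M + R * norm z"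
    and G: "bounded_linear G" and sym: "\<And>a b. G a \<bullet> b = a \<bullet> G b"
    and c: "0 < c" and pos: "\<And>z. c * (norm z)\<^sup>2 \<le> G z \<bullet> z" and \<delta>: "0 < \<delta>"
  shows "\<exists>p z H. norm p < \<delta> \<and> (\<forall>w. f w - G w \<bullet> w / 2 - p \<bullet> w \<le> f z - G z \<bullet> z / 2 - p \<bullet> z) \<and>
           second_order_expansion f z (p + G z) H"
proof -
  interpret G: bounded_linear G by fact
  have cont: "continuous_on UNIV f"
    by (rule convex_on_continuous[OF open_UNIV convex_on_if_subgradient[OF sub]])
  obtain KG where KG: "0 < KG" "\<And>z. norm (G z) \<le> norm z * KG" using G.pos_bounded by blast
  define \<Phi> where "\<Phi> = (\<lambda>p w. f w - G w \<bullet> w / 2 - p \<bullet> w)"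
  have "\<exists>z. \<forall>w. \<Phi> p w \<le> \<Phi> p z" for p
  proof -
    define A where "A = \<bar>M\<bar> + \<bar>f 0\<bar>" define b where "b = \<bar>R\<bar> + norm p"
    \<comment> \<open>Beyond radius \<open>\<rho>\<close> the quadratic
      \<open>c * (norm w)\<^sup>2 / 2\<close> outweighs the linear growth of \<open>f\<close> and of
      the tilt, so that \<open>\<Phi> p w \<le> \<Phi> p 0\<close>.\<close>
    define \<rho> where "\<rho> = 1 + 2 * (A + b) / c"
    have Ab: "0 \<le> A" "0 \<le> b" by (auto simp: A_def b_def)
    have \<rho>: "1 \<le> \<rho>" using Ab c by (simp add: \<rho>_def)
    have "continuous_on (cball 0 \<rho>) (\<Phi> p)"
      unfolding \<Phi>_def
      by (intro continuous_intros continuous_on_subset[OF cont] G.continuous_on) auto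
    then obtain z where z: "z \<in> cball 0 \<rho>" "\<And>w. w \<in> cball 0 \<rho> \<Longrightarrow> \<Phi> p w \<le> \<Phi> p z"
      using continuous_attains_sup[of "cball 0 \<rho>" "\<Phi> p"] \<rho> by auto
    have "\<Phi> p w \<le> \<Phi> p z" for w
    proof (cases "w \<in> cball 0 \<rho>")
      case False
      define r where "r = norm w"
      have r: "\<rho> < r" "1 \<le> r" using False \<rho> by (auto simp: r_def)
      have "\<Phi> p w \<le> M + R * r - c * r\<^sup>2 / 2 + norm p * r"
        using growth[of w] pos[of w] Cauchy_Schwarz_ineq2[of p w] by (simp add: \<Phi>_def r_def)
      also have "\<dots> \<le> f 0 + ((A + b) * r - c * r\<^sup>2 / 2)"
      proof -
        have "M - f 0 \<le> A * r" using mult_left_mono[OF r(2) Ab(1)] by (simp add: A_def)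
        moreover have "R * r + norm p * r \<le> b * r" using r by (simp add: b_def distrib_right[symmetric])
        ultimately show ?thesis by (simp add: distrib_right)
      qed
      also have "(A + b) * r - c * r\<^sup>2 / 2 = r * ((A + b) - c * r / 2)" by (simp add: power2_eq_square algebra_simps)
      also have "\<dots> \<le> 0"
      proof -
        have "2 * (A + b) / c \<le> r" using r by (simp add: \<rho>_def)
        then have "A + b \<le> c * r / 2" using c by (simp add: field_simps)
        then show ?thesis using r by (intro mult_nonneg_nonpos) auto
      qed
      also have "f 0 + 0 = \<Phi> p 0" by (simp add: \<Phi>_def)
      also have "\<Phi> p 0 \<le> \<Phi> p z" by (rule z(2)) (use \<rho> in auto)
      finally show ?thesis by simp
    qed (use z in auto)
    then show ?thesis by blast
  qed
  then obtain Z where Z: "\<And>p w. \<Phi> p w \<le> \<Phi> p (Z p)" by metis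
  \<comment> \<open>Maximality at \<open>Z p\<close> restated: \<open>f\<close> is touched from
    above at \<open>Z p\<close> by a paraboloid whose opening \<open>KG\<close> does not depend on
    \<open>p\<close>.\<close>
  have upper: "f y \<le> f (Z p) + (p + G (Z p)) \<bullet> (y - Z p) + KG * (norm (y - Z p))\<^sup>2" for p y
  proof -
    have "G y \<bullet> y = G (Z p) \<bullet> Z p + 2 * (G (Z p) \<bullet> (y - Z p)) + G (y - Z p) \<bullet> (y - Z p)"
      using sym[of "Z p" y] by (simp add: G.diff inner_diff_left inner_diff_right inner_commute)
    moreover have "G (y - Z p) \<bullet> (y - Z p) \<le> KG * (norm (y - Z p))\<^sup>2"
    proof -
      have "G (y - Z p) \<bullet> (y - Z p) \<le> norm (G (y - Z p)) * norm (y - Z p)" by (rule norm_cauchy_schwarz)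
      also have "\<dots> \<le> (norm (y - Z p) * KG) * norm (y - Z p)" by (intro mult_right_mono KG) auto
      finally show ?thesis by (simp add: power2_eq_square mult_ac)
    qed
    moreover have "0 \<le> KG * (norm (y - Z p))\<^sup>2" using KG by simp
    moreover have "f y - G y \<bullet> y / 2 - p \<bullet> y \<le> f (Z p) - G (Z p) \<bullet> Z p / 2 - p \<bullet> Z p"
      using Z[of p y] by (simp add: \<Phi>_def)
    moreover have "(p + G (Z p)) \<bullet> (y - Z p) = p \<bullet> y - p \<bullet> Z p + G (Z p) \<bullet> (y - Z p)"
      by (simp add: inner_add_left inner_diff_right)
    ultimately show ?thesis by linarith
  qed
  \<comment> \<open>A subgradient with a slope other than that of the touching paraboloid would
    contradict \<open>upper\<close> after a short step along the difference of the slopes.\<close>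
  have subZ: "subgradient f (Z p) (p + G (Z p))" for p
  proof -
    obtain q where q: "subgradient f (Z p) q" using sub by blast
    define D where "D = q - (p + G (Z p))"
    have "D = 0"
    proof (rule ccontr)
      assume "D \<noteq> 0"
      then have D: "0 < (norm D)\<^sup>2" by simp
      define w where "w = Z p + (1 / (2 * KG)) *\<^sub>R D"
      have "f (Z p) + q \<bullet> (w - Z p) \<le> f w" using q by (simp add: subgradient_def)
      with upper[of w p] have "D \<bullet> (w - Z p) \<le> KG * (norm (w - Z p))\<^sup>2"
        by (simp add: D_def inner_diff_left)
      then have "(1 / (2 * KG)) * (norm D)\<^sup>2 \<le> KG * ((1 / (2 * KG))\<^sup>2 * (norm D)\<^sup>2)"
        using KG by (simp add: w_def dot_square_norm power_mult_distrib power_divide)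
      also have "\<dots> = (1 / (4 * KG)) * (norm D)\<^sup>2" using KG by (simp add: power2_eq_square)
      finally show False using D KG by (simp add: field_simps)
    qed
    then show ?thesis using q by (simp add: D_def)
  qed
  obtain J where J: "\<And>\<xi>. subgradient f (J \<xi>) (\<xi> - J \<xi>)" "1-lipschitz_on UNIV J"
    "\<And>x p. subgradient f x p \<Longrightarrow> J (x + p) = x"
    using resolvent_exists[OF sub] by blast
  define N where "N = {\<xi>. \<not> J differentiable (at \<xi>)}"
  have N: "negligible N" unfolding N_def by (rule Rademacher[OF J(2)])
  define S where "S = (\<lambda>\<xi>. \<xi> - J \<xi> - G (J \<xi>))"
  have Sp: "S (Z p + (p + G (Z p))) = p" for p
    using J(3)[OF subZ] by (auto simp: S_def)
  have "negligible (S ` N)"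
  proof (rule negligible_locally_Lipschitz_image[OF order_refl N])
    fix \<xi> assume "\<xi> \<in> N"
    have "norm (S \<zeta> - S \<xi>) \<le> (2 + KG) * norm (\<zeta> - \<xi>)" for \<zeta>
    proof -
      have J1: "norm (J \<zeta> - J \<xi>) \<le> norm (\<zeta> - \<xi>)"
        using lipschitz_onD[OF J(2), of \<zeta> \<xi>] by (simp add: dist_norm)
      have "S \<zeta> - S \<xi> = (\<zeta> - \<xi>) - (J \<zeta> - J \<xi>) - G (J \<zeta> - J \<xi>)" by (simp add: S_def G.diff)
      then have "norm (S \<zeta> - S \<xi>) \<le> norm (\<zeta> - \<xi>) + norm (J \<zeta> - J \<xi>) + norm (G (J \<zeta> - J \<xi>))"
        using norm_triangle_ineq4[of "(\<zeta> - \<xi>) - (J \<zeta> - J \<xi>)" "G (J \<zeta> - J \<xi>)"]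
          norm_triangle_ineq4[of "\<zeta> - \<xi>" "J \<zeta> - J \<xi>"] by (simp only:)
      moreover have "norm (G (J \<zeta> - J \<xi>)) \<le> norm (\<zeta> - \<xi>) * KG"
        using KG(2)[of "J \<zeta> - J \<xi>"] mult_right_mono[OF J1, of KG] KG(1) by linarith
      ultimately show ?thesis using J1 by (simp add: algebra_simps)
    qed
    then show "\<exists>T B. open T \<and> \<xi> \<in> T \<and> (\<forall>\<zeta>\<in>N \<inter> T. norm (S \<zeta> - S \<xi>) \<le> B * norm (\<zeta> - \<xi>))"
      by (intro exI[of _ UNIV] exI[of _ "2 + KG"]) auto
  qed
  \<comment> \<open>A ball is not null, so some slope of norm below \<open>\<delta>\<close> is not
    bad.\<close>
  then have "\<not> ball 0 \<delta> \<subseteq> S ` N"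
    using open_not_negligible[of "ball (0::'a) \<delta>"] \<delta> negligible_subset by auto
  then obtain p where p: "norm p < \<delta>" "p \<notin> S ` N" by (meson mem_ball_0 subsetI)
  then have "Z p + (p + G (Z p)) \<notin> N" using Sp[of p] by (metis image_eqI)
  then have "J differentiable (at (Z p + (p + G (Z p))))" by (simp add: N_def)
  then have "\<exists>H. second_order_expansion f (Z p) (p + G (Z p)) H"
    by (intro second_order_expansion_if_resolvent_differentiable[OF sub J(1) J(3) subZ _ KG(1) upper])
  then show ?thesis using p Z unfolding \<Phi>_def by blast
qed

text \<open>The second order superjet relative to \<open>K\<close>. It is applied with space-time as
  \<open>'a\<close>: the first component of \<open>p\<close> is then a time derivative, and
  \<open>X\<close> acts on time as well. Only points of \<open>K\<close> are compared because the
  sup-convolution is taken over \<open>K\<close>.\<close>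

definition superjet :: "'a::euclidean_space set \<Rightarrow> ('a \<Rightarrow> real) \<Rightarrow> 'a \<Rightarrow> 'a \<Rightarrow> ('a \<Rightarrow> 'a) \<Rightarrow> bool" where
  "superjet K u x p X \<longleftrightarrow> bounded_linear X \<and>
     (\<forall>e>0. \<exists>d>0. \<forall>a\<in>K. norm (a - x) < d \<longrightarrow>
        u a \<le> u x + p \<bullet> (a - x) + X (a - x) \<bullet> (a - x) / 2 + e * (norm (a - x))\<^sup>2)"

text \<open>With \<open>m x\<close> the maximizing point, \<open>\<lambda>x. \<phi> x (m x) - |x|\<^sup>2 / (2 \<epsilon>)\<close> is the sup-convolution of
  \<open>u\<close>; adding \<open>|x|\<^sup>2 / (2 \<epsilon>)\<close> makes it a maximum of affine functions.\<close>

lemma sup_convolution: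
  fixes u :: "'a::euclidean_space \<Rightarrow> real"
  assumes K: "compact K" "K \<noteq> {}" and u: "continuous_on K u" and \<epsilon>: "0 < \<epsilon>"
  defines "\<phi> \<equiv> \<lambda>x x'. (x \<bullet> x') / \<epsilon> + u x' - (norm x')\<^sup>2 / (2 * \<epsilon>)"
  obtains m M R where "\<And>x. m x \<in> K" "\<And>x x'. x' \<in> K \<Longrightarrow> \<phi> x x' \<le> \<phi> x (m x)"
    "\<And>x. \<phi> x (m x) \<le> M + R * norm x" "0 \<le> R"
proof -
  have "\<exists>x'\<in>K. \<forall>y\<in>K. \<phi> x y \<le> \<phi> x x'" for x
    unfolding \<phi>_def using \<epsilon> by (intro continuous_attains_sup K continuous_intros u) auto
  then obtain m where m: "\<And>x. m x \<in> K" "\<And>x x'. x' \<in> K \<Longrightarrow> \<phi> x x' \<le> \<phi> x (m x)" by metis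
  obtain M where M: "\<And>x. x \<in> K \<Longrightarrow> u x \<le> M" using continuous_attains_sup[OF K u] by blast
  obtain R where R: "0 < R" "\<And>x. x \<in> K \<Longrightarrow> norm x \<le> R"
    using compact_imp_bounded[OF K(1)] by (meson bounded_pos)
  have "\<phi> x (m x) \<le> M + R / \<epsilon> * norm x" for x
  proof -
    have "x \<bullet> m x \<le> norm x * norm (m x)" by (rule norm_cauchy_schwarz)
    also have "\<dots> \<le> norm x * R" using R m by (intro mult_left_mono) auto
    finally have "(x \<bullet> m x) / \<epsilon> \<le> R / \<epsilon> * norm x" using \<epsilon> by (simp add: field_simps)
    moreover have "0 \<le> (norm (m x))\<^sup>2 / (2 * \<epsilon>)" using \<epsilon> by simp
    ultimately show ?thesis using M[OF m(1)[of x]] by (simp add: \<phi>_def)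
  qed
  then show thesis using m R \<epsilon> that[of m M "R / \<epsilon>"] by auto
qed

text \<open>If \<open>x'\<close> is the maximizing point for \<open>x\<close>, then
  \<open>x' + h\<close> competes for \<open>x + h\<close> at unchanged distance. So an expansion
  from above of the sup-convolution at \<open>x\<close> passes to \<open>u\<close> at
  \<open>x'\<close> with the same \<open>p\<close> and \<open>X\<close>. The terms with
  \<open>\<epsilon>\<close> in \<open>expand\<close> come from the square that was added to make
  \<open>f\<close> convex.\<close>

lemma superjet_of_sup_convolution:
  fixes u f :: "'a::euclidean_space \<Rightarrow> real"
  assumes \<epsilon>: "0 < \<epsilon>" and X: "bounded_linear X"
    and m: "\<And>y x'. x' \<in> K \<Longrightarrow> (y \<bullet> x') / \<epsilon> + u x' - (norm x')\<^sup>2 / (2 * \<epsilon>) \<le> f y"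
    and fx: "f x = (x \<bullet> x') / \<epsilon> + u x' - (norm x')\<^sup>2 / (2 * \<epsilon>)"
    and expand: "\<And>e. 0 < e \<Longrightarrow> \<exists>d>0. \<forall>h. norm h < d \<longrightarrow>
       f (x + h) - f x \<le> p \<bullet> h + (x \<bullet> h) / \<epsilon> + (X h \<bullet> h + (norm h)\<^sup>2 / \<epsilon>) / 2 + e * (norm h)\<^sup>2"
  shows "superjet K u x' p X"
  unfolding superjet_def
proof (intro conjI X allI impI)
  fix e :: real assume "0 < e"
  then obtain d where d: "0 < d" "\<And>h. norm h < d \<Longrightarrow>
       f (x + h) - f x \<le> p \<bullet> h + (x \<bullet> h) / \<epsilon> + (X h \<bullet> h + (norm h)\<^sup>2 / \<epsilon>) / 2 + e * (norm h)\<^sup>2"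
    using expand by meson
  show "\<exists>d>0. \<forall>a\<in>K. norm (a - x') < d \<longrightarrow>
      u a \<le> u x' + p \<bullet> (a - x') + X (a - x') \<bullet> (a - x') / 2 + e * (norm (a - x'))\<^sup>2"
  proof (intro exI[of _ d] conjI ballI impI d(1))
    fix a assume a: "a \<in> K" "norm (a - x') < d"
    define h where "h = a - x'"
    have "((x + h) \<bullet> a) / \<epsilon> + u a - (norm a)\<^sup>2 / (2 * \<epsilon>) \<le> f (x + h)" by (rule m[OF a(1)])
    moreover have "((x + h) \<bullet> a) / \<epsilon> - (norm a)\<^sup>2 / (2 * \<epsilon>)
        = (x \<bullet> x') / \<epsilon> - (norm x')\<^sup>2 / (2 * \<epsilon>) + (x \<bullet> h) / \<epsilon> + (norm h)\<^sup>2 / \<epsilon> / 2"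
    proof -
      have "2 * ((x + h) \<bullet> a) - (norm a)\<^sup>2 = 2 * (x \<bullet> x') - (norm x')\<^sup>2 + 2 * (x \<bullet> h) + (norm h)\<^sup>2"
        unfolding h_def power2_norm_eq_inner
        by (simp add: inner_add_left inner_add_right inner_diff_left inner_diff_right inner_commute)
      from arg_cong[OF this, of "\<lambda>t. t / (2 * \<epsilon>)"] show ?thesis
        using \<epsilon> by (simp add: diff_divide_distrib add_divide_distrib)
    qed
    moreover have "(X h \<bullet> h + (norm h)\<^sup>2 / \<epsilon>) / 2 = X h \<bullet> h / 2 + (norm h)\<^sup>2 / \<epsilon> / 2" by (rule add_divide_distrib)
    ultimately show "u a \<le> u x' + p \<bullet> (a - x') + X (a - x') \<bullet> (a - x') / 2 + e * (norm (a - x'))\<^sup>2"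
      using d(2)[OF a(2)] fx unfolding h_def[symmetric] by linarith
  qed
qed

text \<open>The penalty acts on the outer points \<open>x\<close>, \<open>y\<close> of the
  sup-convolutions, while the jets sit at the maximizing points \<open>x'\<close>,
  \<open>y'\<close>; this is why \<open>X\<close> and \<open>Y\<close> are bounded by
  \<open>B\<close> itself, with no correction in \<open>\<epsilon>\<close>. The comparison over
  \<open>K\<close> is recorded in order to bring \<open>x\<close> and \<open>x'\<close> together as
  \<open>\<epsilon>\<close> tends to 0.\<close>

lemma superjet_sum_approx:
  fixes u v :: "'a::euclidean_space \<Rightarrow> real"
  assumes K: "compact K" "K \<noteq> {}" and u: "continuous_on K u" and v: "continuous_on K v"
    and B: "bounded_linear B" and sym: "\<And>a b. B a \<bullet> b = a \<bullet> B b" and pos: "\<And>a. 0 \<le> B a \<bullet> a"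
    and \<epsilon>: "0 < \<epsilon>"
  shows "\<exists>x y x' y' \<pi> \<rho> X Y. x' \<in> K \<and> y' \<in> K \<and> norm \<pi> < \<epsilon> \<and> norm \<rho> < \<epsilon> \<and>
     (\<forall>a\<in>K. \<forall>b\<in>K. u a + v b - B (a - b) \<bullet> (a - b) / 2 - \<pi> \<bullet> a - \<rho> \<bullet> b \<le>
        u x' + v y' - (norm (x - x'))\<^sup>2 / (2 * \<epsilon>) - (norm (y - y'))\<^sup>2 / (2 * \<epsilon>) - B (x - y) \<bullet> (x - y) / 2 - \<pi> \<bullet> x - \<rho> \<bullet> y) \<and>
     superjet K u x' (B (x - y) + \<pi>) X \<and> superjet K v y' (- B (x - y) + \<rho>) Y \<and>
     (\<forall>h k. X h \<bullet> h + Y k \<bullet> k \<le> B (h - k) \<bullet> (h - k))"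
proof -
  interpret B: bounded_linear B by fact
  define \<phi> where "\<phi> = (\<lambda>x x'. (x \<bullet> x') / \<epsilon> + u x' - (norm x')\<^sup>2 / (2 * \<epsilon>))"
  define \<psi> where "\<psi> = (\<lambda>x x'. (x \<bullet> x') / \<epsilon> + v x' - (norm x')\<^sup>2 / (2 * \<epsilon>))"
  obtain m Mu Ru where m: "\<And>x. m x \<in> K" "\<And>x x'. x' \<in> K \<Longrightarrow> \<phi> x x' \<le> \<phi> x (m x)"
    and mb: "\<And>x. \<phi> x (m x) \<le> Mu + Ru * norm x" "0 \<le> Ru"
    using sup_convolution[OF K u \<epsilon>] unfolding \<phi>_def by metis
  obtain n Mv Rv where n: "\<And>x. n x \<in> K" "\<And>x x'. x' \<in> K \<Longrightarrow> \<psi> x x' \<le> \<psi> x (n x)"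
    and nb: "\<And>x. \<psi> x (n x) \<le> Mv + Rv * norm x" "0 \<le> Rv"
    using sup_convolution[OF K v \<epsilon>] unfolding \<psi>_def by metis
  define F where "F = (\<lambda>z. \<phi> (fst z) (m (fst z)) + \<psi> (snd z) (n (snd z)))"
  \<comment> \<open>The Hessian of the penalty plus that of the squares contained in
    \<open>\<phi>\<close> and \<open>\<psi>\<close>. Thus \<open>F z - G z \<bullet> z / 2\<close>
    is the sum of the sup-convolutions minus the penalty, and the squares make \<open>G\<close>
    coercive with constant \<open>1 / \<epsilon>\<close>.\<close>
  define G where "G = (\<lambda>z::'a \<times> 'a. (fst z /\<^sub>R \<epsilon> + B (fst z - snd z), snd z /\<^sub>R \<epsilon> - B (fst z - snd z)))"
  have Gdot: "G z \<bullet> z = (norm z)\<^sup>2 / \<epsilon> + B (fst z - snd z) \<bullet> (fst z - snd z)" for z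
    by (cases z) (simp add: G_def norm_Pair power2_norm_eq_inner inner_add_left inner_diff_left inner_diff_right divide_inverse algebra_simps)
  have GL: "bounded_linear G"
    unfolding G_def
    by (intro bounded_linear_Pair bounded_linear_add bounded_linear_sub bounded_linear_compose[OF B]
        bounded_linear_compose[OF bounded_linear_scaleR_right] bounded_linear_fst bounded_linear_snd)
  interpret G: bounded_linear G by (rule GL)
  have symG: "G a \<bullet> b = a \<bullet> G b" for a b
    using sym[of "fst a - snd a" "fst b - snd b"]
    by (simp add: G_def inner_prod_def inner_add_left inner_diff_left inner_add_right inner_diff_right)
  have "\<exists>p z H. norm p < \<epsilon> \<and> (\<forall>w. F w - G w \<bullet> w / 2 - p \<bullet> w \<le> F z - G z \<bullet> z / 2 - p \<bullet> z) \<and>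
           second_order_expansion F z (p + G z) H"
  proof (rule Jensen_maximum_with_expansion)
    \<comment> \<open>\<open>F\<close> is a maximum of affine functions; the one attaining the
      maximum at \<open>z\<close> provides the slope.\<close>
    show "\<exists>p. subgradient F z p" for z
    proof (intro exI[of _ "(m (fst z) /\<^sub>R \<epsilon>, n (snd z) /\<^sub>R \<epsilon>)"], unfold subgradient_def, intro allI)
      fix w :: "'a \<times> 'a"
      have lin: "(b \<bullet> c) / \<epsilon> = (a \<bullet> c) / \<epsilon> + (c /\<^sub>R \<epsilon>) \<bullet> (b - a)" for a b c :: 'a
        unfolding inner_commute[of b c] inner_commute[of a c] inner_scaleR_left inner_diff_right right_diff_distrib
        by (simp add: divide_inverse mult.commute)
      have "\<phi> (fst w) (m (fst z)) = \<phi> (fst z) (m (fst z)) + (m (fst z) /\<^sub>R \<epsilon>) \<bullet> (fst w - fst z)"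
        unfolding \<phi>_def lin[where b="fst w" and a="fst z"] by simp
      moreover have "\<psi> (snd w) (n (snd z)) = \<psi> (snd z) (n (snd z)) + (n (snd z) /\<^sub>R \<epsilon>) \<bullet> (snd w - snd z)"
        unfolding \<psi>_def lin[where b="snd w" and a="snd z"] by simp
      ultimately show "F z + (m (fst z) /\<^sub>R \<epsilon>, n (snd z) /\<^sub>R \<epsilon>) \<bullet> (w - z) \<le> F w"
        using m(2)[OF m(1)[of "fst z"], of "fst w"] n(2)[OF n(1)[of "snd z"], of "snd w"]
        by (simp add: F_def inner_prod_def)
    qed
    show "F z \<le> (Mu + Mv) + (Ru + Rv) * norm z" for z
    proof -
      have "Ru * norm (fst z) \<le> Ru * norm z" "Rv * norm (snd z) \<le> Rv * norm z"
        using mb(2) nb(2) norm_fst_le[of "fst z" "snd z"] norm_snd_le[of "snd z" "fst z"]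
        by (intro mult_left_mono; simp)+
      then show ?thesis using mb(1)[of "fst z"] nb(1)[of "snd z"] by (simp add: F_def distrib_right)
    qed
    show "bounded_linear G" by (rule GL)
    show "G a \<bullet> b = a \<bullet> G b" for a b by (rule symG)
    show "(1 / \<epsilon>) * (norm z)\<^sup>2 \<le> G z \<bullet> z" for z
      using pos[of "fst z - snd z"] by (simp add: Gdot)
  qed (use \<epsilon> in auto)
  then obtain p z H where p: "norm p < \<epsilon>"
    and max: "\<And>w. F w - G w \<bullet> w / 2 - p \<bullet> w \<le> F z - G z \<bullet> z / 2 - p \<bullet> z"
    and H: "second_order_expansion F z (p + G z) H" by blast
  define x where "x = fst z" define y where "y = snd z"
  define \<pi> where "\<pi> = fst p" define \<rho> where "\<rho> = snd p"
  have z: "z = (x, y)" and pp: "p = (\<pi>, \<rho>)" by (auto simp: x_def y_def \<pi>_def \<rho>_def)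
  \<comment> \<open>\<open>X\<close> and \<open>Y\<close> are the diagonal blocks of
    \<open>H\<close> with the Hessians of the added squares removed.\<close>
  define X where "X = (\<lambda>h. fst (H (h, 0)) - h /\<^sub>R \<epsilon>)"
  define Y where "Y = (\<lambda>k. snd (H (0, k)) - k /\<^sub>R \<epsilon>)"
  have HL: "bounded_linear H" using H by (simp add: second_order_expansion_def)
  interpret H: bounded_linear H by (rule HL)
  have XL: "bounded_linear X"
    unfolding X_def by (intro bounded_linear_sub bounded_linear_compose[OF bounded_linear_fst] bounded_linear_compose[OF HL]
      bounded_linear_Pair bounded_linear_ident bounded_linear_zero bounded_linear_scaleR_right)
  have YL: "bounded_linear Y"
    unfolding Y_def by (intro bounded_linear_sub bounded_linear_compose[OF bounded_linear_snd] bounded_linear_compose[OF HL]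
      bounded_linear_Pair bounded_linear_ident bounded_linear_zero bounded_linear_scaleR_right)
  have XH: "X h \<bullet> h = H (h, 0) \<bullet> (h, 0) - (norm h)\<^sup>2 / \<epsilon>" for h
    by (simp add: X_def inner_prod_def inner_diff_left power2_norm_eq_inner divide_inverse)
  have YH: "Y h \<bullet> h = H (0, h) \<bullet> (0, h) - (norm h)\<^sup>2 / \<epsilon>" for h
    by (simp add: Y_def inner_prod_def inner_diff_left power2_norm_eq_inner divide_inverse)
  have ex: "\<exists>d>0. \<forall>h. norm h < d \<longrightarrow> \<bar>F (z + h) - F z - (p + G z) \<bullet> h - H h \<bullet> h / 2\<bar> \<le> e * (norm h)\<^sup>2"
    if "0 < e" for e using H that by (simp add: second_order_expansion_def)
  have G1: "(p + G z) \<bullet> (h, 0) = (B (x - y) + \<pi>) \<bullet> h + (x \<bullet> h) / \<epsilon>" for h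
    by (simp add: z pp G_def inner_prod_def inner_add_left divide_inverse)
  have G2: "(p + G z) \<bullet> (0, h) = (- B (x - y) + \<rho>) \<bullet> h + (y \<bullet> h) / \<epsilon>" for h
    by (simp add: z pp G_def inner_prod_def inner_add_left inner_diff_left divide_inverse)
  have Fd1: "F (z + (h, 0)) - F z = \<phi> (x + h) (m (x + h)) - \<phi> x (m x)" for h
    by (simp add: F_def z)
  have Fd2: "F (z + (0, h)) - F z = \<psi> (y + h) (n (y + h)) - \<psi> y (n y)" for h
    by (simp add: F_def z)
  have jetu: "superjet K u (m x) (B (x - y) + \<pi>) X"
  proof (rule superjet_of_sup_convolution[OF \<epsilon> XL, where f="\<lambda>x. \<phi> x (m x)" and x=x])
    fix e :: real assume "0 < e"
    then obtain d where d: "0 < d" "\<And>h. norm h < d \<Longrightarrow> \<bar>F (z + h) - F z - (p + G z) \<bullet> h - H h \<bullet> h / 2\<bar> \<le> e * (norm h)\<^sup>2"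
      using ex by meson
    show "\<exists>d>0. \<forall>h. norm h < d \<longrightarrow> \<phi> (x + h) (m (x + h)) - \<phi> x (m x) \<le>
        (B (x - y) + \<pi>) \<bullet> h + (x \<bullet> h) / \<epsilon> + (X h \<bullet> h + (norm h)\<^sup>2 / \<epsilon>) / 2 + e * (norm h)\<^sup>2"
    proof (intro exI[of _ d] conjI allI impI d(1))
      fix h :: 'a assume "norm h < d"
      then show "\<phi> (x + h) (m (x + h)) - \<phi> x (m x) \<le>
          (B (x - y) + \<pi>) \<bullet> h + (x \<bullet> h) / \<epsilon> + (X h \<bullet> h + (norm h)\<^sup>2 / \<epsilon>) / 2 + e * (norm h)\<^sup>2"
        using d(2)[of "(h, 0)"] unfolding XH Fd1 G1 by (simp add: norm_Pair abs_le_iff)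
    qed
  qed (use m(2) in \<open>auto simp: \<phi>_def\<close>)
  have jetv: "superjet K v (n y) (- B (x - y) + \<rho>) Y"
  proof (rule superjet_of_sup_convolution[OF \<epsilon> YL, where f="\<lambda>x. \<psi> x (n x)" and x=y])
    fix e :: real assume "0 < e"
    then obtain d where d: "0 < d" "\<And>h. norm h < d \<Longrightarrow> \<bar>F (z + h) - F z - (p + G z) \<bullet> h - H h \<bullet> h / 2\<bar> \<le> e * (norm h)\<^sup>2"
      using ex by meson
    show "\<exists>d>0. \<forall>h. norm h < d \<longrightarrow> \<psi> (y + h) (n (y + h)) - \<psi> y (n y) \<le>
        (- B (x - y) + \<rho>) \<bullet> h + (y \<bullet> h) / \<epsilon> + (Y h \<bullet> h + (norm h)\<^sup>2 / \<epsilon>) / 2 + e * (norm h)\<^sup>2"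
    proof (intro exI[of _ d] conjI allI impI d(1))
      fix h :: 'a assume "norm h < d"
      then show "\<psi> (y + h) (n (y + h)) - \<psi> y (n y) \<le>
          (- B (x - y) + \<rho>) \<bullet> h + (y \<bullet> h) / \<epsilon> + (Y h \<bullet> h + (norm h)\<^sup>2 / \<epsilon>) / 2 + e * (norm h)\<^sup>2"
        using d(2)[of "(0, h)"] unfolding YH Fd2 G2 by (simp add: norm_Pair abs_le_iff)
    qed
  qed (use n(2) in \<open>auto simp: \<psi>_def\<close>)
  \<comment> \<open>\<open>F\<close> is a function of \<open>x\<close> plus a function of
    \<open>y\<close>, so its increment in \<open>(h, k)\<close> is the sum of those in
    \<open>(h, 0)\<close> and \<open>(0, k)\<close>, and no mixed block of \<open>H\<close> appears.
    Maximality at \<open>z\<close> bounds the increment through \<open>G\<close>; division by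
    \<open>t\<^sup>2\<close> leaves the quadratic forms.\<close>
  have XY: "X h \<bullet> h + Y k \<bullet> k \<le> B (h - k) \<bullet> (h - k)" for h k
  proof (rule field_le_epsilon)
    fix e' :: real assume e': "0 < e'"
    define S where "S = (norm h)\<^sup>2 + (norm k)\<^sup>2"
    have S: "0 \<le> S" by (simp add: S_def)
    define e where "e = e' / (2 * (S + 1))"
    have e: "0 < e" "2 * e * S \<le> e'" using e' S by (auto simp: e_def field_simps)
    obtain d where d: "0 < d" "\<And>h. norm h < d \<Longrightarrow> \<bar>F (z + h) - F z - (p + G z) \<bullet> h - H h \<bullet> h / 2\<bar> \<le> e * (norm h)\<^sup>2"
      using ex[OF e(1)] by meson
    define t where "t = d / (1 + norm h + norm k)"
    have den: "0 < 1 + norm h + norm k" by (simp add: add_pos_nonneg)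
    have t: "0 < t" using d den by (simp add: t_def)
    have "t * norm h < t * (1 + norm h + norm k)" "t * norm k < t * (1 + norm h + norm k)"
      using t by (auto intro!: mult_strict_left_mono simp: add_pos_nonneg add_nonneg_pos)
    moreover have "t * (1 + norm h + norm k) = d" using den by (simp add: t_def)
    ultimately have td: "norm (t *\<^sub>R h) < d" "norm (t *\<^sub>R k) < d" using t by auto
    have E: "\<bar>F (z + t *\<^sub>R w) - F z - (p + G z) \<bullet> (t *\<^sub>R w) - t\<^sup>2 * (H w \<bullet> w) / 2\<bar> \<le> e * (t\<^sup>2 * (norm w)\<^sup>2)"
      if "norm (t *\<^sub>R w) < d" for w
    proof -
      have a: "H (t *\<^sub>R w) \<bullet> (t *\<^sub>R w) = t\<^sup>2 * (H w \<bullet> w)" by (simp add: H.scaleR power2_eq_square)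
      have b: "(norm (t *\<^sub>R w))\<^sup>2 = t\<^sup>2 * (norm w)\<^sup>2" by (simp add: power_mult_distrib)
      show ?thesis using d(2)[OF that] unfolding a b .
    qed
    have sc: "t *\<^sub>R (h, 0) = (t *\<^sub>R h, 0)" "t *\<^sub>R (0, k) = (0, t *\<^sub>R k)" by simp_all
    have nr: "norm (h, 0::'a) = norm h" "norm (0::'a, k) = norm k" "norm (t *\<^sub>R h, 0::'a) = norm (t *\<^sub>R h)"
      "norm (0::'a, t *\<^sub>R k) = norm (t *\<^sub>R k)" by (simp_all add: norm_Pair)
    note 1 = E[of "(h, 0)", unfolded sc nr, OF td(1)]
    note 2 = E[of "(0, k)", unfolded sc nr, OF td(2)]
    define w where "w = (t *\<^sub>R h, t *\<^sub>R k)"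
    have Fw: "F (z + w) - F z = (F (z + (t *\<^sub>R h, 0)) - F z) + (F (z + (0, t *\<^sub>R k)) - F z)"
      by (simp add: F_def z w_def)
    have lin: "(p + G z) \<bullet> w = (p + G z) \<bullet> (t *\<^sub>R h, 0) + (p + G z) \<bullet> (0, t *\<^sub>R k)"
      by (simp add: w_def inner_prod_def)
    have "G (z + w) \<bullet> (z + w) = G z \<bullet> z + 2 * (G z \<bullet> w) + G w \<bullet> w"
      using symG[of z w] by (simp add: G.add inner_add_left inner_add_right inner_commute)
    then have 3: "F (z + w) - F z \<le> (p + G z) \<bullet> w + G w \<bullet> w / 2"
      using max[of "z + w"] inner_add_right[of p z w] inner_add_left[of p "G z" w] by argo
    have Gw: "G w \<bullet> w = t\<^sup>2 * (S / \<epsilon> + B (h - k) \<bullet> (h - k))"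
    proof -
      have "w = t *\<^sub>R (h, k)" by (simp add: w_def)
      then have "G w \<bullet> w = t\<^sup>2 * (G (h, k) \<bullet> (h, k))" by (simp only: G.scaleR inner_scaleR_left inner_scaleR_right power2_eq_square mult.assoc)
      also have "G (h, k) \<bullet> (h, k) = S / \<epsilon> + B (h - k) \<bullet> (h - k)" by (simp add: Gdot norm_Pair S_def)
      finally show ?thesis .
    qed
    have "t\<^sup>2 * (H (h, 0) \<bullet> (h, 0)) / 2 + t\<^sup>2 * (H (0, k) \<bullet> (0, k)) / 2 \<le> G w \<bullet> w / 2 + e * (t\<^sup>2 * (norm h)\<^sup>2) + e * (t\<^sup>2 * (norm k)\<^sup>2)"
      using 1 2 3 Fw lin by linarith
    also have "\<dots> = t\<^sup>2 * ((S / \<epsilon> + B (h - k) \<bullet> (h - k)) / 2 + e * S)"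
      unfolding Gw S_def by (simp add: algebra_simps)
    finally have "t\<^sup>2 * ((H (h, 0) \<bullet> (h, 0)) / 2 + (H (0, k) \<bullet> (0, k)) / 2) \<le> t\<^sup>2 * ((S / \<epsilon> + B (h - k) \<bullet> (h - k)) / 2 + e * S)"
      by (simp add: distrib_left)
    then have "(H (h, 0) \<bullet> (h, 0)) / 2 + (H (0, k) \<bullet> (0, k)) / 2 \<le> (S / \<epsilon> + B (h - k) \<bullet> (h - k)) / 2 + e * S"
      using t by simp
    then show "X h \<bullet> h + Y k \<bullet> k \<le> B (h - k) \<bullet> (h - k) + e'"
      unfolding XH YH using e(2) S by (simp add: S_def add_divide_distrib)
  qed
  have "u a + v b - B (a - b) \<bullet> (a - b) / 2 - \<pi> \<bullet> a - \<rho> \<bullet> b \<le>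
        u (m x) + v (n y) - (norm (x - m x))\<^sup>2 / (2 * \<epsilon>) - (norm (y - n y))\<^sup>2 / (2 * \<epsilon>) - B (x - y) \<bullet> (x - y) / 2 - \<pi> \<bullet> x - \<rho> \<bullet> y"
    if ab: "a \<in> K" "b \<in> K" for a b
  proof -
    have sq: "(norm (x - x'))\<^sup>2 / (2 * \<epsilon>) = (norm x)\<^sup>2 / (2 * \<epsilon>) - (x \<bullet> x') / \<epsilon> + (norm x')\<^sup>2 / (2 * \<epsilon>)" for x x' :: 'a
      unfolding power2_norm_eq_inner using \<epsilon> by (simp add: inner_diff_left inner_diff_right inner_commute field_simps)
    have ph: "\<phi> x x' = u x' + (norm x)\<^sup>2 / (2 * \<epsilon>) - (norm (x - x'))\<^sup>2 / (2 * \<epsilon>)" for x x' by (simp add: \<phi>_def sq)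
    have ps: "\<psi> x x' = v x' + (norm x)\<^sup>2 / (2 * \<epsilon>) - (norm (x - x'))\<^sup>2 / (2 * \<epsilon>)" for x x' by (simp add: \<psi>_def sq)
    have Gd: "G (s, t) \<bullet> (s, t) / 2 = (norm s)\<^sup>2 / (2 * \<epsilon>) + (norm t)\<^sup>2 / (2 * \<epsilon>) + B (s - t) \<bullet> (s - t) / 2" for s t
      unfolding Gdot by (simp add: norm_Pair add_divide_distrib)
    have "F (a, b) - G (a, b) \<bullet> (a, b) / 2 - p \<bullet> (a, b) \<le> F (x, y) - G (x, y) \<bullet> (x, y) / 2 - p \<bullet> (x, y)"
      using max[of "(a, b)"] by (simp add: z)
    \<comment> \<open>For \<open>a\<close> in \<open>K\<close> the choice \<open>x' = a\<close>
      shows that the sup-convolution at \<open>a\<close> is at least \<open>u a\<close>.\<close>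
    moreover have "\<phi> a a + \<psi> b b \<le> F (a, b)" using m(2)[OF ab(1), of a] n(2)[OF ab(2), of b] by (simp add: F_def)
    ultimately show ?thesis
      unfolding Gd by (simp add: pp inner_prod_def F_def) (simp add: ph ps)
  qed
  moreover have "norm \<pi> < \<epsilon>" "norm \<rho> < \<epsilon>"
    using p norm_fst_le[of "fst p" "snd p"] norm_snd_le[of "snd p" "fst p"] by (auto simp: \<pi>_def \<rho>_def)
  ultimately show ?thesis using m(1) n(1) jetu jetv XY by blast
qed

text \<open>The limit of the preceding approximation as \<open>\<epsilon>\<close> tends to 0. Base
  points and gradients converge along a subsequence; no limit of \<open>X n\<close> and
  \<open>Y n\<close> is taken, the bound on them being kept for every \<open>n\<close>.\<close>

theorem theorem_on_sums:
  fixes u v :: "'a::euclidean_space \<Rightarrow> real"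
  assumes K: "compact K" "K \<noteq> {}" and u: "continuous_on K u" and v: "continuous_on K v"
    and B: "bounded_linear B" and sym: "\<And>a b. B a \<bullet> b = a \<bullet> B b" and pos: "\<And>a. 0 \<le> B a \<bullet> a"
  obtains xh yh x y p q X Y where "xh \<in> K" "yh \<in> K"
    "\<And>a b. a \<in> K \<Longrightarrow> b \<in> K \<Longrightarrow> u a + v b - B (a - b) \<bullet> (a - b) / 2 \<le> u xh + v yh - B (xh - yh) \<bullet> (xh - yh) / 2"
    "\<And>n::nat. x n \<in> K" "\<And>n. y n \<in> K" "x \<longlonglongrightarrow> xh" "y \<longlonglongrightarrow> yh"
    "p \<longlonglongrightarrow> B (xh - yh)" "q \<longlonglongrightarrow> - B (xh - yh)"
    "\<And>n. superjet K u (x n) (p n) (X n)" "\<And>n. superjet K v (y n) (q n) (Y n)"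
    "\<And>n h k. X n h \<bullet> h + Y n k \<bullet> k \<le> B (h - k) \<bullet> (h - k)"
proof -
  interpret B: bounded_linear B by fact
  define \<epsilon> where "\<epsilon> = (\<lambda>n. inverse (real (Suc n)))"
  have \<epsilon>: "0 < \<epsilon> n" "\<epsilon> n \<le> 1" for n by (auto simp: \<epsilon>_def inverse_le_1_iff)
  have \<epsilon>0: "\<epsilon> \<longlonglongrightarrow> 0" unfolding \<epsilon>_def by (rule LIMSEQ_inverse_real_of_nat)
  have "\<forall>n. \<exists>x y x' y' \<pi> \<rho> X Y. x' \<in> K \<and> y' \<in> K \<and> norm \<pi> < \<epsilon> n \<and> norm \<rho> < \<epsilon> n \<and>
     (\<forall>a\<in>K. \<forall>b\<in>K. u a + v b - B (a - b) \<bullet> (a - b) / 2 - \<pi> \<bullet> a - \<rho> \<bullet> b \<le>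
        u x' + v y' - (norm (x - x'))\<^sup>2 / (2 * \<epsilon> n) - (norm (y - y'))\<^sup>2 / (2 * \<epsilon> n) - B (x - y) \<bullet> (x - y) / 2 - \<pi> \<bullet> x - \<rho> \<bullet> y) \<and>
     superjet K u x' (B (x - y) + \<pi>) X \<and> superjet K v y' (- B (x - y) + \<rho>) Y \<and>
     (\<forall>h k. X h \<bullet> h + Y k \<bullet> k \<le> B (h - k) \<bullet> (h - k))"
    by (intro allI superjet_sum_approx[OF K u v B sym pos \<epsilon>(1)])
  then obtain x y x' y' \<pi> \<rho> X Y where xK: "\<And>n. x' n \<in> K" "\<And>n. y' n \<in> K"
    and \<pi>: "\<And>n. norm (\<pi> n) < \<epsilon> n" and \<rho>: "\<And>n. norm (\<rho> n) < \<epsilon> n"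
    and max: "\<And>n a b. a \<in> K \<Longrightarrow> b \<in> K \<Longrightarrow> u a + v b - B (a - b) \<bullet> (a - b) / 2 - \<pi> n \<bullet> a - \<rho> n \<bullet> b \<le>
        u (x' n) + v (y' n) - (norm (x n - x' n))\<^sup>2 / (2 * \<epsilon> n) - (norm (y n - y' n))\<^sup>2 / (2 * \<epsilon> n)
          - B (x n - y n) \<bullet> (x n - y n) / 2 - \<pi> n \<bullet> x n - \<rho> n \<bullet> y n"
    and jets: "\<And>n. superjet K u (x' n) (B (x n - y n) + \<pi> n) (X n)" "\<And>n. superjet K v (y' n) (- B (x n - y n) + \<rho> n) (Y n)"
    and XY: "\<And>n h k. X n h \<bullet> h + Y n k \<bullet> k \<le> B (h - k) \<bullet> (h - k)"
    by metis
  obtain Mu where Mu: "\<And>a. a \<in> K \<Longrightarrow> u a \<le> Mu" using continuous_attains_sup[OF K u] by blast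
  obtain Mv where Mv: "\<And>a. a \<in> K \<Longrightarrow> v a \<le> Mv" using continuous_attains_sup[OF K v] by blast
  obtain R where R: "0 < R" "\<And>a. a \<in> K \<Longrightarrow> norm a \<le> R"
    using compact_imp_bounded[OF K(1)] by (meson bounded_pos)
  obtain k0 where k0: "k0 \<in> K" using K by blast
  \<comment> \<open>Comparison with the fixed pair \<open>(k0, k0)\<close> bounds the regularization
    terms; \<open>4 * R\<close> pays for the tilts at \<open>k0\<close> and at the maximizing
    points.\<close>
  define C where "C = Mu + Mv - u k0 - v k0 + 4 * R"
  have close: "(norm (x n - x' n))\<^sup>2 + (norm (y n - y' n))\<^sup>2 \<le> 4 * \<epsilon> n * (C + 2)" for n
  proof -
    define e where "e = \<epsilon> n" define s where "s = norm (x n - x' n)" define t where "t = norm (y n - y' n)"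
    have e: "0 < e" "e \<le> 1" using \<epsilon> by (auto simp: e_def)
    have pi1: "\<pi> n \<bullet> k0 \<le> R" "\<rho> n \<bullet> k0 \<le> R"
    proof -
      have "norm (\<pi> n) * norm k0 \<le> 1 * R" "norm (\<rho> n) * norm k0 \<le> 1 * R"
        using \<pi>[of n] \<rho>[of n] e R k0 by (intro mult_mono; simp add: e_def)+
      then show "\<pi> n \<bullet> k0 \<le> R" "\<rho> n \<bullet> k0 \<le> R"
        using norm_cauchy_schwarz[of "\<pi> n" k0] norm_cauchy_schwarz[of "\<rho> n" k0] by linarith+
    qed
    have lower: "- (e * s + R) \<le> \<omega> \<bullet> w" if "norm \<omega> < e" "norm (w - w') = s" "w' \<in> K" for \<omega> w w' s
    proof -
      have "norm w \<le> s + R" using norm_triangle_sub[of w w'] R(2)[OF that(3)] that(2) by linarith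
      then have "norm \<omega> * norm w \<le> e * (s + R)" using that(1) e by (intro mult_mono) auto
      also have "\<dots> \<le> e * s + R" using e R by (simp add: distrib_left mult_left_le_one_le)
      finally show ?thesis using Cauchy_Schwarz_ineq2[of \<omega> w] by linarith
    qed
    have p1: "- (e * s + R) \<le> \<pi> n \<bullet> x n"
      by (rule lower[of _ _ "x' n"]) (use \<pi> xK in \<open>auto simp: e_def s_def\<close>)
    have p2: "- (e * t + R) \<le> \<rho> n \<bullet> y n"
      by (rule lower[of _ _ "y' n"]) (use \<rho> xK in \<open>auto simp: e_def t_def\<close>)
    have "s\<^sup>2 / (2 * e) + t\<^sup>2 / (2 * e) \<le> C + e * s + e * t"
      using max[OF k0 k0, of n] pi1 p1 p2 Mu[OF xK(1)[of n]] Mv[OF xK(2)[of n]] pos[of "x n - y n"]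
      by (simp add: C_def B.zero s_def t_def e_def)
    \<comment> \<open>Young's inequality: the extra tilt caused by the distances \<open>s\<close>
      and \<open>t\<close> is absorbed into half of the regularization terms.\<close>
    moreover have "e * r \<le> r\<^sup>2 / (4 * e) + 1" for r
    proof -
      have "0 \<le> (r - 2 * e\<^sup>2)\<^sup>2 / (4 * e)" using e by simp
      also have "\<dots> = r\<^sup>2 / (4 * e) - e * r + e ^ 3" using e
        by (simp add: power2_eq_square power3_eq_cube field_simps)
      finally show ?thesis using power_le_one[of e 3] e by linarith
    qed
    from this[of s] this[of t] have "e * s + e * t \<le> s\<^sup>2 / (4 * e) + t\<^sup>2 / (4 * e) + 2" by linarith
    moreover have "s\<^sup>2 / (2 * e) = 2 * (s\<^sup>2 / (4 * e))" "t\<^sup>2 / (2 * e) = 2 * (t\<^sup>2 / (4 * e))" by auto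
    ultimately have "s\<^sup>2 / (4 * e) + t\<^sup>2 / (4 * e) \<le> C + 2" by linarith
    then have "(s\<^sup>2 + t\<^sup>2) / (4 * e) \<le> C + 2" by (simp add: add_divide_distrib)
    then show ?thesis using e by (simp add: s_def t_def e_def pos_divide_le_eq mult.commute)
  qed
  have lim0: "(\<lambda>n. 4 * \<epsilon> n * (C + 2)) \<longlonglongrightarrow> 0"
    using tendsto_mult[OF tendsto_mult[OF tendsto_const \<epsilon>0] tendsto_const, of 4 "C + 2"] by simp
  have sqlim: "w \<longlonglongrightarrow> 0" if "\<And>n. (norm (w n))\<^sup>2 \<le> 4 * \<epsilon> n * (C + 2)" for w :: "nat \<Rightarrow> 'a"
  proof -
    have "(\<lambda>n. (norm (w n))\<^sup>2) \<longlonglongrightarrow> 0"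
      by (rule tendsto_sandwich[OF _ _ tendsto_const lim0]) (use that in auto)
    then have "(\<lambda>n. sqrt ((norm (w n))\<^sup>2)) \<longlonglongrightarrow> sqrt 0" by (rule tendsto_real_sqrt)
    then show ?thesis by (simp add: tendsto_norm_zero_iff)
  qed
  have dx: "(\<lambda>n. x n - x' n) \<longlonglongrightarrow> 0" by (rule sqlim) (use close in \<open>smt (verit) zero_le_power2\<close>)
  have dy: "(\<lambda>n. y n - y' n) \<longlonglongrightarrow> 0" by (rule sqlim) (use close in \<open>smt (verit) zero_le_power2\<close>)
  have \<pi>0: "\<pi> \<longlonglongrightarrow> 0" "\<rho> \<longlonglongrightarrow> 0"
    by (rule Lim_null_comparison[OF _ \<epsilon>0]; use \<pi> \<rho> in \<open>auto intro!: always_eventually less_imp_le\<close>)+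
  obtain z r where z: "z \<in> K \<times> K" "strict_mono r" "((\<lambda>n. (x' n, y' n)) \<circ> r) \<longlonglongrightarrow> z"
    using compact_Times[OF K(1) K(1)] xK unfolding compact_def by (metis (no_types, lifting) SigmaI)
  obtain xh yh where zz: "z = (xh, yh)" by (cases z)
  have xl: "(\<lambda>n. x' (r n)) \<longlonglongrightarrow> xh" "(\<lambda>n. y' (r n)) \<longlonglongrightarrow> yh"
    using tendsto_fst[OF z(3)] tendsto_snd[OF z(3)] by (auto simp: zz o_def)
  have sub: "(\<lambda>n. w (r n)) \<longlonglongrightarrow> l" if "w \<longlonglongrightarrow> l" for w :: "nat \<Rightarrow> 'a" and l
    using LIMSEQ_subseq_LIMSEQ[OF that z(2)] by (simp add: o_def)
  have xl': "(\<lambda>n. x (r n)) \<longlonglongrightarrow> xh" "(\<lambda>n. y (r n)) \<longlonglongrightarrow> yh"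
    using tendsto_add[OF sub[OF dx] xl(1)] tendsto_add[OF sub[OF dy] xl(2)] by simp_all
  have Bl: "(\<lambda>n. B (x (r n) - y (r n))) \<longlonglongrightarrow> B (xh - yh)"
    by (intro B.tendsto tendsto_diff xl')
  have ul: "(\<lambda>n. u (x' (r n))) \<longlonglongrightarrow> u xh" "(\<lambda>n. v (y' (r n))) \<longlonglongrightarrow> v yh"
    using continuous_on_tendsto_compose[OF u xl(1)] continuous_on_tendsto_compose[OF v xl(2)] z(1) xK by (auto simp: zz)
  show thesis
  proof (rule that[of xh yh "\<lambda>n. x' (r n)" "\<lambda>n. y' (r n)" "\<lambda>n. B (x (r n) - y (r n)) + \<pi> (r n)"
        "\<lambda>n. - B (x (r n) - y (r n)) + \<rho> (r n)" "\<lambda>n. X (r n)" "\<lambda>n. Y (r n)"])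
    show "xh \<in> K" "yh \<in> K" using z zz by auto
    fix a b assume ab: "a \<in> K" "b \<in> K"
    show "u a + v b - B (a - b) \<bullet> (a - b) / 2 \<le> u xh + v yh - B (xh - yh) \<bullet> (xh - yh) / 2"
    proof (rule tendsto_le[OF trivial_limit_sequentially])
      let ?l = "\<lambda>n. u a + v b - B (a - b) \<bullet> (a - b) / 2 - \<pi> (r n) \<bullet> a - \<rho> (r n) \<bullet> b"
      let ?r = "\<lambda>n. u (x' (r n)) + v (y' (r n)) - B (x (r n) - y (r n)) \<bullet> (x (r n) - y (r n)) / 2 - \<pi> (r n) \<bullet> x (r n) - \<rho> (r n) \<bullet> y (r n)"
      have "?l \<longlonglongrightarrow> u a + v b - B (a - b) \<bullet> (a - b) / 2 - 0 \<bullet> a - 0 \<bullet> b"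
        by (intro tendsto_intros sub \<pi>0)
      then show "?l \<longlonglongrightarrow> u a + v b - B (a - b) \<bullet> (a - b) / 2" by simp
      have "?r \<longlonglongrightarrow> u xh + v yh - B (xh - yh) \<bullet> (xh - yh) / 2 - 0 \<bullet> xh - 0 \<bullet> yh"
        by (intro tendsto_intros sub \<pi>0 ul Bl xl') simp
      then show "?r \<longlonglongrightarrow> u xh + v yh - B (xh - yh) \<bullet> (xh - yh) / 2" by simp
      show "\<forall>\<^sub>F n in sequentially. ?l n \<le> ?r n"
      proof (intro always_eventually allI)
        fix n
        have "0 \<le> (norm (x (r n) - x' (r n)))\<^sup>2 / (2 * \<epsilon> (r n))" "0 \<le> (norm (y (r n) - y' (r n)))\<^sup>2 / (2 * \<epsilon> (r n))"
          using \<epsilon>(1)[of "r n"] by auto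
        then show "?l n \<le> ?r n" using max[OF ab, of "r n"] by linarith
      qed
    qed
  next
    show "(\<lambda>n. B (x (r n) - y (r n)) + \<pi> (r n)) \<longlonglongrightarrow> B (xh - yh)"
      using tendsto_add[OF Bl sub[OF \<pi>0(1)]] by simp
    show "(\<lambda>n. - B (x (r n) - y (r n)) + \<rho> (r n)) \<longlonglongrightarrow> - B (xh - yh)"
      using tendsto_add[OF tendsto_minus[OF Bl] sub[OF \<pi>0(2)]] by simp
  qed (use xK xl jets XY in auto)
qed

text \<open>Comparison with \<open>z0\<close> bounds \<open>n * P (z n)\<close>, so cluster points
  of the maximizers lie in the zero set of \<open>P\<close>. Comparison with the limit
  \<open>zh\<close> itself then sends the penalty terms to 0. This serves first for the penalty in
  time, then for the one in space.\<close>

lemma penalized_maximizers_converge: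
  fixes F P :: "'a::metric_space \<Rightarrow> real"
  assumes S: "compact S" and F: "continuous_on S F" and P: "continuous_on S P" and P0: "\<And>w. w \<in> S \<Longrightarrow> 0 \<le> P w"
    and z0: "z0 \<in> S" "P z0 = 0"
    and z: "\<And>n::nat. z n \<in> S" and max: "\<And>n w. w \<in> S \<Longrightarrow> F w - real n * P w \<le> F (z n) - real n * P (z n)"
  obtains r zh where "strict_mono r" "zh \<in> S" "(\<lambda>n. z (r n)) \<longlonglongrightarrow> zh" "P zh = 0"
    "(\<lambda>n. real (r n) * P (z (r n))) \<longlonglongrightarrow> 0" "\<And>w. w \<in> S \<Longrightarrow> P w = 0 \<Longrightarrow> F w \<le> F zh"
proof -
  obtain zh r where r: "zh \<in> S" "strict_mono r" "(z \<circ> r) \<longlonglongrightarrow> zh"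
    using S z unfolding compact_def by metis
  have lim: "(\<lambda>n. z (r n)) \<longlonglongrightarrow> zh" using r(3) by (simp add: o_def)
  have Fl: "(\<lambda>n. F (z (r n))) \<longlonglongrightarrow> F zh"
    by (rule continuous_on_tendsto_compose[OF F lim r(1)]) (use z in auto)
  have Pl: "(\<lambda>n. P (z (r n))) \<longlonglongrightarrow> P zh"
    by (rule continuous_on_tendsto_compose[OF P lim r(1)]) (use z in auto)
  have "S \<noteq> {}" using z by blast
  then obtain M where M: "\<And>w. w \<in> S \<Longrightarrow> F w \<le> M" using continuous_attains_sup[OF S _ F] by blast
  have rn: "n \<le> r n" for n using r(2) by (rule seq_suble)
  have "P zh \<le> 0"
  \<comment> \<open>The shift by one keeps the index positive for the division.\<close>
  proof (rule tendsto_le[OF trivial_limit_sequentially _ LIMSEQ_Suc[OF Pl]])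
    show "(\<lambda>n. (M - F z0) * inverse (real (Suc n))) \<longlonglongrightarrow> 0"
      using tendsto_mult[OF tendsto_const LIMSEQ_inverse_real_of_nat, of "M - F z0"] by simp
    show "\<forall>\<^sub>F n in sequentially. P (z (r (Suc n))) \<le> (M - F z0) * inverse (real (Suc n))"
    proof (intro always_eventually allI)
      fix n
      have "real (r (Suc n)) * P (z (r (Suc n))) \<le> M - F z0"
        using max[OF z0(1), of "r (Suc n)"] M[OF z[of "r (Suc n)"]] z0(2) by simp
      moreover have "real (Suc n) * P (z (r (Suc n))) \<le> real (r (Suc n)) * P (z (r (Suc n)))"
        using rn[of "Suc n"] P0[OF z] by (intro mult_right_mono) auto
      ultimately have "real (Suc n) * P (z (r (Suc n))) \<le> M - F z0" by linarith
      then have "P (z (r (Suc n))) \<le> (M - F z0) / real (Suc n)"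
        by (subst pos_le_divide_eq) (simp_all only: of_nat_0_less_iff zero_less_Suc mult.commute)
      then show "P (z (r (Suc n))) \<le> (M - F z0) * inverse (real (Suc n))" by (simp only: divide_inverse)
    qed
  qed
  then have Pzh: "P zh = 0" using P0[OF r(1)] by simp
  have nP: "(\<lambda>n. real (r n) * P (z (r n))) \<longlonglongrightarrow> 0"
  proof (rule tendsto_sandwich[OF _ _ tendsto_const])
    show "(\<lambda>n. F (z (r n)) - F zh) \<longlonglongrightarrow> 0" using tendsto_diff[OF Fl tendsto_const, of "F zh"] by simp
    show "\<forall>\<^sub>F n in sequentially. real (r n) * P (z (r n)) \<le> F (z (r n)) - F zh"
      using max[OF r(1)] Pzh by (intro always_eventually allI) (simp add: algebra_simps)
    show "\<forall>\<^sub>F n in sequentially. 0 \<le> real (r n) * P (z (r n))"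
      using P0[OF z] by (intro always_eventually allI) auto
  qed
  have "F w \<le> F zh" if w: "w \<in> S" "P w = 0" for w
  proof (rule LIMSEQ_le_const[OF Fl], intro exI[of _ 0] allI impI)
    fix n
    have "0 \<le> real (r n) * P (z (r n))" using P0[OF z] by simp
    then show "F w \<le> F (z (r n))" using max[OF w(1), of "r n"] w(2) by simp
  qed
  then show thesis using that[OF r(2,1) lim Pzh nP] by blast
qed

subsection \<open>Doubling of variables\<close>

text \<open>The jet hypotheses express linear degenerate inequalities with drift \<open>b\<close>,
  diffusion columns \<open>s k\<close> and sources \<open>g1\<close>, \<open>g2\<close>. Testing the
  bound on the matrices with \<open>s k (x n)\<close> and \<open>s k (y n)\<close> eliminates
  \<open>X n\<close> and \<open>Y n\<close> before the passage to the limit, so they need not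
  converge.\<close>

lemma doubled_maximum:
  fixes U V g1 g2 :: "'a::euclidean_space \<Rightarrow> real" and s :: "'k::finite \<Rightarrow> 'a \<Rightarrow> 'a"
  assumes K: "compact K" "K \<noteq> {}" and U: "continuous_on K U" and V: "continuous_on K V"
    and B: "bounded_linear B" and sym: "\<And>a b. B a \<bullet> b = a \<bullet> B b" and pos: "\<And>a. 0 \<le> B a \<bullet> a"
    and b: "continuous_on K b" and s: "\<And>k. continuous_on K (s k)"
    and g1: "continuous_on K g1" and g2: "continuous_on K g2"
    and jetU: "\<And>z p X. z \<in> interior K \<Longrightarrow> superjet K U z p X \<Longrightarrow> 0 \<le> b z \<bullet> p + (\<Sum>k\<in>UNIV. X (s k z) \<bullet> s k z) / 2 + g1 z"
    and jetV: "\<And>z p X. z \<in> interior K \<Longrightarrow> superjet K V z p X \<Longrightarrow> 0 \<le> b z \<bullet> p + (\<Sum>k\<in>UNIV. X (s k z) \<bullet> s k z) / 2 + g2 z"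
  shows "\<exists>x y. x \<in> K \<and> y \<in> K \<and>
    (\<forall>a\<in>K. \<forall>c\<in>K. U a + V c - B (a - c) \<bullet> (a - c) / 2 \<le> U x + V y - B (x - y) \<bullet> (x - y) / 2) \<and>
    (x \<in> interior K \<longrightarrow> y \<in> interior K \<longrightarrow>
      0 \<le> (b x - b y) \<bullet> B (x - y) + (\<Sum>k\<in>UNIV. B (s k x - s k y) \<bullet> (s k x - s k y)) / 2 + g1 x + g2 y)"
proof -
  interpret B: bounded_linear B by fact
  obtain xh yh x y p q X Y where h: "xh \<in> K" "yh \<in> K"
    "\<And>a b. a \<in> K \<Longrightarrow> b \<in> K \<Longrightarrow> U a + V b - B (a - b) \<bullet> (a - b) / 2 \<le> U xh + V yh - B (xh - yh) \<bullet> (xh - yh) / 2"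
    and xy: "\<And>n::nat. x n \<in> K" "\<And>n. y n \<in> K" and lim: "x \<longlonglongrightarrow> xh" "y \<longlonglongrightarrow> yh"
    "p \<longlonglongrightarrow> B (xh - yh)" "q \<longlonglongrightarrow> - B (xh - yh)"
    and jets: "\<And>n. superjet K U (x n) (p n) (X n)" "\<And>n. superjet K V (y n) (q n) (Y n)"
    and XY: "\<And>n h k. X n h \<bullet> h + Y n k \<bullet> k \<le> B (h - k) \<bullet> (h - k)"
    by (rule theorem_on_sums[OF K U V B sym pos]) blast
  have cx: "(\<lambda>n. f (x n)) \<longlonglongrightarrow> f xh" if "continuous_on K f" for f :: "'a \<Rightarrow> 'c::topological_space"
    by (rule continuous_on_tendsto_compose[OF that lim(1) h(1)]) (use xy in auto)
  have cy: "(\<lambda>n. f (y n)) \<longlonglongrightarrow> f yh" if "continuous_on K f" for f :: "'a \<Rightarrow> 'c::topological_space"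
    by (rule continuous_on_tendsto_compose[OF that lim(2) h(2)]) (use xy in auto)
  have "0 \<le> (b xh - b yh) \<bullet> B (xh - yh) + (\<Sum>k\<in>UNIV. B (s k xh - s k yh) \<bullet> (s k xh - s k yh)) / 2 + g1 xh + g2 yh"
    if int: "xh \<in> interior K" "yh \<in> interior K"
  proof (rule tendsto_le[OF trivial_limit_sequentially _ tendsto_const])
    show "\<forall>\<^sub>F n in sequentially. 0 \<le> b (x n) \<bullet> p n + b (y n) \<bullet> q n +
       (\<Sum>k\<in>UNIV. B (s k (x n) - s k (y n)) \<bullet> (s k (x n) - s k (y n))) / 2 + g1 (x n) + g2 (y n)"
      using topological_tendstoD[OF lim(1) open_interior int(1)] topological_tendstoD[OF lim(2) open_interior int(2)]
    proof eventually_elim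
      case (elim n)
      have "(\<Sum>k\<in>UNIV. X n (s k (x n)) \<bullet> s k (x n)) + (\<Sum>k\<in>UNIV. Y n (s k (y n)) \<bullet> s k (y n))
          \<le> (\<Sum>k\<in>UNIV. B (s k (x n) - s k (y n)) \<bullet> (s k (x n) - s k (y n)))"
        unfolding sum.distrib[symmetric] by (intro sum_mono XY)
      then show ?case
        using jetU[OF elim(1) jets(1)[of n]] jetV[OF elim(2) jets(2)[of n]] by argo
    qed
    have "(\<lambda>n. b (x n) \<bullet> p n + b (y n) \<bullet> q n +
       (\<Sum>k\<in>UNIV. B (s k (x n) - s k (y n)) \<bullet> (s k (x n) - s k (y n))) / 2 + g1 (x n) + g2 (y n))
      \<longlonglongrightarrow> b xh \<bullet> B (xh - yh) + b yh \<bullet> (- B (xh - yh)) + (\<Sum>k\<in>UNIV. B (s k xh - s k yh) \<bullet> (s k xh - s k yh)) / 2 + g1 xh + g2 yh"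
      by (intro tendsto_intros B.tendsto cx cy lim b s g1 g2) simp
    then show "(\<lambda>n. b (x n) \<bullet> p n + b (y n) \<bullet> q n +
       (\<Sum>k\<in>UNIV. B (s k (x n) - s k (y n)) \<bullet> (s k (x n) - s k (y n))) / 2 + g1 (x n) + g2 (y n))
      \<longlonglongrightarrow> (b xh - b yh) \<bullet> B (xh - yh) + (\<Sum>k\<in>UNIV. B (s k xh - s k yh) \<bullet> (s k xh - s k yh)) / 2 + g1 xh + g2 yh"
      by (simp add: inner_diff_left)
  qed
  then show ?thesis using h by blast
qed

text \<open>The penalization \<open>n |t - s|\<^sup>2 / 2\<close> in time is removed first, with the spatial one fixed, since the
  coefficients are merely continuous in time.\<close>

lemma doubled_maximum_equal_times:
  fixes U V g1 g2 :: "real \<times> 'b::euclidean_space \<Rightarrow> real" and \<sigma> :: "'k::finite \<Rightarrow> real \<times> 'b \<Rightarrow> 'b"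
  assumes K: "compact K" "K \<noteq> {}" and U: "continuous_on K U" and V: "continuous_on K V"
    and m: "continuous_on K m" and \<sigma>: "\<And>k. continuous_on K (\<sigma> k)"
    and g1: "continuous_on K g1" and g2: "continuous_on K g2" and \<alpha>: "0 \<le> \<alpha>"
    and jetU: "\<And>z p X. z \<in> interior K \<Longrightarrow> superjet K U z p X \<Longrightarrow>
       0 \<le> (1, m z) \<bullet> p + (\<Sum>k\<in>UNIV. X (0, \<sigma> k z) \<bullet> (0, \<sigma> k z)) / 2 + g1 z"
    and jetV: "\<And>z p X. z \<in> interior K \<Longrightarrow> superjet K V z p X \<Longrightarrow>
       0 \<le> (1, m z) \<bullet> p + (\<Sum>k\<in>UNIV. X (0, \<sigma> k z) \<bullet> (0, \<sigma> k z)) / 2 + g2 z"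
  shows "\<exists>x y. x \<in> K \<and> y \<in> K \<and> fst x = fst y \<and>
    (\<forall>a\<in>K. \<forall>c\<in>K. fst a = fst c \<longrightarrow> U a + V c - \<alpha> * (norm (snd a - snd c))\<^sup>2 / 2 \<le> U x + V y - \<alpha> * (norm (snd x - snd y))\<^sup>2 / 2) \<and>
    (x \<in> interior K \<longrightarrow> y \<in> interior K \<longrightarrow>
      0 \<le> \<alpha> * ((m x - m y) \<bullet> (snd x - snd y)) + \<alpha> * (\<Sum>k\<in>UNIV. (norm (\<sigma> k x - \<sigma> k y))\<^sup>2) / 2 + g1 x + g2 y)"
proof -
  \<comment> \<open>Weight \<open>n\<close> on the difference of times, weight
    \<open>\<alpha>\<close> on the difference of space variables.\<close>
  define B where "B = (\<lambda>(n::nat) z::real \<times> 'b. (real n * fst z, \<alpha> *\<^sub>R snd z))"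
  have Bq: "B n z \<bullet> z = real n * (fst z)\<^sup>2 + \<alpha> * (norm (snd z))\<^sup>2" for n z
    by (simp add: B_def inner_prod_def dot_square_norm) (simp add: power2_eq_square)
  define Q where "Q = (\<lambda>n x y. x \<in> K \<and> y \<in> K \<and>
    (\<forall>a\<in>K. \<forall>c\<in>K. U a + V c - B n (a - c) \<bullet> (a - c) / 2 \<le> U x + V y - B n (x - y) \<bullet> (x - y) / 2) \<and>
    (x \<in> interior K \<longrightarrow> y \<in> interior K \<longrightarrow>
      0 \<le> ((1, m x) - (1, m y)) \<bullet> B n (x - y) + (\<Sum>k\<in>UNIV. B n ((0, \<sigma> k x) - (0, \<sigma> k y)) \<bullet> ((0, \<sigma> k x) - (0, \<sigma> k y))) / 2 + g1 x + g2 y))"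
  have "\<exists>x y. Q n x y" for n
    unfolding Q_def
  proof (rule doubled_maximum[OF K U V, where B="B n" and b="\<lambda>x. (1, m x)" and s="\<lambda>k x. (0, \<sigma> k x)"])
    show "bounded_linear (B n)" unfolding B_def
      by (intro bounded_linear_Pair bounded_linear_const_mult bounded_linear_compose[OF bounded_linear_scaleR_right] bounded_linear_fst bounded_linear_snd)
    show "B n a \<bullet> b = a \<bullet> B n b" for a b by (simp add: B_def inner_prod_def)
    show "0 \<le> B n a \<bullet> a" for a using \<alpha> by (simp add: Bq)
    show "continuous_on K (\<lambda>x. (1, m x))" "\<And>k. continuous_on K (\<lambda>x. (0, \<sigma> k x))" by (intro continuous_intros m \<sigma>)+
  qed (use g1 g2 jetU jetV in auto)
  then obtain x y where Q: "\<And>n. Q n (x n) (y n)" by metis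
  note xy = Q[unfolded Q_def, THEN conjunct1] Q[unfolded Q_def, THEN conjunct2, THEN conjunct1]
    and max = Q[unfolded Q_def, THEN conjunct2, THEN conjunct2, THEN conjunct1, rule_format]
    and ineq = Q[unfolded Q_def, THEN conjunct2, THEN conjunct2, THEN conjunct2, rule_format]
  define F where "F = (\<lambda>z. U (fst z) + V (snd z) - \<alpha> * (norm (snd (fst z) - snd (snd z)))\<^sup>2 / 2)"
  define P where "P = (\<lambda>z::(real \<times> 'b) \<times> (real \<times> 'b). (fst (fst z) - fst (snd z))\<^sup>2 / 2)"
  have FP: "F z - real n * P z = U (fst z) + V (snd z) - B n (fst z - snd z) \<bullet> (fst z - snd z) / 2" for z n
    by (simp add: F_def P_def Bq add_divide_distrib)
  obtain z0 where z0: "z0 \<in> K" using K by blast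
  obtain r zh where r: "strict_mono r" "zh \<in> K \<times> K" "(\<lambda>n. (x (r n), y (r n))) \<longlonglongrightarrow> zh" "P zh = 0"
    "\<And>w. w \<in> K \<times> K \<Longrightarrow> P w = 0 \<Longrightarrow> F w \<le> F zh"
  proof (rule penalized_maximizers_converge[of "K \<times> K" F P "(z0, z0)" "\<lambda>n. (x n, y n)"])
    show "compact (K \<times> K)" by (intro compact_Times K)
    show "continuous_on (K \<times> K) F"
      unfolding F_def
      by (intro continuous_intros continuous_on_compose2[OF U continuous_on_fst[OF continuous_on_id]]
         continuous_on_compose2[OF V continuous_on_snd[OF continuous_on_id]]) auto
    show "continuous_on (K \<times> K) P" unfolding P_def by (intro continuous_intros) auto
    show "F w - real n * P w \<le> F (x n, y n) - real n * P (x n, y n)" if "w \<in> K \<times> K" for n w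
      unfolding FP using max[of "fst w" "snd w" n] that by auto
  qed (use z0 xy that in \<open>auto simp: P_def\<close>)
  obtain xh yh where zh: "zh = (xh, yh)" by (cases zh)
  have h: "xh \<in> K" "yh \<in> K" using r(2) zh by auto
  have lim: "(\<lambda>n. x (r n)) \<longlonglongrightarrow> xh" "(\<lambda>n. y (r n)) \<longlonglongrightarrow> yh"
    using tendsto_fst[OF r(3)] tendsto_snd[OF r(3)] by (auto simp: zh)
  have cx: "(\<lambda>n. f (x (r n))) \<longlonglongrightarrow> f xh" if "continuous_on K f" for f :: "real \<times> 'b \<Rightarrow> 'c::topological_space"
    by (rule continuous_on_tendsto_compose[OF that lim(1) h(1)]) (use xy in auto)
  have cy: "(\<lambda>n. f (y (r n))) \<longlonglongrightarrow> f yh" if "continuous_on K f" for f :: "real \<times> 'b \<Rightarrow> 'c::topological_space"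
    by (rule continuous_on_tendsto_compose[OF that lim(2) h(2)]) (use xy in auto)
  have "0 \<le> \<alpha> * ((m xh - m yh) \<bullet> (snd xh - snd yh)) + \<alpha> * (\<Sum>k\<in>UNIV. (norm (\<sigma> k xh - \<sigma> k yh))\<^sup>2) / 2 + g1 xh + g2 yh"
    if int: "xh \<in> interior K" "yh \<in> interior K"
  proof (rule tendsto_le[OF trivial_limit_sequentially _ tendsto_const])
    show "(\<lambda>n. \<alpha> * ((m (x (r n)) - m (y (r n))) \<bullet> (snd (x (r n)) - snd (y (r n)))) +
        \<alpha> * (\<Sum>k\<in>UNIV. (norm (\<sigma> k (x (r n)) - \<sigma> k (y (r n))))\<^sup>2) / 2 + g1 (x (r n)) + g2 (y (r n)))
      \<longlonglongrightarrow> \<alpha> * ((m xh - m yh) \<bullet> (snd xh - snd yh)) + \<alpha> * (\<Sum>k\<in>UNIV. (norm (\<sigma> k xh - \<sigma> k yh))\<^sup>2) / 2 + g1 xh + g2 yh"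
      by (intro tendsto_intros cx cy lim m \<sigma> g1 g2) simp
    show "\<forall>\<^sub>F n in sequentially. 0 \<le> \<alpha> * ((m (x (r n)) - m (y (r n))) \<bullet> (snd (x (r n)) - snd (y (r n)))) +
        \<alpha> * (\<Sum>k\<in>UNIV. (norm (\<sigma> k (x (r n)) - \<sigma> k (y (r n))))\<^sup>2) / 2 + g1 (x (r n)) + g2 (y (r n))"
      using topological_tendstoD[OF lim(1) open_interior int(1)] topological_tendstoD[OF lim(2) open_interior int(2)]
    proof eventually_elim
      case (elim n)
      \<comment> \<open>Time is a variable with drift 1 and no diffusion. The time components of the
        two drifts cancel, so the weight of the time penalty drops out of the inequality.\<close>
      have "((1, m a) - (1, m c)) \<bullet> B l (a - c) = \<alpha> * ((m a - m c) \<bullet> (snd a - snd c))" for a c l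
        by (simp add: B_def inner_prod_def)
      moreover have "B l ((0, v) - (0, w)) \<bullet> ((0, v) - (0, w)) = \<alpha> * (norm (v - w))\<^sup>2" for l v w
        by (simp add: Bq)
      ultimately show ?case using ineq[OF elim] by (simp only: sum_distrib_left[symmetric])
    qed
  qed
  moreover have "U a + V c - \<alpha> * (norm (snd a - snd c))\<^sup>2 / 2 \<le> U xh + V yh - \<alpha> * (norm (snd xh - snd yh))\<^sup>2 / 2"
    if "a \<in> K" "c \<in> K" "fst a = fst c" for a c
    using r(5)[of "(a, c)"] that by (simp add: P_def F_def zh)
  moreover have "fst xh = fst yh" using r(4) by (simp add: P_def zh)
  ultimately show ?thesis using h by blast
qed

text \<open>The spatial weight now tends to infinity. At equal times the Lipschitz bounds estimate
  the differences of drift and diffusion by a multiple of the spatial penalty, which tends to 0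
  along the maximizers, so only the sources survive. A maximum point on the boundary of
  \<open>K\<close> carries no inequality.\<close>

lemma viscosity_maximum_principle:
  fixes U V g1 g2 :: "real \<times> 'b::euclidean_space \<Rightarrow> real" and \<sigma> :: "'k::finite \<Rightarrow> real \<times> 'b \<Rightarrow> 'b"
  assumes K: "compact K" "K \<noteq> {}" and U: "continuous_on K U" and V: "continuous_on K V"
    and m: "continuous_on K m" and \<sigma>: "\<And>k. continuous_on K (\<sigma> k)"
    and g1: "continuous_on K g1" and g2: "continuous_on K g2"
    and lip: "\<And>x y. x \<in> K \<Longrightarrow> y \<in> K \<Longrightarrow> fst x = fst y \<Longrightarrow> norm (m x - m y) \<le> \<Lambda> * norm (snd x - snd y)"
      "\<And>k x y. x \<in> K \<Longrightarrow> y \<in> K \<Longrightarrow> fst x = fst y \<Longrightarrow> norm (\<sigma> k x - \<sigma> k y) \<le> \<Lambda> * norm (snd x - snd y)"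
    and jetU: "\<And>z p X. z \<in> interior K \<Longrightarrow> superjet K U z p X \<Longrightarrow>
       0 \<le> (1, m z) \<bullet> p + (\<Sum>k\<in>UNIV. X (0, \<sigma> k z) \<bullet> (0, \<sigma> k z)) / 2 + g1 z"
    and jetV: "\<And>z p X. z \<in> interior K \<Longrightarrow> superjet K V z p X \<Longrightarrow>
       0 \<le> (1, m z) \<bullet> p + (\<Sum>k\<in>UNIV. X (0, \<sigma> k z) \<bullet> (0, \<sigma> k z)) / 2 + g2 z"
  shows "\<exists>x\<in>K. (\<forall>a\<in>K. U a + V a \<le> U x + V x) \<and> (x \<in> interior K \<longrightarrow> 0 \<le> g1 x + g2 x)"
proof -
  define Q where "Q = (\<lambda>(n::nat) x y. x \<in> K \<and> y \<in> K \<and> fst x = fst y \<and>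
    (\<forall>a\<in>K. \<forall>c\<in>K. fst a = fst c \<longrightarrow> U a + V c - real n * (norm (snd a - snd c))\<^sup>2 / 2 \<le> U x + V y - real n * (norm (snd x - snd y))\<^sup>2 / 2) \<and>
    (x \<in> interior K \<longrightarrow> y \<in> interior K \<longrightarrow>
      0 \<le> real n * ((m x - m y) \<bullet> (snd x - snd y)) + real n * (\<Sum>k\<in>UNIV. (norm (\<sigma> k x - \<sigma> k y))\<^sup>2) / 2 + g1 x + g2 y))"
  have "\<exists>x y. Q n x y" for n
    unfolding Q_def
    by (rule doubled_maximum_equal_times[OF K U V m \<sigma> g1 g2 of_nat_0_le_iff jetU jetV])
  then obtain x y where Q: "\<And>n. Q n (x n) (y n)" by metis
  note xy = Q[unfolded Q_def, THEN conjunct1] Q[unfolded Q_def, THEN conjunct2, THEN conjunct1]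
      Q[unfolded Q_def, THEN conjunct2, THEN conjunct2, THEN conjunct1]
    and max = Q[unfolded Q_def, THEN conjunct2, THEN conjunct2, THEN conjunct2, THEN conjunct1, rule_format]
    and ineq = Q[unfolded Q_def, THEN conjunct2, THEN conjunct2, THEN conjunct2, THEN conjunct2, rule_format]
  define S where "S = (K \<times> K) \<inter> {z. fst (fst z) = fst (snd z)}"
  define F where "F = (\<lambda>z. U (fst z) + V (snd z))"
  define P where "P = (\<lambda>z::(real \<times> 'b) \<times> (real \<times> 'b). (norm (snd (fst z) - snd (snd z)))\<^sup>2 / 2)"
  obtain z0 where z0: "z0 \<in> K" using K by blast
  obtain r zh where r: "strict_mono r" "zh \<in> S" "(\<lambda>n. (x (r n), y (r n))) \<longlonglongrightarrow> zh" "P zh = 0"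
    "(\<lambda>n. real (r n) * P (x (r n), y (r n))) \<longlonglongrightarrow> 0" "\<And>w. w \<in> S \<Longrightarrow> P w = 0 \<Longrightarrow> F w \<le> F zh"
  proof (rule penalized_maximizers_converge[of S F P "(z0, z0)" "\<lambda>n. (x n, y n)"])
    show "compact S" unfolding S_def
      by (intro compact_Int_closed compact_Times K closed_Collect_eq continuous_intros)
    show "continuous_on S F"
      unfolding F_def
      by (intro continuous_intros continuous_on_compose2[OF U continuous_on_fst[OF continuous_on_id]]
         continuous_on_compose2[OF V continuous_on_snd[OF continuous_on_id]]) (auto simp: S_def)
    show "continuous_on S P" unfolding P_def by (intro continuous_intros) auto
    show "F w - real n * P w \<le> F (x n, y n) - real n * P (x n, y n)" if "w \<in> S" for n w
      using max[of "fst w" "snd w" n] that by (auto simp: F_def P_def S_def)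
  qed (use z0 xy that in \<open>auto simp: P_def S_def\<close>)
  obtain xh where zh: "zh = (xh, xh)" and h: "xh \<in> K"
    using r(2,4) by (cases zh) (auto simp: S_def P_def prod_eq_iff)
  have lim: "(\<lambda>n. x (r n)) \<longlonglongrightarrow> xh" "(\<lambda>n. y (r n)) \<longlonglongrightarrow> xh"
    using tendsto_fst[OF r(3)] tendsto_snd[OF r(3)] by (auto simp: zh)
  \<comment> \<open>With \<open>P = N\<^sup>2 / 2\<close> the summand \<open>2 * \<Lambda>\<close>
    stems from the drift and \<open>CARD('k) * \<Lambda>\<^sup>2\<close> from the diffusion, whose
    sum is halved.\<close>
  define c where "c = 2 * \<Lambda> + real CARD('k) * \<Lambda>\<^sup>2"
  have "0 \<le> g1 xh + g2 xh" if int: "xh \<in> interior K"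
  proof (rule tendsto_le[OF trivial_limit_sequentially _ tendsto_const])
    have "(\<lambda>n. c * (real (r n) * P (x (r n), y (r n))) + g1 (x (r n)) + g2 (y (r n))) \<longlonglongrightarrow> c * 0 + g1 xh + g2 xh"
      using xy by (intro tendsto_intros r(5) continuous_on_tendsto_compose[OF g1 lim(1) h] continuous_on_tendsto_compose[OF g2 lim(2) h]) auto
    then show "(\<lambda>n. c * (real (r n) * P (x (r n), y (r n))) + g1 (x (r n)) + g2 (y (r n))) \<longlonglongrightarrow> g1 xh + g2 xh" by simp
    show "\<forall>\<^sub>F n in sequentially. 0 \<le> c * (real (r n) * P (x (r n), y (r n))) + g1 (x (r n)) + g2 (y (r n))"
      using topological_tendstoD[OF lim(1) open_interior int(1)] topological_tendstoD[OF lim(2) open_interior int(1)]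
    proof eventually_elim
      case (elim n)
      define N where "N = norm (snd (x (r n)) - snd (y (r n)))"
      define R where "R = real (r n)"
      have "(m (x (r n)) - m (y (r n))) \<bullet> (snd (x (r n)) - snd (y (r n))) \<le> norm (m (x (r n)) - m (y (r n))) * N"
        unfolding N_def by (rule norm_cauchy_schwarz)
      also have "\<dots> \<le> (\<Lambda> * N) * N" unfolding N_def by (intro mult_right_mono lip xy) auto
      finally have a: "R * ((m (x (r n)) - m (y (r n))) \<bullet> (snd (x (r n)) - snd (y (r n)))) \<le> R * (\<Lambda> * N * N)"
        by (intro mult_left_mono) (auto simp: R_def)
      have "(\<Sum>k\<in>UNIV. (norm (\<sigma> k (x (r n)) - \<sigma> k (y (r n))))\<^sup>2) \<le> (\<Sum>k\<in>(UNIV::'k set). (\<Lambda> * N)\<^sup>2)"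
        unfolding N_def by (intro sum_mono power_mono lip xy) auto
      then have b: "R * (\<Sum>k\<in>UNIV. (norm (\<sigma> k (x (r n)) - \<sigma> k (y (r n))))\<^sup>2) \<le> R * (real CARD('k) * (\<Lambda> * N)\<^sup>2)"
        by (intro mult_left_mono) (auto simp: R_def)
      have "c * (R * P (x (r n), y (r n))) = R * (\<Lambda> * N * N) + R * (real CARD('k) * (\<Lambda> * N)\<^sup>2) / 2"
        by (simp add: c_def P_def N_def power2_eq_square algebra_simps)
      then show ?case using ineq[OF elim, folded R_def] a b unfolding R_def[symmetric] by linarith
    qed
  qed
  moreover have "U a + V a \<le> U xh + V xh" if "a \<in> K" for a
    using r(6)[of "(a, a)"] that by (simp add: F_def zh S_def P_def)
  ultimately show ?thesis using h by blast
qed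

subsection \<open>Test functions\<close>

text \<open>The derivatives are named explicitly so that those of sums and products can be computed.\<close>

definition C12_derivs ::
  "real set \<Rightarrow> (real^'d) set \<Rightarrow> (real \<Rightarrow> real^'d \<Rightarrow> real) \<Rightarrow> (real \<Rightarrow> real^'d \<Rightarrow> real) \<Rightarrow>
   (real \<Rightarrow> real^'d \<Rightarrow> real^'d) \<Rightarrow> (real \<Rightarrow> real^'d \<Rightarrow> real^'d^'d) \<Rightarrow> bool" where
  "C12_derivs I D u ut ux uxx \<longleftrightarrow>
     (\<forall>t\<in>I. \<forall>x\<in>D. ((\<lambda>s. u s x) has_real_derivative ut t x) (at t) \<and>
        (u t has_derivative (\<lambda>h. ux t x \<bullet> h)) (at x) \<and>
        (ux t has_derivative (\<lambda>h. uxx t x *v h)) (at x)) \<and>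
     continuous_on (I \<times> D) (\<lambda>(t, x). u t x) \<and> continuous_on (I \<times> D) (\<lambda>(t, x). ut t x) \<and>
     continuous_on (I \<times> D) (\<lambda>(t, x). ux t x) \<and> continuous_on (I \<times> D) (\<lambda>(t, x). uxx t x)"

lemma C12_derivsD:
  assumes "C12_derivs I D u ut ux uxx" "t \<in> I" "x \<in> D"
  shows "((\<lambda>s. u s x) has_real_derivative ut t x) (at t)" "(u t has_derivative (\<lambda>h. ux t x \<bullet> h)) (at x)"
    "(ux t has_derivative (\<lambda>h. uxx t x *v h)) (at x)"
  using assms by (auto simp: C12_derivs_def)

lemma C12_derivs_eq:
  assumes C: "C12_derivs I D u ut ux uxx" and I: "open I" and D: "open D" and t: "t \<in> I" and x: "x \<in> D"
  shows "time_deriv I u t x = ut t x" "space_grad u t x = ux t x" "space_hess u t x = uxx t x"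
    "(\<lambda>s. u s x) differentiable (at t within I)" "u t differentiable (at x)" "space_grad u t differentiable (at x)"
proof -
  note d = C12_derivsD[OF C]
  have atI: "at t within I = at t" using I t by (rule at_within_open[rotated])
  show "time_deriv I u t x = ut t x"
    unfolding time_deriv_def atI
    using d(1)[OF t x] by (intro vector_derivative_at) (simp add: has_real_derivative_iff_has_vector_derivative)
  show "(\<lambda>s. u s x) differentiable (at t within I)"
    using d(1)[OF t x] unfolding atI by (metis has_field_derivative_imp_has_derivative differentiable_def)
  have grad: "space_grad u t y = ux t y" if "y \<in> D" for y
  proof (rule space_grad_eq_GDERIV)
    show "GDERIV (u t) y :> ux t y"
      using d(2)[OF t that] by (simp add: gderiv_def inner_commute)
  qed
  show "space_grad u t x = ux t x" by (rule grad[OF x])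
  show "u t differentiable (at x)" using d(2)[OF t x] by (auto simp: differentiable_def)
  have hd: "(space_grad u t has_derivative (\<lambda>h. uxx t x *v h)) (at x)"
    by (rule has_derivative_transform_within_open[OF d(3)[OF t x] D x]) (simp add: grad)
  then show "space_grad u t differentiable (at x)" by (auto simp: differentiable_def)
  show "space_hess u t x = uxx t x"
    unfolding space_hess_def jacobian_def frechet_derivative_at[OF hd, symmetric]
    by (rule matrix_of_matrix_vector_mul)
qed

lemma C12_on_if_C12_derivs:
  assumes C: "C12_derivs I D u ut ux uxx" and I: "open I" and D: "open D"
  shows "C12_on I D u"
proof -
  note e = C12_derivs_eq[OF C I D]
  have "continuous_on (I \<times> D) (\<lambda>(t, x). time_deriv I u t x)"
    using C by (subst continuous_on_cong[OF refl, of _ _ "\<lambda>(t, x). ut t x"]) (auto simp: e C12_derivs_def)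
  moreover have "continuous_on (I \<times> D) (\<lambda>(t, x). space_grad u t x)"
    using C by (subst continuous_on_cong[OF refl, of _ _ "\<lambda>(t, x). ux t x"]) (auto simp: e C12_derivs_def)
  moreover have "continuous_on (I \<times> D) (\<lambda>(t, x). space_hess u t x)"
    using C by (subst continuous_on_cong[OF refl, of _ _ "\<lambda>(t, x). uxx t x"]) (auto simp: e C12_derivs_def)
  moreover have "continuous_on (I \<times> D) (\<lambda>(t, x). u t x)" using C by (simp add: C12_derivs_def)
  ultimately show ?thesis unfolding C12_on_def using e(4-6) by blast
qed

text \<open>On an open \<open>I\<close> inside \<open>J\<close> the derivatives within
  \<open>J\<close> are two-sided. \<open>time_deriv J\<close> is kept in the conclusion so that the
  Lyapunov inequality, stated for \<open>J = {0..T}\<close>, applies verbatim.\<close>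

lemma C12_derivs_if_C12_on:
  fixes u :: "real \<Rightarrow> real^'d \<Rightarrow> real"
  assumes C: "C12_on J D u" and I: "open I" "I \<subseteq> J"
  shows "C12_derivs I D u (time_deriv J u) (space_grad u) (space_hess u)"
proof -
  have cont: "continuous_on (I \<times> D) f" if "continuous_on (J \<times> D) f" for f :: "real \<times> (real^'d) \<Rightarrow> 'c::topological_space"
    by (rule continuous_on_subset[OF that]) (use I in auto)
  have "((\<lambda>s. u s x) has_real_derivative time_deriv J u t x) (at t) \<and>
        (u t has_derivative (\<lambda>h. space_grad u t x \<bullet> h)) (at x) \<and>
        (space_grad u t has_derivative (\<lambda>h. space_hess u t x *v h)) (at x)" if tx: "t \<in> I" "x \<in> D" for t x
  proof -
    have d: "(\<lambda>s. u s x) differentiable (at t within J)" "u t differentiable (at x)" "space_grad u t differentiable (at x)"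
      using C tx I by (auto simp: C12_on_def)
    have "t \<in> interior J" using I tx by (meson interiorI)
    then have atJ: "at t within J = at t" by (rule at_within_interior)
    have 1: "((\<lambda>s. u s x) has_real_derivative time_deriv J u t x) (at t)"
      using d(1) unfolding time_deriv_def atJ
      by (simp add: has_real_derivative_iff_has_vector_derivative vector_derivative_works)
    let ?F = "frechet_derivative (u t) (at x)"
    have F: "(u t has_derivative ?F) (at x)" using d(2) frechet_derivative_works by blast
    then interpret F: bounded_linear ?F by (rule has_derivative_bounded_linear)
    have "?F h = space_grad u t x \<bullet> h" for h
    proof -
      have "?F h = ?F (\<Sum>i\<in>UNIV. h $ i *\<^sub>R axis i 1)" by (simp add: basis_expansion scalar_mult_eq_scaleR[symmetric])
      also have "\<dots> = (\<Sum>i\<in>UNIV. h $ i * ?F (axis i 1))" by (simp add: F.sum F.scaleR)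
      also have "\<dots> = space_grad u t x \<bullet> h" by (simp add: space_grad_def inner_vec_def mult.commute)
      finally show ?thesis .
    qed
    then have "?F = (\<lambda>h. space_grad u t x \<bullet> h)" by auto
    then have 2: "(u t has_derivative (\<lambda>h. space_grad u t x \<bullet> h)) (at x)" using F by simp
    have 3: "(space_grad u t has_derivative (\<lambda>h. space_hess u t x *v h)) (at x)"
      using d(3) unfolding space_hess_def by (simp add: jacobian_works)
    show ?thesis using 1 2 3 by blast
  qed
  then show ?thesis using C unfolding C12_derivs_def C12_on_def by (blast intro: cont)
qed

lemma C12_derivs_add:
  assumes "C12_derivs I D u ut ux uxx" "C12_derivs I D v vt vx vxx"
  shows "C12_derivs I D (\<lambda>t x. u t x + v t x) (\<lambda>t x. ut t x + vt t x) (\<lambda>t x. ux t x + vx t x) (\<lambda>t x. uxx t x + vxx t x)"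
  using assms unfolding C12_derivs_def
  by (auto simp: split_beta matrix_vector_mult_add_rdistrib inner_add_left
      intro!: derivative_eq_intros continuous_on_add)

definition outer :: "real^'d \<Rightarrow> real^'d \<Rightarrow> real^'d^'d" where
  "outer a b = (\<chi> i j. a $ i * b $ j)"

lemma outer_mult_vector: "outer a b *v h = (b \<bullet> h) *\<^sub>R a"
  by (simp add: outer_def matrix_vector_mult_def vec_eq_iff inner_vec_def sum_distrib_left mult_ac)

lemma continuous_on_outer [continuous_intros]:
  "continuous_on S f \<Longrightarrow> continuous_on S g \<Longrightarrow> continuous_on S (\<lambda>z. outer (f z) (g z))"
  unfolding outer_def by (intro continuous_intros)

lemma C12_derivs_mult:
  assumes U: "C12_derivs I D u ut ux uxx" and V: "C12_derivs I D v vt vx vxx"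
  shows "C12_derivs I D (\<lambda>t x. u t x * v t x) (\<lambda>t x. ut t x * v t x + u t x * vt t x)
     (\<lambda>t x. u t x *\<^sub>R vx t x + v t x *\<^sub>R ux t x)
     (\<lambda>t x. u t x *\<^sub>R vxx t x + v t x *\<^sub>R uxx t x + outer (vx t x) (ux t x) + outer (ux t x) (vx t x))"
  unfolding C12_derivs_def
proof (intro conjI ballI)
  fix t x assume tx: "t \<in> I" "x \<in> D"
  note u = C12_derivsD[OF U tx] note v = C12_derivsD[OF V tx]
  show "((\<lambda>s. u s x * v s x) has_real_derivative ut t x * v t x + u t x * vt t x) (at t)"
    by (rule derivative_eq_intros u(1) v(1))+ (simp add: mult.commute)
  show "((\<lambda>x. u t x * v t x) has_derivative (\<lambda>h. (u t x *\<^sub>R vx t x + v t x *\<^sub>R ux t x) \<bullet> h)) (at x)"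
    by (rule has_derivative_eq_rhs[OF has_derivative_mult[OF u(2) v(2)]]) (simp add: fun_eq_iff inner_add_left)
  show "((\<lambda>x. u t x *\<^sub>R vx t x + v t x *\<^sub>R ux t x) has_derivative
     (\<lambda>h. (u t x *\<^sub>R vxx t x + v t x *\<^sub>R uxx t x + outer (vx t x) (ux t x) + outer (ux t x) (vx t x)) *v h)) (at x)"
    by (rule has_derivative_eq_rhs[OF has_derivative_add[OF has_derivative_scaleR[OF u(2) v(3)] has_derivative_scaleR[OF v(2) u(3)]]])
       (simp add: fun_eq_iff matrix_vector_mult_add_rdistrib outer_mult_vector scaleR_matrix_vector_assoc)
qed (use U V in \<open>auto simp: C12_derivs_def split_beta intro!: continuous_intros\<close>)

lemma C12_derivs_time:
  assumes d: "\<And>t. t \<in> I \<Longrightarrow> (g has_real_derivative g' t) (at t)" and c: "continuous_on I g'"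
  shows "C12_derivs I D (\<lambda>t x. g t) (\<lambda>t x. g' t) (\<lambda>t x. 0) (\<lambda>t x. 0)"
proof -
  have "continuous_on I g" using d by (meson DERIV_isCont continuous_at_imp_continuous_on)
  then have "continuous_on (I \<times> D) (\<lambda>z. g (fst z))" "continuous_on (I \<times> D) (\<lambda>z. g' (fst z))"
    by (auto intro!: continuous_on_compose2[OF _ continuous_on_fst[OF continuous_on_id]] c)
  then show ?thesis using d by (auto simp: C12_derivs_def split_beta)
qed

text \<open>\<open>A\<close> comes from a map not known to be symmetric, hence the symmetrization in
  the Hessian. Mixed terms in time and space are left out, as \<open>k\<close> and a small increase
  of \<open>A\<close> can absorb them.\<close>

lemma C12_derivs_quadratic:
  fixes A :: "real^'d^'d"
  shows "C12_derivs I D (\<lambda>s y. c + pt * (s - t0) + k * (s - t0)\<^sup>2 + px \<bullet> (y - x0) + ((A *v (y - x0)) \<bullet> (y - x0)) / 2)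
     (\<lambda>s y. pt + 2 * k * (s - t0)) (\<lambda>s y. px + ((1/2) *\<^sub>R (A + transpose A)) *v (y - x0)) (\<lambda>s y. (1/2) *\<^sub>R (A + transpose A))"
  unfolding C12_derivs_def
proof (intro conjI ballI)
  fix t :: real and x :: "real^'d"
  show "((\<lambda>s. c + pt * (s - t0) + k * (s - t0)\<^sup>2 + px \<bullet> (x - x0) + ((A *v (x - x0)) \<bullet> (x - x0)) / 2)
      has_real_derivative pt + 2 * k * (t - t0)) (at t)"
    by (auto intro!: derivative_eq_intros)
  have tr: "(A *v a) \<bullet> h = a \<bullet> (transpose A *v h)" for a h
    by (metis dot_lmul_matrix inner_commute transpose_matrix_vector)
  show "((\<lambda>y. c + pt * (t - t0) + k * (t - t0)\<^sup>2 + px \<bullet> (y - x0) + ((A *v (y - x0)) \<bullet> (y - x0)) / 2)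
     has_derivative (\<lambda>h. (px + ((1/2) *\<^sub>R (A + transpose A)) *v (x - x0)) \<bullet> h)) (at x)"
  proof (rule has_derivative_eq_rhs)
    show "((\<lambda>y. c + pt * (t - t0) + k * (t - t0)\<^sup>2 + px \<bullet> (y - x0) + ((A *v (y - x0)) \<bullet> (y - x0)) / 2)
      has_derivative (\<lambda>h. px \<bullet> h + ((A *v (x - x0)) \<bullet> h + (A *v h) \<bullet> (x - x0)) / 2)) (at x)"
      by (auto intro!: derivative_eq_intros bounded_linear.has_derivative[OF matrix_vector_mul_bounded_linear])
    show "(\<lambda>h. px \<bullet> h + ((A *v (x - x0)) \<bullet> h + (A *v h) \<bullet> (x - x0)) / 2) = (\<lambda>h. (px + ((1/2) *\<^sub>R (A + transpose A)) *v (x - x0)) \<bullet> h)"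
      by (auto simp: fun_eq_iff inner_add_left matrix_vector_mult_add_rdistrib scaleR_matrix_vector_assoc[symmetric] tr inner_commute add_divide_distrib
          inner_add_right scaleR_add_right)
  qed
  show "((\<lambda>y. px + ((1/2) *\<^sub>R (A + transpose A)) *v (y - x0)) has_derivative (\<lambda>h. ((1/2) *\<^sub>R (A + transpose A)) *v h)) (at x)"
    by (rule has_derivative_eq_rhs)
      (auto intro!: derivative_eq_intros bounded_linear.has_derivative[OF matrix_vector_mul_bounded_linear])
qed (auto simp: split_beta intro!: continuous_intros linear_continuous_on_compose[OF _ matrix_vector_mul_linear])

text \<open>Brings the second order term into the form in which superjets enter the maximum
  principle: values of a quadratic form on the columns of \<open>S\<close>.\<close>

lemma trace_mult_transpose:
  fixes S :: "real^'m^'d" and A :: "real^'d^'d"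
  shows "trace (S ** transpose S ** A) = (\<Sum>k\<in>UNIV. (A *v column k S) \<bullet> column k S)"
proof -
  have "trace (S ** transpose S ** A) = trace (A ** (S ** transpose S))"
    by (rule trace_mul_sym)
  also have "\<dots> = (\<Sum>i\<in>UNIV. \<Sum>j\<in>UNIV. \<Sum>k\<in>UNIV. A$i$j * (S$j$k * S$i$k))"
    by (simp add: trace_def matrix_matrix_mult_def transpose_def sum_distrib_left)
  also have "\<dots> = (\<Sum>i\<in>UNIV. \<Sum>k\<in>UNIV. \<Sum>j\<in>UNIV. A$i$j * (S$j$k * S$i$k))"
    by (intro sum.cong refl sum.swap)
  also have "\<dots> = (\<Sum>k\<in>UNIV. \<Sum>i\<in>UNIV. \<Sum>j\<in>UNIV. A$i$j * (S$j$k * S$i$k))"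
    by (rule sum.swap)
  also have "\<dots> = (\<Sum>k\<in>UNIV. (A *v column k S) \<bullet> column k S)"
    by (simp add: inner_vec_def matrix_vector_mult_def column_def sum_distrib_right mult.assoc)
  finally show ?thesis .
qed

subsection \<open>Superjets of subsolutions\<close>

text \<open>The nonlinearity along \<open>u\<close> is frozen into a source \<open>g\<close>. In
  this form \<open>u1\<close> and \<open>- u2\<close> are both subsolutions of linear equations and
  can be treated alike.\<close>

definition touching_subsolution ::
  "real \<Rightarrow> (real^'d) set \<Rightarrow> (real \<Rightarrow> real^'d \<Rightarrow> real^'d) \<Rightarrow> (real \<Rightarrow> real^'d \<Rightarrow> real^'m^'d) \<Rightarrow>
   (real \<Rightarrow> real^'d \<Rightarrow> real) \<Rightarrow> (real \<Rightarrow> real^'d \<Rightarrow> real) \<Rightarrow> bool" where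
  "touching_subsolution T D \<mu> \<sigma> g u \<longleftrightarrow>
     (\<forall>t\<in>{0<..<T}. \<forall>x\<in>D. \<forall>\<phi> \<phi>t \<phi>x \<phi>xx. C12_derivs {0<..<T} D \<phi> \<phi>t \<phi>x \<phi>xx \<longrightarrow> \<phi> t x = u t x \<longrightarrow>
        (\<forall>s\<in>{0<..<T}. \<forall>y\<in>D. u s y \<le> \<phi> s y) \<longrightarrow>
        0 \<le> \<phi>t t x + 1/2 * trace (\<sigma> t x ** transpose (\<sigma> t x) ** \<phi>xx t x) + \<mu> t x \<bullet> \<phi>x t x + g t x)"

lemma touching_subsolution_if_viscosity_subsolution:
  assumes "viscosity_subsolution T D W (semilinear_op \<mu> \<sigma> f) u" and D: "open D"
  shows "touching_subsolution T D \<mu> \<sigma> (\<lambda>t x. f t x (u t x)) u"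
  unfolding touching_subsolution_def
proof (intro ballI allI impI)
  fix t x \<phi> \<phi>t \<phi>x \<phi>xx
  assume a: "t \<in> {0<..<T}" "x \<in> D" "C12_derivs {0<..<T} D \<phi> \<phi>t \<phi>x \<phi>xx" "\<phi> t x = u t x" "\<forall>s\<in>{0<..<T}. \<forall>y\<in>D. u s y \<le> \<phi> s y"
  note e = C12_derivs_eq[OF a(3) open_greaterThanLessThan D a(1,2)]
  have "C12_on {0<..<T} D \<phi>" by (rule C12_on_if_C12_derivs[OF a(3) open_greaterThanLessThan D])
  then have "0 \<le> time_deriv {0<..<T} \<phi> t x + semilinear_op \<mu> \<sigma> f t x (\<phi> t x) (space_grad \<phi> t x) (space_hess \<phi> t x)"
    using assms(1) a unfolding viscosity_subsolution_def by blast
  then show "0 \<le> \<phi>t t x + 1/2 * trace (\<sigma> t x ** transpose (\<sigma> t x) ** \<phi>xx t x) + \<mu> t x \<bullet> \<phi>x t x + f t x (u t x)"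
    by (simp add: e semilinear_op_def a(4) add.assoc)
qed

lemma touching_subsolution_if_viscosity_supersolution:
  assumes "viscosity_supersolution T D W (semilinear_op \<mu> \<sigma> f) u" and D: "open D"
  shows "touching_subsolution T D \<mu> \<sigma> (\<lambda>t x. - f t x (u t x)) (\<lambda>t x. - u t x)"
  unfolding touching_subsolution_def
proof (intro ballI allI impI)
  fix t x \<phi> \<phi>t \<phi>x \<phi>xx
  assume a: "t \<in> {0<..<T}" "x \<in> D" "C12_derivs {0<..<T} D \<phi> \<phi>t \<phi>x \<phi>xx" "\<phi> t x = - u t x" "\<forall>s\<in>{0<..<T}. \<forall>y\<in>D. - u s y \<le> \<phi> s y"
  have minus: "C12_derivs {0<..<T} D (\<lambda>t x. (-1) * \<phi> t x) (\<lambda>t x. - \<phi>t t x) (\<lambda>t x. - \<phi>x t x) (\<lambda>t x. - \<phi>xx t x)"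
    using C12_derivs_mult[OF C12_derivs_time[of "{0<..<T}" "\<lambda>_. -1" "\<lambda>_. 0"] a(3)]
    by (simp add: outer_def zero_vec_def[symmetric])
  note e = C12_derivs_eq[OF minus open_greaterThanLessThan D a(1,2)]
  have "C12_on {0<..<T} D (\<lambda>t x. (-1) * \<phi> t x)" by (rule C12_on_if_C12_derivs[OF minus open_greaterThanLessThan D])
  moreover have "(-1) * \<phi> t x = u t x" using a(4) by simp
  moreover have "\<forall>s\<in>{0<..<T}. \<forall>y\<in>D. (-1) * \<phi> s y \<le> u s y"
  proof (intro ballI)
    fix s y assume "s \<in> {0<..<T}" "y \<in> D"
    then have "- u s y \<le> \<phi> s y" using a(5) by blast
    then show "(-1) * \<phi> s y \<le> u s y" by simp
  qed
  ultimately have "time_deriv {0<..<T} (\<lambda>t x. (-1) * \<phi> t x) t x + semilinear_op \<mu> \<sigma> f t x ((-1) * \<phi> t x)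
     (space_grad (\<lambda>t x. (-1) * \<phi> t x) t x) (space_hess (\<lambda>t x. (-1) * \<phi> t x) t x) \<le> 0"
    using assms(1) a(1,2) unfolding viscosity_supersolution_def by blast
  moreover have "trace (\<sigma> t x ** transpose (\<sigma> t x) ** - \<phi>xx t x) = - trace (\<sigma> t x ** transpose (\<sigma> t x) ** \<phi>xx t x)"
  proof -
    have "(- B) *v v = - (B *v v)" for B :: "real^'a^'a" and v
      by (simp add: matrix_vector_mult_def vec_eq_iff sum_negf)
    then show ?thesis by (simp add: trace_mult_transpose sum_negf)
  qed
  ultimately show "0 \<le> \<phi>t t x + 1/2 * trace (\<sigma> t x ** transpose (\<sigma> t x) ** \<phi>xx t x) + \<mu> t x \<bullet> \<phi>x t x + - f t x (u t x)"
    unfolding e semilinear_op_def using a(4) by simp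
qed

text \<open>The fourth power of the space-time distance has vanishing first derivatives and Hessian
  at \<open>(t0, x0)\<close>. The factor \<open>1 + V\<close> lets it dominate multiples of
  \<open>V\<close> and quadratic polynomials away from that point.\<close>

lemma C12_derivs_quartic_penalty:
  assumes V: "C12_derivs I D V Vt Vx Vxx"
  obtains Rt Rx Rxx where
    "C12_derivs I D (\<lambda>s y. M * (((s - t0)\<^sup>2 + (norm (y - x0))\<^sup>2)\<^sup>2 * (1 + V s y))) Rt Rx Rxx"
    "Rt t0 x0 = 0" "Rx t0 x0 = 0" "Rxx t0 x0 = 0"
proof -
  define R where "R = (\<lambda>s y. 0 + 0 * (s - t0) + 1 * (s - t0)\<^sup>2 + 0 \<bullet> (y - x0) + (((2 *\<^sub>R mat 1) *v (y - x0)) \<bullet> (y - x0)) / 2)"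
  have R: "R s y = (s - t0)\<^sup>2 + (norm (y - x0))\<^sup>2" for s y
    by (simp add: R_def scaleR_matrix_vector_assoc[symmetric] power2_norm_eq_inner)
  obtain rt rx rxx where r: "C12_derivs I D R rt rx rxx" "rt t0 x0 = 0" "rx t0 x0 = 0"
    by (rule that[OF C12_derivs_quadratic[of I D 0 0 t0 1 0 x0 "2 *\<^sub>R mat 1", folded R_def]]) auto
  have one: "C12_derivs I D (\<lambda>s y. c) (\<lambda>s y. 0) (\<lambda>s y. 0) (\<lambda>s y. 0)" for c :: real
    by (rule C12_derivs_time) auto
  have R0: "R t0 x0 = 0" by (simp add: R)
  have o: "outer 0 a = 0" "outer a 0 = 0" for a :: "real^'a" by (simp_all add: outer_def vec_eq_iff)
  note P = C12_derivs_mult[OF one[of M] C12_derivs_mult[OF C12_derivs_mult[OF r(1) r(1)] C12_derivs_add[OF one[of 1] V]]]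
  have sq: "R s y * R s y = ((s - t0)\<^sup>2 + (norm (y - x0))\<^sup>2)\<^sup>2" for s y
    unfolding R by (rule power2_eq_square[symmetric])
  show thesis
    by (rule that[OF P[unfolded sq]]) (simp_all add: R0 r(2,3) o)
qed

text \<open>The superjet controls \<open>u - W\<close> near one point, but a test function must lie
  above \<open>u\<close> on all of \<open>{0<..<T} \<times> D\<close>. It is built from
  \<open>W\<close>, a quadratic enlarged by \<open>\<kappa>\<close> so as to beat the error term
  near the point, and the quartic penalty, which takes over farther out. The enlargement costs
  \<open>3 / 2 * \<kappa> * E\<close> and is sent to 0.\<close>

lemma superjet_inequality:
  fixes D :: "(real^'d) set" and \<sigma> :: "real \<Rightarrow> real^'d \<Rightarrow> real^'m^'d"
  assumes touch: "touching_subsolution T D \<mu> \<sigma> g u"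
    and W: "C12_derivs {0<..<T} D W Wt Wx Wxx" and W0: "\<And>s y. s \<in> {0<..<T} \<Longrightarrow> y \<in> D \<Longrightarrow> 0 \<le> W s y"
    and V: "C12_derivs {0<..<T} D V Vt Vx Vxx" and V0: "\<And>s y. s \<in> {0<..<T} \<Longrightarrow> y \<in> D \<Longrightarrow> 0 < V s y"
    and bound: "\<And>s y. s \<in> {0<..<T} \<Longrightarrow> y \<in> D \<Longrightarrow> u s y \<le> C * V s y"
    and K: "K \<subseteq> {0..T} \<times> D" and D: "open D" and z0: "(t0, x0) \<in> interior K"
    and jet: "superjet K (\<lambda>z. u (fst z) (snd z) - W (fst z) (snd z)) (t0, x0) p X"
  shows "0 \<le> (1, \<mu> t0 x0) \<bullet> p + (\<Sum>k\<in>UNIV. X (0, column k (\<sigma> t0 x0)) \<bullet> (0, column k (\<sigma> t0 x0))) / 2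
     + (Wt t0 x0 + 1/2 * trace (\<sigma> t0 x0 ** transpose (\<sigma> t0 x0) ** Wxx t0 x0) + \<mu> t0 x0 \<bullet> Wx t0 x0 + g t0 x0)"
    (is "0 \<le> ?target")
proof -
  have "interior K \<subseteq> interior ({0..T} \<times> D)" using K by (rule interior_mono)
  also have "\<dots> = {0<..<T} \<times> D" using D by (simp add: interior_Times interior_open)
  finally have intK: "interior K \<subseteq> {0<..<T} \<times> D" .
  then have t0: "t0 \<in> {0<..<T}" and x0: "x0 \<in> D" using z0 by auto
  interpret X: bounded_linear X using jet by (simp add: superjet_def)
  obtain KX where KX: "0 < KX" "\<And>h. norm (X h) \<le> norm h * KX" using X.pos_bounded by blast
  define E where "E = (\<Sum>k\<in>UNIV. (norm (column k (\<sigma> t0 x0)))\<^sup>2)"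
  have E: "0 \<le> E" unfolding E_def by (intro sum_nonneg) auto
  define c0 where "c0 = u t0 x0 - W t0 x0"
  obtain pt px where p: "p = (pt, px)" by (cases p)
  define A0 where "A0 = matrix (\<lambda>y. snd (X (0, y)))"
  have "linear (\<lambda>y. snd (X (0, y)))"
    by (intro bounded_linear.linear bounded_linear_compose[OF bounded_linear_snd] bounded_linear_compose[OF X.bounded_linear_axioms]
        bounded_linear_Pair bounded_linear_ident bounded_linear_zero)
  then have A0: "A0 *v y = snd (X (0, y))" for y
    unfolding A0_def by (intro matrix_works) (simp add: linear_matrix_vector_mul_eq)
  have main: "0 \<le> ?target + 3 / 2 * \<kappa> * E" if \<kappa>: "0 < \<kappa>" for \<kappa>
  proof -
    \<comment> \<open>By Young's inequality the mixed time-space part of \<open>X\<close> is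
      absorbed by \<open>KX\<^sup>2 / \<kappa>\<close> here and one \<open>\<kappa>\<close> in
      space. That \<open>k\<close> blows up as \<open>\<kappa>\<close> tends to 0 is harmless: the
      time derivative of \<open>k * (s - t0)\<^sup>2\<close> vanishes at \<open>t0\<close>.\<close>
    define k where "k = (KX + KX\<^sup>2 / \<kappa>) / 2 + \<kappa>"
    have k: "0 \<le> k" using KX \<kappa> by (simp add: k_def)
    \<comment> \<open>One \<open>\<kappa>\<close> is for the mixed terms and two are for the error
      \<open>\<kappa> * (norm b)\<^sup>2\<close>, as the quadratic form is halved in
      \<open>q\<close>.\<close>
    define A where "A = A0 + (3 * \<kappa>) *\<^sub>R mat 1"
    have A: "(A *v y) \<bullet> y = X (0, y) \<bullet> (0, y) + 3 * \<kappa> * (norm y)\<^sup>2" for y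
      by (simp add: A_def matrix_vector_mult_add_rdistrib scaleR_matrix_vector_assoc[symmetric] A0
          inner_add_left inner_prod_def power2_norm_eq_inner)
    define q where "q = (\<lambda>s y. c0 + pt * (s - t0) + k * (s - t0)\<^sup>2 + px \<bullet> (y - x0) + ((A *v (y - x0)) \<bullet> (y - x0)) / 2)"
    obtain d where d: "0 < d" "\<And>a. a \<in> K \<Longrightarrow> norm (a - (t0, x0)) < d \<Longrightarrow>
        u (fst a) (snd a) - W (fst a) (snd a) \<le> c0 + p \<bullet> (a - (t0, x0)) + X (a - (t0, x0)) \<bullet> (a - (t0, x0)) / 2 + \<kappa> * (norm (a - (t0, x0)))\<^sup>2"
      using jet \<kappa> unfolding superjet_def c0_def by (metis fst_conv snd_conv)
    obtain \<rho>' where \<rho>': "0 < \<rho>'" "ball (t0, x0) \<rho>' \<subseteq> K" using z0 by (auto simp: mem_interior)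
    define \<rho> where "\<rho> = min d \<rho>'"
    have \<rho>: "0 < \<rho>" using d \<rho>' by (simp add: \<rho>_def)
    define r where "r = (\<lambda>s y. (s - t0)\<^sup>2 + (norm (y - x0))\<^sup>2)"
    have nr: "(norm ((s, y) - (t0, x0)))\<^sup>2 = r s y" for s y by (simp add: r_def norm_Pair)
    have near: "u s y - W s y \<le> q s y" if "norm ((s, y) - (t0, x0)) < \<rho>" for s y
    proof -
      define a b where "a = s - t0" and "b = y - x0"
      have h: "(s, y) - (t0, x0) = (a, b)" by (simp add: a_def b_def)
      have "(s, y) \<in> ball (t0, x0) \<rho>'"
        using that dist_norm[of "(s, y)" "(t0, x0)"] unfolding mem_ball dist_commute[of "(t0, x0)" "(s, y)"] \<rho>_def by linarith
      then have "(s, y) \<in> K" using \<rho>'(2) by (rule subsetD[rotated])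
      then have 1: "u s y - W s y \<le> c0 + p \<bullet> (a, b) + X (a, b) \<bullet> (a, b) / 2 + \<kappa> * (norm (a, b))\<^sup>2"
        using d(2)[of "(s, y)"] that h by (simp add: \<rho>_def)
      have "X (a, b) = X (a, 0) + X (0, b)" using X.add[of "(a, 0)" "(0, b)"] by simp
      then have "X (a, b) \<bullet> (a, b) = X (0, b) \<bullet> (0, b) + (X (a, 0) \<bullet> (0, b) + X (0, b) \<bullet> (a, 0) + X (a, 0) \<bullet> (a, 0))"
        by (simp add: inner_prod_def inner_add_left algebra_simps)
      moreover have "X (a, 0) \<bullet> (0, b) \<le> KX * (\<bar>a\<bar> * norm b)" "X (0, b) \<bullet> (a, 0) \<le> KX * (\<bar>a\<bar> * norm b)" "X (a, 0) \<bullet> (a, 0) \<le> KX * a\<^sup>2"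
      proof -
        have gen: "X v \<bullet> w \<le> norm v * KX * norm w" for v w
          using norm_cauchy_schwarz[of "X v" w] mult_right_mono[OF KX(2)[of v], of "norm w"] by simp
        show "X (a, 0) \<bullet> (0, b) \<le> KX * (\<bar>a\<bar> * norm b)" "X (0, b) \<bullet> (a, 0) \<le> KX * (\<bar>a\<bar> * norm b)" "X (a, 0) \<bullet> (a, 0) \<le> KX * a\<^sup>2"
          using gen[of "(a, 0)" "(0, b)"] gen[of "(0, b)" "(a, 0)"] gen[of "(a, 0)" "(a, 0)"]
          by (simp_all add: norm_Pair mult_ac power2_eq_square)
      qed
      moreover have "2 * (KX * (\<bar>a\<bar> * norm b)) \<le> \<kappa> * (norm b)\<^sup>2 + KX\<^sup>2 / \<kappa> * a\<^sup>2"
      proof -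
        have "0 \<le> (\<kappa> * norm b - KX * \<bar>a\<bar>)\<^sup>2 / \<kappa>" using \<kappa> by simp
        also have "\<dots> = \<kappa> * (norm b)\<^sup>2 - 2 * (KX * (\<bar>a\<bar> * norm b)) + KX\<^sup>2 / \<kappa> * a\<^sup>2"
          using \<kappa> by (simp add: power2_diff power_mult_distrib diff_divide_distrib add_divide_distrib) (simp add: power2_eq_square)
        finally show ?thesis by simp
      qed
      ultimately have 2: "X (a, b) \<bullet> (a, b) \<le> X (0, b) \<bullet> (0, b) + \<kappa> * (norm b)\<^sup>2 + KX\<^sup>2 / \<kappa> * a\<^sup>2 + KX * a\<^sup>2" by linarith
      have 3: "(norm (a, b))\<^sup>2 = a\<^sup>2 + (norm b)\<^sup>2" by (simp add: norm_Pair)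
      have 4: "p \<bullet> (a, b) = pt * a + px \<bullet> b" by (simp add: p inner_prod_def)
      have "k * a\<^sup>2 = (KX * a\<^sup>2 + KX\<^sup>2 / \<kappa> * a\<^sup>2) / 2 + \<kappa> * a\<^sup>2" by (simp add: k_def algebra_simps add_divide_distrib)
      then have "c0 + p \<bullet> (a, b) + X (a, b) \<bullet> (a, b) / 2 + \<kappa> * (norm (a, b))\<^sup>2 \<le> q s y"
        unfolding q_def a_def[symmetric] b_def[symmetric] A 3 4 using 2 by (simp add: distrib_left) argo
      then show ?thesis using 1 by linarith
    qed
    obtain KA where KA: "0 < KA" "\<And>y. norm (A *v y) \<le> norm y * KA"
      using bounded_linear.pos_bounded[OF matrix_vector_mul_bounded_linear[of A]] by blast
    define Cq where "Cq = \<bar>c0\<bar> + norm p + KA"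
    have Cq: "0 \<le> Cq" using KA by (simp add: Cq_def)
    have qlow: "- (Cq * (1 + r s y)) \<le> q s y" for s y
    proof -
      define a b where "a = s - t0" and "b = y - x0"
      have r: "r s y = a\<^sup>2 + (norm b)\<^sup>2" by (simp add: r_def a_def b_def)
      have r0: "0 \<le> r s y" by (simp add: r)
      have "- (norm p * (1 + r s y)) \<le> p \<bullet> (a, b)"
      proof -
        define N where "N = norm (a, b)"
        have "N\<^sup>2 = r s y" by (simp add: N_def norm_Pair r)
        moreover have "0 \<le> (N - 1)\<^sup>2" "0 \<le> N" by (auto simp: N_def)
        ultimately have "N \<le> 1 + r s y" by (simp add: power2_diff)
        then have "norm p * N \<le> norm p * (1 + r s y)" by (intro mult_left_mono) auto
        then show ?thesis using Cauchy_Schwarz_ineq2[of p "(a, b)"] by (simp add: N_def)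
      qed
      moreover have "p \<bullet> (a, b) = pt * a + px \<bullet> b" by (simp add: p inner_prod_def)
      moreover have "- (KA * (1 + r s y)) \<le> ((A *v b) \<bullet> b) / 2"
      proof -
        have "\<bar>(A *v b) \<bullet> b\<bar> \<le> norm b * KA * norm b"
          using Cauchy_Schwarz_ineq2[of "A *v b" b] mult_right_mono[OF KA(2)[of b], of "norm b"] by simp
        also have "\<dots> = KA * (norm b)\<^sup>2" by (simp add: power2_eq_square)
        also have "\<dots> \<le> KA * (1 + r s y)" using KA r by (intro mult_left_mono) auto
        finally have "\<bar>(A *v b) \<bullet> b\<bar> \<le> KA * (1 + r s y)" .
        moreover have "0 \<le> KA * (1 + r s y)" using KA r0 by simp
        ultimately show ?thesis by linarith
      qed
      moreover have "- (\<bar>c0\<bar> * (1 + r s y)) \<le> c0"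
      proof -
        have "\<bar>c0\<bar> * 1 \<le> \<bar>c0\<bar> * (1 + r s y)" using r0 by (intro mult_left_mono) auto
        then show ?thesis by linarith
      qed
      moreover have "0 \<le> k * a\<^sup>2" using k by simp
      moreover have "Cq * (1 + r s y) = \<bar>c0\<bar> * (1 + r s y) + norm p * (1 + r s y) + KA * (1 + r s y)"
        by (simp add: Cq_def distrib_right)
      ultimately show ?thesis unfolding q_def a_def[symmetric] b_def[symmetric] by linarith
    qed
    \<comment> \<open>Away from the point \<open>r s y\<close> is at least
      \<open>\<rho>\<^sup>2\<close>, so \<open>(r s y)\<^sup>2 / \<rho> ^ 4\<close> is at least 1
      and \<open>(r s y)\<^sup>2 / \<rho>\<^sup>2\<close> is at least \<open>r s y\<close>. The
      first summand pays for \<open>Cq\<close> and \<open>\<bar>C\<bar> * V\<close>, the second for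
      \<open>Cq * r\<close>.\<close>
    define M where "M = (Cq + \<bar>C\<bar>) / \<rho> ^ 4 + Cq / \<rho>\<^sup>2"
    have M: "0 \<le> M" using Cq \<rho> by (simp add: M_def)
    obtain Rt Rx Rxx where R: "C12_derivs {0<..<T} D (\<lambda>s y. M * ((r s y)\<^sup>2 * (1 + V s y))) Rt Rx Rxx"
      "Rt t0 x0 = 0" "Rx t0 x0 = 0" "Rxx t0 x0 = 0"
      using C12_derivs_quartic_penalty[OF V, of M t0 x0] unfolding r_def by blast
    define \<phi> where "\<phi> = (\<lambda>s y. W s y + q s y + M * ((r s y)\<^sup>2 * (1 + V s y)))"
    note d\<phi> = C12_derivs_add[OF C12_derivs_add[OF W C12_derivs_quadratic[of "{0<..<T}" D c0 pt t0 k px x0 A, folded q_def]] R(1), folded \<phi>_def]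
    have "\<phi> t0 x0 = u t0 x0" by (simp add: \<phi>_def q_def c0_def r_def)
    moreover have "\<forall>s\<in>{0<..<T}. \<forall>y\<in>D. u s y \<le> \<phi> s y"
    proof (intro ballI)
      fix s y assume sy: "s \<in> {0<..<T}" "y \<in> D"
      have V: "0 < V s y" by (rule V0[OF sy])
      show "u s y \<le> \<phi> s y"
      proof (cases "norm ((s, y) - (t0, x0)) < \<rho>")
        case True
        have "0 \<le> M * ((r s y)\<^sup>2 * (1 + V s y))" using M V by simp
        then show ?thesis using near[OF True] by (simp add: \<phi>_def)
      next
        case False
        then have "\<rho>\<^sup>2 \<le> (norm ((s, y) - (t0, x0)))\<^sup>2" using \<rho> by (intro power_mono) auto
        then have r: "\<rho>\<^sup>2 \<le> r s y" unfolding nr .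
        have \<rho>2: "0 < \<rho>\<^sup>2" using \<rho> by simp
        have "(\<rho>\<^sup>2)\<^sup>2 \<le> (r s y)\<^sup>2" using r by (intro power_mono) auto
        then have r4: "1 \<le> (r s y)\<^sup>2 / \<rho> ^ 4" using \<rho> by (simp add: power_mult[symmetric])
        have r2: "r s y \<le> (r s y)\<^sup>2 / \<rho>\<^sup>2"
        proof -
          have "r s y * \<rho>\<^sup>2 \<le> r s y * r s y" using r \<rho>2 by (intro mult_left_mono) linarith+
          then show ?thesis using \<rho>2 by (simp add: pos_le_divide_eq power2_eq_square[of "r s y"])
        qed
        have "Cq * (1 + r s y) + \<bar>C\<bar> * V s y \<le> M * ((r s y)\<^sup>2 * (1 + V s y))"
        proof -
          have a: "Cq * 1 \<le> Cq * ((r s y)\<^sup>2 / \<rho> ^ 4)" "Cq * r s y \<le> Cq * ((r s y)\<^sup>2 / \<rho>\<^sup>2)"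
            "(\<bar>C\<bar> * V s y) * 1 \<le> (\<bar>C\<bar> * V s y) * ((r s y)\<^sup>2 / \<rho> ^ 4)"
            using V Cq by (intro mult_left_mono r4 r2; simp)+
          have b: "0 \<le> \<bar>C\<bar> * ((r s y)\<^sup>2 / \<rho> ^ 4)" "0 \<le> (Cq * V s y) * ((r s y)\<^sup>2 / \<rho> ^ 4)" "0 \<le> (Cq * V s y) * ((r s y)\<^sup>2 / \<rho>\<^sup>2)"
            using Cq V by auto
          moreover have "M * ((r s y)\<^sup>2 * (1 + V s y)) = Cq * ((r s y)\<^sup>2 / \<rho> ^ 4) + Cq * ((r s y)\<^sup>2 / \<rho>\<^sup>2) + (\<bar>C\<bar> * V s y) * ((r s y)\<^sup>2 / \<rho> ^ 4)
             + \<bar>C\<bar> * ((r s y)\<^sup>2 / \<rho> ^ 4) + (Cq * V s y) * ((r s y)\<^sup>2 / \<rho> ^ 4) + (Cq * V s y) * ((r s y)\<^sup>2 / \<rho>\<^sup>2)"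
            by (simp add: M_def divide_inverse algebra_simps)
          moreover have "Cq * (1 + r s y) = Cq * 1 + Cq * r s y" by (simp add: distrib_left)
          ultimately show ?thesis using a b by linarith
        qed
        moreover have "u s y \<le> \<bar>C\<bar> * V s y"
        proof -
          have "C * V s y \<le> \<bar>C\<bar> * V s y" using V by (intro mult_right_mono) auto
          then show ?thesis using bound[OF sy] by linarith
        qed
        ultimately show ?thesis using qlow[of s y] W0[OF sy] unfolding \<phi>_def by linarith
      qed
    qed
    ultimately have "0 \<le> (Wt t0 x0 + (pt + 2 * k * (t0 - t0)) + Rt t0 x0) +
       1/2 * trace (\<sigma> t0 x0 ** transpose (\<sigma> t0 x0) ** (Wxx t0 x0 + (1/2) *\<^sub>R (A + transpose A) + Rxx t0 x0)) +
       \<mu> t0 x0 \<bullet> (Wx t0 x0 + (px + ((1/2) *\<^sub>R (A + transpose A)) *v (x0 - x0)) + Rx t0 x0) + g t0 x0"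
      using touch t0 x0 d\<phi> unfolding touching_subsolution_def by blast
    moreover have "trace (\<sigma> t0 x0 ** transpose (\<sigma> t0 x0) ** (Wxx t0 x0 + (1/2) *\<^sub>R (A + transpose A) + Rxx t0 x0))
        = trace (\<sigma> t0 x0 ** transpose (\<sigma> t0 x0) ** Wxx t0 x0) + (\<Sum>k\<in>UNIV. X (0, column k (\<sigma> t0 x0)) \<bullet> (0, column k (\<sigma> t0 x0))) + 3 * \<kappa> * E"
    proof -
      have tr: "(transpose A *v a) \<bullet> a = (A *v a) \<bullet> a" for a
        by (metis dot_lmul_matrix inner_commute transpose_matrix_vector)
      have "((Wxx t0 x0 + (1/2) *\<^sub>R (A + transpose A)) *v a) \<bullet> a = (Wxx t0 x0 *v a) \<bullet> a + (X (0, a) \<bullet> (0, a) + 3 * \<kappa> * (norm a)\<^sup>2)" for a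
        unfolding A[symmetric]
        by (simp only: matrix_vector_mult_add_rdistrib scaleR_matrix_vector_assoc[symmetric] inner_add_left inner_scaleR_left tr) simp
      then show ?thesis
        unfolding R(4) trace_mult_transpose E_def sum_distrib_left by (simp add: sum.distrib)
    qed
    ultimately show ?thesis by (simp add: R p inner_prod_def inner_add_right algebra_simps add_divide_distrib)
  qed
  have "0 \<le> ?target + e" if e: "0 < e" for e
  proof -
    define \<kappa> where "\<kappa> = e / (2 * (E + 1))"
    have "0 < \<kappa>" using e E by (simp add: \<kappa>_def)
    moreover have "3 / 2 * \<kappa> * E \<le> e" using e E by (simp add: \<kappa>_def field_simps)
    ultimately show ?thesis using main[of \<kappa>] by linarith
  qed
  then show ?thesis using field_le_epsilon by blast
qed

subsection \<open>Comparison\<close>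

lemma inner_region_subset: "inner_region D r \<subseteq> D"
  by (auto simp: inner_region_def)

lemma compact_inner_region:
  assumes r: "0 < r"
  shows "compact (inner_region D r)"
proof -
  have cl: "closed (inner_region D r)"
    unfolding closed_sequential_limits
  proof (intro allI impI, elim conjE)
    fix X x assume X: "\<forall>n. X n \<in> inner_region D r" "X \<longlonglongrightarrow> x"
    have ball: "y \<in> D" if y: "norm (y - x) < 1 / r" for y
    proof -
      have "(\<lambda>n. norm (y - X n)) \<longlonglongrightarrow> norm (y - x)" by (intro tendsto_intros X(2))
      then have "\<forall>\<^sub>F n in sequentially. norm (y - X n) < 1 / r" using y by (rule order_tendstoD(2))
      then obtain n where "norm (y - X n) < 1 / r" by (auto simp: eventually_sequentially)
      then show ?thesis using X(1) unfolding inner_region_def by auto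
    qed
    moreover have "norm x \<le> r"
      by (rule LIMSEQ_le_const2[OF tendsto_norm[OF X(2)]]) (use X(1) in \<open>auto simp: inner_region_def\<close>)
    moreover have "x \<in> D" using ball[of x] r by simp
    ultimately show "x \<in> inner_region D r" by (auto simp: inner_region_def)
  qed
  have "bounded (inner_region D r)" by (rule boundedI[of _ r]) (auto simp: inner_region_def)
  then show ?thesis using cl by (simp add: compact_eq_bounded_closed)
qed

lemma inner_region_subset_interior:
  assumes r: "0 < r" "r < R"
  shows "inner_region D r \<subseteq> interior (inner_region D R)"
proof
  fix x assume x: "x \<in> inner_region D r"
  define d where "d = min (R - r) (1 / r - 1 / R)"
  have d: "0 < d" using r by (simp add: d_def frac_less2)
  have "ball x d \<subseteq> inner_region D R"
  proof
    fix y assume "y \<in> ball x d"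
    then have y: "norm (y - x) < d" by (simp add: dist_norm norm_minus_commute)
    have "norm y \<le> R" using x y norm_triangle_sub[of y x] by (auto simp: inner_region_def d_def)
    moreover have D: "z \<in> D" if "norm (z - y) < 1 / R" for z
    proof -
      have "norm (z - x) \<le> norm (z - y) + norm (y - x)" using norm_triangle_ineq[of "z - y" "y - x"] by simp
      then have "norm (z - x) < 1 / r" using that y by (simp add: d_def)
      then show ?thesis using x by (auto simp: inner_region_def)
    qed
    moreover have "y \<in> D" using D[of y] r by simp
    ultimately show "y \<in> inner_region D R" by (auto simp: inner_region_def)
  qed
  then show "x \<in> interior (inner_region D R)" using d by (meson centre_in_ball interiorI open_ball)
qed

lemma small_outside_inner_region:
  assumes v: "vanishes_relative_to T D V h" and e: "0 < e"
    and V: "\<And>t x. t \<in> {0..T} \<Longrightarrow> x \<in> D \<Longrightarrow> V t x > 0"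
  shows "\<exists>R0>0. \<forall>R\<ge>R0. \<forall>t\<in>{0..T}. \<forall>x\<in>D - inner_region D R. \<bar>h t x\<bar> \<le> e * V t x"
proof -
  have "Limsup at_top (\<lambda>r::real. SUP t\<in>{0..T}. SUP x\<in>D - inner_region D r. ereal (\<bar>h t x\<bar> / V t x)) < ereal e"
    using v e by (simp add: vanishes_relative_to_def)
  then have "\<forall>\<^sub>F r in at_top. (SUP t\<in>{0..T}. SUP x\<in>D - inner_region D r. ereal (\<bar>h t x\<bar> / V t x)) < ereal e"
    by (rule Limsup_lessD)
  then obtain R0 where R0: "\<And>r. R0 \<le> r \<Longrightarrow> (SUP t\<in>{0..T}. SUP x\<in>D - inner_region D r. ereal (\<bar>h t x\<bar> / V t x)) < ereal e"
    by (auto simp: eventually_at_top_linorder)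
  show ?thesis
  proof (intro exI[of _ "max R0 1"] conjI allI impI ballI)
    fix R t x assume R: "max R0 1 \<le> R" and t: "t \<in> {0..T}" and x: "x \<in> D - inner_region D R"
    have "ereal (\<bar>h t x\<bar> / V t x) \<le> (SUP x\<in>D - inner_region D R. ereal (\<bar>h t x\<bar> / V t x))"
      using x by (rule SUP_upper)
    also have "\<dots> \<le> (SUP t\<in>{0..T}. SUP x\<in>D - inner_region D R. ereal (\<bar>h t x\<bar> / V t x))"
      using t by (rule SUP_upper)
    also have "\<dots> < ereal e" using R0[of R] R by simp
    finally have "\<bar>h t x\<bar> / V t x < e" by simp
    then show "\<bar>h t x\<bar> \<le> e * V t x" using V[OF t, of x] x by (simp add: pos_divide_less_eq)
  qed simp
qed

text \<open>Outside a large inner region the quotient of \<open>h\<close> and \<open>V\<close> is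
  small, and on the compact remainder it is bounded by continuity. The bound makes the supremum in
  the comparison finite and serves as the growth bound in
  \<open>superjet_inequality\<close>.\<close>

lemma dominated_by_Lyapunov:
  assumes v: "vanishes_relative_to T D V h"
    and V: "\<And>t x. t \<in> {0..T} \<Longrightarrow> x \<in> D \<Longrightarrow> V t x > 0"
    and cV: "continuous_on ({0..T} \<times> D) (\<lambda>(t, x). V t x)" and ch: "continuous_on ({0..T} \<times> D) (\<lambda>(t, x). h t x)"
  shows "\<exists>C\<ge>0. \<forall>t\<in>{0..T}. \<forall>x\<in>D. \<bar>h t x\<bar> \<le> C * V t x"
proof -
  obtain R where R: "0 < R" "\<And>t x. t \<in> {0..T} \<Longrightarrow> x \<in> D - inner_region D R \<Longrightarrow> \<bar>h t x\<bar> \<le> 1 * V t x"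
    using small_outside_inner_region[OF v zero_less_one V] by blast
  let ?K = "{0..T} \<times> inner_region D R"
  have sub: "?K \<subseteq> {0..T} \<times> D" using inner_region_subset by blast
  have "continuous_on ?K (\<lambda>z. \<bar>h (fst z) (snd z)\<bar> / V (fst z) (snd z))"
    using continuous_on_subset[OF cV sub] continuous_on_subset[OF ch sub] V sub
    by (intro continuous_on_divide continuous_on_rabs) (auto simp: split_beta less_le)
  then have "bounded ((\<lambda>z. \<bar>h (fst z) (snd z)\<bar> / V (fst z) (snd z)) ` ?K)"
    by (intro compact_imp_bounded compact_continuous_image compact_Times compact_Icc compact_inner_region R)
  then obtain C where C: "\<And>z. z \<in> ?K \<Longrightarrow> \<bar>\<bar>h (fst z) (snd z)\<bar> / V (fst z) (snd z)\<bar> \<le> C"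
    unfolding bounded_iff by (metis (no_types, lifting) image_eqI real_norm_def)
  show ?thesis
  proof (intro exI[of _ "max C 1"] conjI ballI)
    fix t x assume tx: "t \<in> {0..T}" "x \<in> D"
    have V': "0 < V t x" by (rule V[OF tx])
    show "\<bar>h t x\<bar> \<le> max C 1 * V t x"
    proof (cases "x \<in> inner_region D R")
      case True
      then have "\<bar>h t x\<bar> / V t x \<le> max C 1" using C[of "(t, x)"] tx V' by auto
      then show ?thesis using V' by (simp add: pos_divide_le_eq)
    next
      case False
      then have "\<bar>h t x\<bar> \<le> 1 * V t x" using R(2) tx by blast
      also have "\<dots> \<le> max C 1 * V t x" using V' by (intro mult_right_mono) auto
      finally show ?thesis .
    qed
  qed simp
qed

lemma norm_column_le: "norm (column k S) \<le> norm S"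
  for S :: "real^'m^'d"
proof -
  have "norm (column k S) = L2_set (\<lambda>i. norm (S $ i $ k)) UNIV" unfolding norm_vec_def[of "column k S"] by (simp add: column_def)
  also have "\<dots> \<le> L2_set (\<lambda>i. norm (S $ i)) UNIV" by (intro L2_set_mono) (auto simp: component_le_norm_cart)
  also have "\<dots> = norm S" by (rule norm_vec_def[symmetric])
  finally show ?thesis .
qed

lemma local_Lipschitz_constant:
  assumes "Sup ({ereal ((norm (\<mu> t x - \<mu> t y) + norm (\<sigma> t x - \<sigma> t y)) / norm (x - y)) | t x y.
              t \<in> {0..T} \<and> x \<in> O' \<and> y \<in> O' \<and> x \<noteq> y} \<union> {0}) < \<infinity>"
  shows "\<exists>\<Lambda>. \<forall>t\<in>{0..T}. \<forall>x\<in>O'. \<forall>y\<in>O'. norm (\<mu> t x - \<mu> t y) + norm (\<sigma> t x - \<sigma> t y) \<le> \<Lambda> * norm (x - y)"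
proof -
  let ?S = "{ereal ((norm (\<mu> t x - \<mu> t y) + norm (\<sigma> t x - \<sigma> t y)) / norm (x - y)) | t x y.
              t \<in> {0..T} \<and> x \<in> O' \<and> y \<in> O' \<and> x \<noteq> y} \<union> {0}"
  have "0 \<le> Sup ?S" by (rule Sup_upper) simp
  then obtain \<Lambda> where \<Lambda>: "Sup ?S = ereal \<Lambda>" using assms by (cases "Sup ?S") auto
  have "norm (\<mu> t x - \<mu> t y) + norm (\<sigma> t x - \<sigma> t y) \<le> \<Lambda> * norm (x - y)" if "t \<in> {0..T}" "x \<in> O'" "y \<in> O'" for t x y
  proof (cases "x = y")
    case False
    have "ereal ((norm (\<mu> t x - \<mu> t y) + norm (\<sigma> t x - \<sigma> t y)) / norm (x - y)) \<le> Sup ?S"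
      by (rule Sup_upper) (use that False in blast)
    then have "(norm (\<mu> t x - \<mu> t y) + norm (\<sigma> t x - \<sigma> t y)) / norm (x - y) \<le> \<Lambda>" unfolding \<Lambda> by simp
    then show ?thesis using False by (simp add: pos_divide_le_eq)
  qed simp
  then show ?thesis by blast
qed

section \<open>The comparison argument\<close>

lemma comparison_principle:
  fixes L T :: real
    and D :: "(real^'d) set"
    and \<mu> :: "real \<Rightarrow> real^'d \<Rightarrow> real^'d"
    and \<sigma> :: "real \<Rightarrow> real^'d \<Rightarrow> real^'m^'d"
    and f :: "real \<Rightarrow> real^'d \<Rightarrow> real \<Rightarrow> real"
    and V u1 u2 :: "real \<Rightarrow> real^'d \<Rightarrow> real"
  assumes L: "L > 0" and T: "T > 0" and D: "open D"
    and c\<mu>: "continuous_on ({0..T} \<times> D) (\<lambda>(t, x). \<mu> t x)"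
    and c\<sigma>: "continuous_on ({0..T} \<times> D) (\<lambda>(t, x). \<sigma> t x)"
    and cf: "continuous_on ({0..T} \<times> D \<times> UNIV) (\<lambda>(t, x, r). f t x r)"
    and V: "C12_on {0..T} D V" and V0: "\<And>t x. t \<in> {0..T} \<Longrightarrow> x \<in> D \<Longrightarrow> V t x > 0"
    and lip: "\<And>r::real. r > 0 \<Longrightarrow>
      Sup ({ereal ((norm (\<mu> t x - \<mu> t y) + norm (\<sigma> t x - \<sigma> t y)) / norm (x - y)) | t x y.
              t \<in> {0..T} \<and> x \<in> inner_region D r \<and> y \<in> inner_region D r \<and> x \<noteq> y} \<union> {0}) < \<infinity>"
    and mono: "\<And>t x v w. t \<in> {0..T} \<Longrightarrow> x \<in> D \<Longrightarrow> (f t x v - f t x w) * (v - w) \<le> L * \<bar>v - w\<bar>\<^sup>2"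
    and Lyap: "\<And>t x. t \<in> {0..T} \<Longrightarrow> x \<in> D \<Longrightarrow>
      time_deriv {0..T} V t x
        + 1/2 * trace (\<sigma> t x ** transpose (\<sigma> t x) ** space_hess V t x)
        + \<mu> t x \<bullet> space_grad V t x \<le> 0"
    and cu: "continuous_on ({0..T} \<times> D) (\<lambda>(t, x). u1 t x)" "continuous_on ({0..T} \<times> D) (\<lambda>(t, x). u2 t x)"
    and van: "vanishes_relative_to T D V u1" "vanishes_relative_to T D V u2"
    and sub: "touching_subsolution T D \<mu> \<sigma> (\<lambda>t x. f t x (u1 t x)) u1"
    and super: "touching_subsolution T D \<mu> \<sigma> (\<lambda>t x. - f t x (u2 t x)) (\<lambda>t x. - u2 t x)"
    and terminal: "\<And>x. x \<in> D \<Longrightarrow> u1 T x \<le> u2 T x"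
    and ts: "ts \<in> {0..T}" and xs: "xs \<in> D"
  shows "u1 ts xs \<le> u2 ts xs"
proof (rule ccontr)
  assume neg: "\<not> u1 ts xs \<le> u2 ts xs"
  have cV: "continuous_on ({0..T} \<times> D) (\<lambda>(t, x). V t x)" using V by (simp add: C12_on_def)
  obtain C1 where C1: "0 \<le> C1" "\<And>t x. t \<in> {0..T} \<Longrightarrow> x \<in> D \<Longrightarrow> \<bar>u1 t x\<bar> \<le> C1 * V t x"
    using dominated_by_Lyapunov[OF van(1) V0 cV cu(1)] by blast
  obtain C2 where C2: "0 \<le> C2" "\<And>t x. t \<in> {0..T} \<Longrightarrow> x \<in> D \<Longrightarrow> \<bar>u2 t x\<bar> \<le> C2 * V t x"
    using dominated_by_Lyapunov[OF van(2) V0 cV cu(2)] by blast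
  have diffC: "u1 t x - u2 t x \<le> (C1 + C2) * V t x" if "t \<in> {0..T}" "x \<in> D" for t x
    using C1(2)[OF that] C2(2)[OF that] by (simp add: distrib_right)
  define lam where "lam = 2 * L"
  define W where "W = (\<lambda>t x. exp (- lam * t) * V t x)"
  have W0: "0 < W t x" if "t \<in> {0..T}" "x \<in> D" for t x using V0[OF that] by (simp add: W_def)
  have VW: "exp (- lam * T) * V t x \<le> W t x" if "t \<in> {0..T}" "x \<in> D" for t x
    using V0[OF that] L that by (auto simp: W_def lam_def intro!: mult_right_mono)
  define Q where "Q = (\<lambda>z. (u1 (fst z) (snd z) - u2 (fst z) (snd z)) / W (fst z) (snd z)) ` ({0..T} \<times> D)"
  define \<theta> where "\<theta> = Sup Q"
  have Qbd: "bdd_above Q"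
  proof (rule bdd_aboveI)
    fix q assume "q \<in> Q"
    then obtain t x where q: "q = (u1 t x - u2 t x) / W t x" "t \<in> {0..T}" "x \<in> D" by (auto simp: Q_def)
    have "u1 t x - u2 t x \<le> (C1 + C2) * V t x" by (rule diffC[OF q(2,3)])
    also have "\<dots> = (C1 + C2) * exp (lam * T) * (exp (- lam * T) * V t x)" by (simp add: exp_minus)
    also have "\<dots> \<le> (C1 + C2) * exp (lam * T) * W t x"
      using VW[OF q(2,3)] C1(1) C2(1) by (intro mult_left_mono) auto
    finally show "q \<le> (C1 + C2) * exp (lam * T)" using W0[OF q(2,3)] by (simp add: q(1) pos_divide_le_eq)
  qed
  have upper: "u1 t x - u2 t x \<le> \<theta> * W t x" if "t \<in> {0..T}" "x \<in> D" for t x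
  proof -
    have "(u1 t x - u2 t x) / W t x \<in> Q" unfolding Q_def using that by (intro image_eqI[of _ _ "(t, x)"]) auto
    then have "(u1 t x - u2 t x) / W t x \<le> \<theta>" unfolding \<theta>_def using Qbd by (rule cSup_upper)
    then show ?thesis using W0[OF that] by (simp add: pos_divide_le_eq)
  qed
  have \<theta>: "0 < \<theta>"
  proof -
    have "0 < \<theta> * W ts xs" using upper[OF ts xs] neg by linarith
    then show ?thesis using W0[OF ts xs] by (simp add: zero_less_mult_iff)
  qed
  \<comment> \<open>The factor has to lie strictly between 1/2 and 1: below 1 the difference still
    exceeds \<open>\<delta> * W\<close> somewhere, above 1/2 the gain \<open>lam * \<delta>\<close>
    exceeds \<open>L * \<theta>\<close>.\<close>
  define \<delta> where "\<delta> = 3 / 4 * \<theta>"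
  have \<delta>: "0 < \<delta>" "\<delta> < \<theta>" using \<theta> by (auto simp: \<delta>_def)
  have "Q \<noteq> {}" using ts xs by (auto simp: Q_def)
  then obtain q where q: "q \<in> Q" "\<delta> < q" using less_cSupD[of Q \<delta>] \<delta>(2) by (auto simp: \<theta>_def)
  then obtain z1 where z1: "z1 \<in> {0..T} \<times> D" "q = (u1 (fst z1) (snd z1) - u2 (fst z1) (snd z1)) / W (fst z1) (snd z1)"
    unfolding Q_def by blast
  define t1 x1 where "t1 = fst z1" and "x1 = snd z1"
  have t1: "t1 \<in> {0..T}" and x1: "x1 \<in> D" and "\<delta> < (u1 t1 x1 - u2 t1 x1) / W t1 x1"
    using z1 q(2) by (auto simp: t1_def x1_def)
  then have h1: "0 < u1 t1 x1 - u2 t1 x1 - \<delta> * W t1 x1" using W0[OF t1 x1] by (simp add: pos_less_divide_eq)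
  define h where "h = (\<lambda>s. u1 s x1 - u2 s x1 - \<delta> * W s x1)"
  have ch: "continuous_on {0..T} h"
  proof -
    have c: "continuous_on {0..T} (\<lambda>s. k s x1)" if "continuous_on ({0..T} \<times> D) (\<lambda>(t, x). k t x)" for k :: "real \<Rightarrow> real^'d \<Rightarrow> real"
    proof -
      have "continuous_on {0..T} (\<lambda>s. (s, x1))" by (intro continuous_intros)
      then have "continuous_on {0..T} (\<lambda>s. (\<lambda>(t, x). k t x) (s, x1))"
        by (rule continuous_on_compose2[OF that]) (use x1 in auto)
      then show ?thesis by simp
    qed
    show ?thesis unfolding h_def W_def by (intro continuous_intros c cu cV)
  qed
  have "t1 < T"
  proof (rule ccontr)
    assume "\<not> t1 < T"
    then have "t1 = T" using t1 by auto
    then show False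
      using h1 terminal[OF x1] mult_pos_pos[OF \<delta>(1) W0[OF t1 x1]] unfolding \<open>t1 = T\<close> by linarith
  qed
  \<comment> \<open>\<open>t1\<close> may be 0, where the penalty \<open>\<eta> / t\<close> cannot
    be used; by continuity \<open>h\<close> is still positive slightly later.\<close>
  obtain t2 where t2: "0 < t2" "t2 < T" "0 < h t2"
  proof -
    obtain d where d: "0 < d" "\<And>s. s \<in> {0..T} \<Longrightarrow> dist s t1 < d \<Longrightarrow> dist (h s) (h t1) < h t1"
      using ch t1 h1 unfolding continuous_on_iff h_def[symmetric] by (metis h_def)
    define s where "s = min (t1 + d / 2) ((t1 + T) / 2)"
    have s: "t1 < s" "s < T" "s - t1 < d" using d(1) \<open>t1 < T\<close> by (auto simp: s_def min_def)
    then have "dist (h s) (h t1) < h t1" using t1 by (intro d(2)) (auto simp: dist_real_def)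
    then have "0 < h s" by (simp add: dist_real_def)
    then show thesis using that[of s] s t1 by auto
  qed
  \<comment> \<open>The penalty takes half of the gap, so that \<open>G t2 x1 = h t2 / 2\<close>
    stays positive.\<close>
  define \<eta> where "\<eta> = h t2 * t2 / 2"
  have \<eta>: "0 < \<eta>" using t2 by (simp add: \<eta>_def)
  define Wd where "Wd = (\<lambda>t x. \<delta> * exp (- lam * t) * V t x + \<eta> / t)"
  have WdW: "Wd t x = \<delta> * W t x + \<eta> / t" for t x by (simp add: Wd_def W_def)
  define G where "G = (\<lambda>t x. u1 t x - u2 t x - Wd t x)"
  have "G t2 x1 = h t2 - \<eta> / t2" by (simp add: G_def WdW h_def)
  moreover have "\<eta> / t2 = h t2 / 2" using t2 by (simp add: \<eta>_def)
  ultimately have G2: "0 < G t2 x1" using t2(3) by linarith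
  \<comment> \<open>\<open>u1\<close> and \<open>- u2\<close> may each use half of
    \<open>\<delta> * W\<close> outside a large inner region; \<open>exp (- lam * T)\<close> is the
    least value of the weight on \<open>{0..T}\<close>.\<close>
  define e where "e = \<delta> * exp (- lam * T) / 2"
  have e: "0 < e" using \<delta> by (simp add: e_def)
  obtain R1 where R1: "0 < R1" "\<And>R t x. R1 \<le> R \<Longrightarrow> t \<in> {0..T} \<Longrightarrow> x \<in> D - inner_region D R \<Longrightarrow> \<bar>u1 t x\<bar> \<le> e * V t x"
    using small_outside_inner_region[OF van(1) e V0] by blast
  obtain R2 where R2: "0 < R2" "\<And>R t x. R2 \<le> R \<Longrightarrow> t \<in> {0..T} \<Longrightarrow> x \<in> D - inner_region D R \<Longrightarrow> \<bar>u2 t x\<bar> \<le> e * V t x"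
    using small_outside_inner_region[OF van(2) e V0] by blast
  define R where "R = max R1 R2"
  have R: "0 < R" using R1 by (simp add: R_def)
  have Gout: "G t x < 0" if "0 < t" "t \<le> T" "x \<in> D" "x \<notin> inner_region D R" for t x
  proof -
    have t: "t \<in> {0..T}" using that by auto
    have "u1 t x - u2 t x \<le> 2 * (e * V t x)"
      using R1(2)[of R t x] R2(2)[of R t x] that t by (auto simp: R_def)
    also have "\<dots> = \<delta> * (exp (- lam * T) * V t x)" by (simp add: e_def)
    also have "\<dots> \<le> \<delta> * W t x" using VW[OF t that(3)] \<delta> by (intro mult_left_mono) auto
    finally show ?thesis using \<eta> that(1) divide_pos_pos[of \<eta> t] unfolding G_def WdW by linarith
  qed
  obtain Vm where Vm: "\<And>t x. t \<in> {0..T} \<Longrightarrow> x \<in> inner_region D R \<Longrightarrow> V t x \<le> Vm"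
  proof -
    have "continuous_on ({0..T} \<times> inner_region D R) (\<lambda>(t, x). V t x)"
      by (rule continuous_on_subset[OF cV]) (use inner_region_subset in blast)
    then have "bounded ((\<lambda>(t, x). V t x) ` ({0..T} \<times> inner_region D R))"
      by (intro compact_imp_bounded compact_continuous_image compact_Times compact_Icc compact_inner_region R)
    then obtain B where "\<And>z. z \<in> (\<lambda>(t, x). V t x) ` ({0..T} \<times> inner_region D R) \<Longrightarrow> norm z \<le> B"
      unfolding bounded_iff by blast
    then have "\<bar>V t x\<bar> \<le> B" if "t \<in> {0..T}" "x \<in> inner_region D R" for t x using that by fastforce
    then show thesis using that[of B] by (metis abs_le_D1)
  qed
  define B where "B = (C1 + C2) * \<bar>Vm\<bar>"
  have B: "0 \<le> B" using C1 C2 by (simp add: B_def)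
  \<comment> \<open>For times up to \<open>\<tau>\<close> the term \<open>\<eta> / t\<close> exceeds
    \<open>B\<close>, an upper bound for \<open>u1 - u2\<close> on the inner region.\<close>
  define \<tau> where "\<tau> = min (T / 2) (\<eta> / (B + 1))"
  have \<tau>: "0 < \<tau>" "\<tau> < T" using \<eta> B T by (auto simp: \<tau>_def)
  have Gsmall: "G t x < 0" if "0 < t" "t \<le> \<tau>" "x \<in> D" for t x
  proof (cases "x \<in> inner_region D R")
    case True
    have t: "t \<in> {0..T}" using that \<tau> by auto
    have "u1 t x - u2 t x \<le> (C1 + C2) * V t x" by (rule diffC[OF t that(3)])
    also have "\<dots> \<le> B" unfolding B_def using Vm[OF t True] C1 C2 by (intro mult_left_mono) auto
    also have "B < \<eta> / t"
    proof -
      have "t \<le> \<eta> / (B + 1)" using that by (simp add: \<tau>_def)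
      then have "t * (B + 1) \<le> \<eta>" using B by (simp add: pos_le_divide_eq)
      then show ?thesis using that(1) by (simp add: pos_less_divide_eq algebra_simps)
    qed
    finally show ?thesis using mult_pos_pos[OF \<delta>(1) W0[OF t that(3)]] unfolding G_def WdW by linarith
  qed (use Gout[of t x] that \<tau> in auto)
  have GT: "G T x < 0" if "x \<in> D" for x
    using terminal[OF that] mult_pos_pos[OF \<delta>(1) W0[OF _ that, of T]] divide_pos_pos[OF \<eta> T] T unfolding G_def WdW by auto
  \<comment> \<open>The margin 1 places the inner region of radius \<open>R\<close>, outside which
    \<open>G\<close> is negative, into the interior. As \<open>G\<close> is also negative at times
    \<open>\<tau>\<close> and \<open>T\<close>, a positive maximum is an interior one.\<close>
  define K where "K = {\<tau>..T} \<times> inner_region D (R + 1)"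
  have Ksub: "K \<subseteq> {0..T} \<times> D" unfolding K_def using \<tau> inner_region_subset by fastforce
  have KD: "fst z \<in> {0..T}" "snd z \<in> D" "fst z \<noteq> 0" if "z \<in> K" for z
    using that Ksub \<tau> by (auto simp: K_def)
  have z2: "(t2, x1) \<in> K"
  proof -
    have "\<tau> < t2" using Gsmall[OF t2(1) _ x1] G2 by (meson less_asym not_less)
    moreover have "x1 \<in> inner_region D R" using Gout[OF t2(1) _ x1] t2 G2 by (meson less_asym less_imp_le)
    then have "x1 \<in> inner_region D (R + 1)" using inner_region_subset_interior[OF R, of "R + 1" D] interior_subset by fastforce
    ultimately show ?thesis using t2 by (simp add: K_def)
  qed
  have Kc: "compact K" unfolding K_def using R by (intro compact_Times compact_Icc compact_inner_region) auto
  have cK: "continuous_on K (\<lambda>z. k (fst z) (snd z))" if "continuous_on ({0..T} \<times> D) (\<lambda>(t, x). k t x)"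
    for k :: "real \<Rightarrow> real^'d \<Rightarrow> 'z::topological_space"
    using continuous_on_subset[OF that Ksub] by (simp add: split_beta)
  have cW: "continuous_on K (\<lambda>z. W (fst z) (snd z))"
    unfolding W_def by (intro continuous_intros cK cV)
  have cfu: "continuous_on K (\<lambda>z. f (fst z) (snd z) (u (fst z) (snd z)))"
    if "continuous_on ({0..T} \<times> D) (\<lambda>(t, x). u t x)" for u
  proof -
    have "continuous_on K (\<lambda>z. (fst z, snd z, u (fst z) (snd z)))" by (intro continuous_intros cK that)
    then have "continuous_on K (\<lambda>z. (\<lambda>(t, x, r). f t x r) (fst z, snd z, u (fst z) (snd z)))"
      by (rule continuous_on_compose2[OF cf]) (use KD in auto)
    then show ?thesis by simp
  qed
  obtain \<Lambda> where \<Lambda>: "\<And>t x y. t \<in> {0..T} \<Longrightarrow> x \<in> inner_region D (R + 1) \<Longrightarrow> y \<in> inner_region D (R + 1) \<Longrightarrow>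
     norm (\<mu> t x - \<mu> t y) + norm (\<sigma> t x - \<sigma> t y) \<le> \<Lambda> * norm (x - y)"
    using local_Lipschitz_constant[OF lip[of "R + 1"]] R by (metis add_pos_pos zero_less_one)
  have dV: "C12_derivs {0<..<T} D V (time_deriv {0..T} V) (space_grad V) (space_hess V)"
    by (rule C12_derivs_if_C12_on[OF V]) auto
  have dE: "C12_derivs {0<..<T} D (\<lambda>t x. \<delta> * exp (- lam * t)) (\<lambda>t x. - lam * (\<delta> * exp (- lam * t))) (\<lambda>t x. 0) (\<lambda>t x. 0)"
    by (rule C12_derivs_time) (auto intro!: derivative_eq_intros continuous_intros)
  have d\<eta>: "C12_derivs {0<..<T} D (\<lambda>t x. \<eta> / t) (\<lambda>t x. - \<eta> / t\<^sup>2) (\<lambda>t x. 0) (\<lambda>t x. 0)"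
    by (rule C12_derivs_time) (auto intro!: derivative_eq_intros continuous_intros simp: power2_eq_square)
  have dWd: "C12_derivs {0<..<T} D Wd
     (\<lambda>t x. - lam * (\<delta> * exp (- lam * t)) * V t x + \<delta> * exp (- lam * t) * time_deriv {0..T} V t x + - \<eta> / t\<^sup>2)
     (\<lambda>t x. (\<delta> * exp (- lam * t)) *\<^sub>R space_grad V t x) (\<lambda>t x. (\<delta> * exp (- lam * t)) *\<^sub>R space_hess V t x)"
  proof -
    have o: "outer 0 a = 0" "outer a 0 = 0" for a :: "real^'d" by (simp_all add: outer_def vec_eq_iff)
    show ?thesis
      using C12_derivs_add[OF C12_derivs_mult[OF dE dV] d\<eta>] by (simp add: Wd_def o)
  qed
  have d0: "C12_derivs {0<..<T} D (\<lambda>t x. 0) (\<lambda>t x. 0) (\<lambda>t x. 0) (\<lambda>t x. 0)"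
    by (rule C12_derivs_time) auto
  \<comment> \<open>All of \<open>Wd\<close> is subtracted from \<open>u1\<close>. By the Lyapunov
    inequality the linear operator applied to \<open>Wd\<close> is at most
    \<open>- lam * \<delta> * W\<close>, and this gain is all that \<open>Wd\<close> leaves in the
    sources.\<close>
  have "\<exists>z\<in>K. (\<forall>a\<in>K. (u1 (fst a) (snd a) - Wd (fst a) (snd a)) + - u2 (fst a) (snd a) \<le> (u1 (fst z) (snd z) - Wd (fst z) (snd z)) + - u2 (fst z) (snd z)) \<and>
     (z \<in> interior K \<longrightarrow> 0 \<le> (f (fst z) (snd z) (u1 (fst z) (snd z)) - lam * \<delta> * W (fst z) (snd z)) + - f (fst z) (snd z) (u2 (fst z) (snd z)))"
  proof (rule viscosity_maximum_principle[where m="\<lambda>z. \<mu> (fst z) (snd z)" and \<sigma>="\<lambda>k z. column k (\<sigma> (fst z) (snd z))" and \<Lambda>=\<Lambda>])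
    show "compact K" by (rule Kc)
    show "K \<noteq> {}" using z2 by blast
    show "continuous_on K (\<lambda>a. u1 (fst a) (snd a) - Wd (fst a) (snd a))"
      unfolding WdW by (intro continuous_intros cK cu cW) (use KD in auto)
    show "continuous_on K (\<lambda>a. - u2 (fst a) (snd a))" by (intro continuous_intros cK cu)
    show "continuous_on K (\<lambda>z. \<mu> (fst z) (snd z))" by (intro cK c\<mu>)
    show "continuous_on K (\<lambda>z. column k (\<sigma> (fst z) (snd z)))" for k
      unfolding column_def by (intro continuous_intros cK c\<sigma>)
    show "continuous_on K (\<lambda>z. f (fst z) (snd z) (u1 (fst z) (snd z)) - lam * \<delta> * W (fst z) (snd z))"
      by (intro continuous_intros cfu cu cW)
    show "continuous_on K (\<lambda>z. - f (fst z) (snd z) (u2 (fst z) (snd z)))"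
      by (intro continuous_intros cfu cu)
  next
    fix x y assume xy: "x \<in> K" "y \<in> K" "fst x = fst y"
    have "snd x \<in> inner_region D (R + 1)" "snd y \<in> inner_region D (R + 1)" using xy by (auto simp: K_def)
    then have l: "norm (\<mu> (fst x) (snd x) - \<mu> (fst y) (snd y)) + norm (\<sigma> (fst x) (snd x) - \<sigma> (fst y) (snd y)) \<le> \<Lambda> * norm (snd x - snd y)"
      using \<Lambda>[OF KD(1)[OF xy(1)], of "snd x" "snd y"] xy(3) by simp
    then show "norm (\<mu> (fst x) (snd x) - \<mu> (fst y) (snd y)) \<le> \<Lambda> * norm (snd x - snd y)"
      using norm_ge_zero[of "\<sigma> (fst x) (snd x) - \<sigma> (fst y) (snd y)"] by linarith
    fix k
    have "column k (\<sigma> (fst x) (snd x)) - column k (\<sigma> (fst y) (snd y)) = column k (\<sigma> (fst x) (snd x) - \<sigma> (fst y) (snd y))"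
      by (simp add: column_def vec_eq_iff)
    then show "norm (column k (\<sigma> (fst x) (snd x)) - column k (\<sigma> (fst y) (snd y))) \<le> \<Lambda> * norm (snd x - snd y)"
      using l norm_column_le[of k "\<sigma> (fst x) (snd x) - \<sigma> (fst y) (snd y)"]
        norm_ge_zero[of "\<mu> (fst x) (snd x) - \<mu> (fst y) (snd y)"] by (simp only:)
  next
    fix z p X assume z: "z \<in> interior K" and jet: "superjet K (\<lambda>a. u1 (fst a) (snd a) - Wd (fst a) (snd a)) z p X"
    obtain t x where tx: "z = (t, x)" by (cases z)
    have zK: "z \<in> K" using z interior_subset by blast
    have t: "t \<in> {0..T}" and x: "x \<in> D" using KD[OF zK] by (auto simp: tx)
    have "0 \<le> (1, \<mu> t x) \<bullet> p + (\<Sum>k\<in>UNIV. X (0, column k (\<sigma> t x)) \<bullet> (0, column k (\<sigma> t x))) / 2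
     + ((- lam * (\<delta> * exp (- lam * t)) * V t x + \<delta> * exp (- lam * t) * time_deriv {0..T} V t x + - \<eta> / t\<^sup>2)
       + 1/2 * trace (\<sigma> t x ** transpose (\<sigma> t x) ** ((\<delta> * exp (- lam * t)) *\<^sub>R space_hess V t x))
       + \<mu> t x \<bullet> ((\<delta> * exp (- lam * t)) *\<^sub>R space_grad V t x) + f t x (u1 t x))"
    proof (rule superjet_inequality[OF sub dWd _ dV _ _ Ksub D])
      show "0 \<le> Wd s y" if "s \<in> {0<..<T}" "y \<in> D" for s y
        using W0[of s y] \<delta> \<eta> that by (simp add: WdW)
      show "0 < V s y" if "s \<in> {0<..<T}" "y \<in> D" for s y using V0[of s y] that by simp
      show "u1 s y \<le> C1 * V s y" if "s \<in> {0<..<T}" "y \<in> D" for s y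
        using C1(2)[of s y] that by auto
    qed (use z jet tx in auto)
    moreover have "(- lam * (\<delta> * exp (- lam * t)) * V t x + \<delta> * exp (- lam * t) * time_deriv {0..T} V t x + - \<eta> / t\<^sup>2)
       + 1/2 * trace (\<sigma> t x ** transpose (\<sigma> t x) ** ((\<delta> * exp (- lam * t)) *\<^sub>R space_hess V t x))
       + \<mu> t x \<bullet> ((\<delta> * exp (- lam * t)) *\<^sub>R space_grad V t x) \<le> - (lam * \<delta> * W t x)"
    proof -
      define a where "a = \<delta> * exp (- lam * t)"
      have a: "0 < a" using \<delta> by (simp add: a_def)
      have tr: "trace (\<sigma> t x ** transpose (\<sigma> t x) ** (a *\<^sub>R space_hess V t x)) = a * trace (\<sigma> t x ** transpose (\<sigma> t x) ** space_hess V t x)"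
        by (simp add: trace_mult_transpose scaleR_matrix_vector_assoc[symmetric] sum_distrib_left)
      have i: "a * (time_deriv {0..T} V t x + 1/2 * trace (\<sigma> t x ** transpose (\<sigma> t x) ** space_hess V t x) + \<mu> t x \<bullet> space_grad V t x) \<le> 0"
        using Lyap[OF t x] a by (simp add: mult_le_0_iff)
      have j: "0 \<le> \<eta> / t\<^sup>2" using \<eta> by simp
      have W: "lam * \<delta> * W t x = lam * a * V t x" by (simp add: W_def a_def)
      show ?thesis
        using i j unfolding a_def[symmetric] tr W by (simp add: algebra_simps)
    qed
    ultimately show "0 \<le> (1, \<mu> (fst z) (snd z)) \<bullet> p +
         (\<Sum>k\<in>UNIV. X (0, column k (\<sigma> (fst z) (snd z))) \<bullet> (0, column k (\<sigma> (fst z) (snd z)))) / 2 +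
         (f (fst z) (snd z) (u1 (fst z) (snd z)) - lam * \<delta> * W (fst z) (snd z))"
      unfolding tx fst_conv snd_conv by linarith
  next
    fix z p X assume z: "z \<in> interior K" and jet: "superjet K (\<lambda>a. - u2 (fst a) (snd a)) z p X"
    obtain t x where tx: "z = (t, x)" by (cases z)
    have "0 \<le> (1, \<mu> t x) \<bullet> p + (\<Sum>k\<in>UNIV. X (0, column k (\<sigma> t x)) \<bullet> (0, column k (\<sigma> t x))) / 2
     + (0 + 1/2 * trace (\<sigma> t x ** transpose (\<sigma> t x) ** 0) + \<mu> t x \<bullet> 0 + - f t x (u2 t x))"
    proof (rule superjet_inequality[OF super d0 _ dV _ _ Ksub D])
      show "0 < V s y" if "s \<in> {0<..<T}" "y \<in> D" for s y using V0[of s y] that by simp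
      show "- u2 s y \<le> C2 * V s y" if "s \<in> {0<..<T}" "y \<in> D" for s y
        using C2(2)[of s y] that by auto
    qed (use z jet tx in auto)
    moreover have "trace (\<sigma> t x ** transpose (\<sigma> t x) ** 0) = 0" by (simp add: trace_def)
    ultimately show "0 \<le> (1, \<mu> (fst z) (snd z)) \<bullet> p +
         (\<Sum>k\<in>UNIV. X (0, column k (\<sigma> (fst z) (snd z))) \<bullet> (0, column k (\<sigma> (fst z) (snd z)))) / 2 +
         - f (fst z) (snd z) (u2 (fst z) (snd z))"
      unfolding tx fst_conv snd_conv by simp
  qed
  then obtain t x where zK: "(t, x) \<in> K" and max: "G t2 x1 \<le> G t x"
    and ineq: "(t, x) \<in> interior K \<Longrightarrow> 0 \<le> (f t x (u1 t x) - lam * \<delta> * W t x) + - f t x (u2 t x)"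
    using z2 by (force simp: G_def)
  have Gpos: "0 < G t x" using max G2 by linarith
  have t: "t \<in> {0..T}" and x: "x \<in> D" and t0: "0 < t" using KD[OF zK] by auto
  have "\<tau> < t" using Gsmall[OF t0 _ x] Gpos by (meson less_asym not_less)
  moreover have "t < T" using GT[OF x] Gpos t by (cases "t = T") auto
  moreover have "x \<in> interior (inner_region D (R + 1))"
    using Gout[OF t0 _ x] Gpos t inner_region_subset_interior[OF R, of "R + 1" D] by fastforce
  ultimately have "(t, x) \<in> interior K" by (simp add: K_def interior_Times)
  then have 1: "lam * \<delta> * W t x \<le> f t x (u1 t x) - f t x (u2 t x)" using ineq by linarith
  define w where "w = u1 t x - u2 t x"
  have "0 < Wd t x" using mult_pos_pos[OF \<delta>(1) W0[OF t x]] divide_pos_pos[OF \<eta> t0] unfolding WdW by linarith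
  then have w: "0 < w" using Gpos by (simp add: w_def G_def)
  have "(f t x (u1 t x) - f t x (u2 t x)) * w \<le> L * w * w"
    using mono[OF t x, of "u1 t x" "u2 t x"] by (simp add: w_def power2_eq_square mult.assoc)
  then have "f t x (u1 t x) - f t x (u2 t x) \<le> L * w" using w by simp
  \<comment> \<open>Positivity of \<open>G\<close> bounds \<open>w\<close> only from below; the
    upper bound is where \<open>\<theta>\<close> being a supremum matters.\<close>
  also have "\<dots> \<le> L * (\<theta> * W t x)" using upper[OF t x] L by (intro mult_left_mono) (auto simp: w_def)
  finally have "lam * \<delta> * W t x \<le> L * (\<theta> * W t x)" using 1 by linarith
  moreover have "lam * \<delta> * W t x = 3 / 2 * (L * (\<theta> * W t x))" by (simp add: lam_def \<delta>_def)
  moreover have "0 < L * (\<theta> * W t x)" using L \<theta> W0[OF t x] by simp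
  ultimately show False by linarith
qed

theorem proposition3p5:
  fixes L T :: real
    and D :: "(real^'d) set"
    and \<mu> :: "real \<Rightarrow> real^'d \<Rightarrow> real^'d"
    and \<sigma> :: "real \<Rightarrow> real^'d \<Rightarrow> real^'m^'d"
    and f :: "real \<Rightarrow> real^'d \<Rightarrow> real \<Rightarrow> real"
    and g :: "real^'d \<Rightarrow> real"
    and V u1 u2 :: "real \<Rightarrow> real^'d \<Rightarrow> real"
  assumes "L > 0" and "T > 0"
    and "open D" and "D \<noteq> {}"
    and "continuous_on ({0..T} \<times> D) (\<lambda>(t, x). \<mu> t x)"
    and "continuous_on ({0..T} \<times> D) (\<lambda>(t, x). \<sigma> t x)"
    and "continuous_on ({0..T} \<times> D \<times> UNIV) (\<lambda>(t, x, r). f t x r)"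
    and "continuous_on D g"
    and "C12_on {0..T} D V"
    and "\<And>t x. t \<in> {0..T} \<Longrightarrow> x \<in> D \<Longrightarrow> V t x > 0"
    and "\<And>r::real. r > 0 \<Longrightarrow>
      Sup ({ereal ((norm (\<mu> t x - \<mu> t y) + norm (\<sigma> t x - \<sigma> t y)) / norm (x - y)) | t x y.
              t \<in> {0..T} \<and> x \<in> inner_region D r \<and> y \<in> inner_region D r \<and> x \<noteq> y} \<union> {0}) < \<infinity>"
    and "\<And>t x v w. t \<in> {0..T} \<Longrightarrow> x \<in> D \<Longrightarrow> (f t x v - f t x w) * (v - w) \<le> L * \<bar>v - w\<bar>\<^sup>2"
    and "vanishes_relative_to T D V (\<lambda>t x. f t x 0)"
    and "\<And>t x. t \<in> {0..T} \<Longrightarrow> x \<in> D \<Longrightarrow>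
      time_deriv {0..T} V t x
        + 1/2 * trace (\<sigma> t x ** transpose (\<sigma> t x) ** space_hess V t x)
        + \<mu> t x \<bullet> space_grad V t x \<le> 0"
    and "\<And>u. u \<in> {u1, u2} \<Longrightarrow> continuous_on ({0..T} \<times> D) (\<lambda>(t, x). u t x)"
    and "\<And>u. u \<in> {u1, u2} \<Longrightarrow> vanishes_relative_to T D V u"
    and "\<And>u. u \<in> {u1, u2} \<Longrightarrow> viscosity_solution T D ({0..T} \<times> D) (semilinear_op \<mu> \<sigma> f) u"
    and "\<And>u x. u \<in> {u1, u2} \<Longrightarrow> x \<in> D \<Longrightarrow> u T x = g x"
  shows "\<forall>t\<in>{0..T}. \<forall>x\<in>D. u1 t x = u2 t x"
proof -
  have le: "u t x \<le> v t x" if "u \<in> {u1, u2}" "v \<in> {u1, u2}" "t \<in> {0..T}" "x \<in> D" for u v t x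
  proof (rule comparison_principle[where ?u1.0 = u and ?u2.0 = v, OF assms(1-3,5-7,9-12,14)])
    show "touching_subsolution T D \<mu> \<sigma> (\<lambda>t x. f t x (u t x)) u"
      using assms(17)[OF that(1)] assms(3)
      by (auto simp: viscosity_solution_def intro: touching_subsolution_if_viscosity_subsolution)
    show "touching_subsolution T D \<mu> \<sigma> (\<lambda>t x. - f t x (v t x)) (\<lambda>t x. - v t x)"
      using assms(17)[OF that(2)] assms(3)
      by (auto simp: viscosity_solution_def intro: touching_subsolution_if_viscosity_supersolution)
    show "u T y \<le> v T y" if "y \<in> D" for y
      using assms(18)[OF \<open>u \<in> {u1, u2}\<close> that] assms(18)[OF \<open>v \<in> {u1, u2}\<close> that] by simp
  qed (use that assms(15,16) in auto)
  show ?thesis by (intro ballI antisym le) auto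
qed

end
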